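(* Let $d\ge 1$ and let $G$ be a $(d+1)$-connected graph. If $G$ is generically globally rigid in $\mathbb{R}^d$, then any generic framework $(G,p)$ in $\mathbb{R}^d$ has an equilibrium stress matrix in $\mathrm{Gstr}$, and thus is Gstressable.
   Context: Graphs are finite and simple, with vertex set $\{1,\dots,n\}$. A graph is $k$-connected if it has at least $k+1$ vertices and remains connected after deleting any set of fewer than $k$ vertices. A framework $(G,p)$ in $\mathbb{R}^d$ is $G$ with a configuration $p=(p_1,\dots,p_n)$ of points of $\mathbb{R}^d$. Frameworks $(G,p)$ and $(G,q)$ in $\mathbb{R}^d$ are equivalent if $\|p_i-p_j\|=\|q_i-q_j\|$ for all edges $\{i,j\}$, and congruent if $q_i=T(p_i)$ for all $i$ for some Euclidean motion $T$ of $\mathbb{R}^d$. $(G,p)$ is globally rigid if every $(G,q)$ in $\mathbb{R}^d$ equivalent to it is congruent to it. A configuration is generic if its coordinates are algebraically independent over $\mathbb{Q}$. $G$ is generically globally rigid in $\mathbb{R}^d$ if every generic framework $(G,p)$ in $\mathbb{R}^d$ is globally rigid. An equilibrium stress matrix of $(G,p)$ is a real symmetric $n\times n$ matrix $\Omega$ with $\Omega_{ij}=0$ whenever $i\neq j$ and $\{i,j\}$ is not an edge, with the all-ones vector in its kernel, and with $\sum_j\Omega_{ij}p_j=0$ for all $i$. $\mathrm{Gstr}$ is the set of real symmetric $n\times n$ matrices $\Omega$ such that $\Omega_{ij}=0$ whenever $i\ne j$ and $\{i,j\}$ is not an edge of $G$; the all-ones vector is in the kernel; $\operatorname{rank}\Omega=n-d-1$;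 and every subset of $n-d-1$ columns is linearly independent. $p$ is in affine general position if no $k\le d+1$ of its points lie on a $(k-2)$-dimensional affine subspace. $(G,p)$ is Gstressable if $p$ is in affine general position and $(G,p)$ has an equilibrium stress matrix of rank $n-d-1$. *)

theory Defs
  imports "HOL-Analysis.Analysis" "HOL-Library.Poly_Mapping"
begin

text \<open>
  The finite type \<open>'n\<close> is the vertex set, so \<open>CARD('n)\<close> is the number of vertices $n$; the finite
  type \<open>'d\<close> indexes the coordinates of $\mathbb{R}^d$, so \<open>CARD('d)\<close> is $d \ge 1$. A graph is given
  by its set of edges, each edge being an unordered pair of distinct vertices.
\<close>

definition simple_graph :: "'n::finite set set \<Rightarrow> bool" where
  "simple_graph E \<longleftrightarrow> (\<forall>e\<in>E. card e = 2)"

definition induced_connected :: "'n::finite set set \<Rightarrow> 'n set \<Rightarrow> bool" where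
  "induced_connected E W \<longleftrightarrow>
    (\<forall>u\<in>W. \<forall>v\<in>W. (u, v) \<in> {(x, y). x \<in> W \<and> y \<in> W \<and> {x, y} \<in> E}\<^sup>*)"

definition k_connected :: "nat \<Rightarrow> 'n::finite set set \<Rightarrow> bool" where
  "k_connected k E \<longleftrightarrow>
    CARD('n) \<ge> k + 1 \<and> (\<forall>S. card S < k \<longrightarrow> induced_connected E (- S))"

definition equivalent_frameworks ::
    "'n::finite set set \<Rightarrow> ('n \<Rightarrow> real ^ 'd) \<Rightarrow> ('n \<Rightarrow> real ^ 'd) \<Rightarrow> bool" where
  "equivalent_frameworks E p q \<longleftrightarrow>
    (\<forall>i j. {i, j} \<in> E \<longrightarrow> norm (p i - p j) = norm (q i - q j))"

text \<open>Reflections count as Euclidean motions.\<close>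

definition euclidean_motion :: "(real ^ 'd \<Rightarrow> real ^ 'd) \<Rightarrow> bool" where
  "euclidean_motion T \<longleftrightarrow>
    (\<exists>a f. orthogonal_transformation f \<and> T = (\<lambda>x. a + f x))"

definition congruent_frameworks ::
    "('n::finite \<Rightarrow> real ^ 'd) \<Rightarrow> ('n \<Rightarrow> real ^ 'd) \<Rightarrow> bool" where
  "congruent_frameworks p q \<longleftrightarrow> (\<exists>T. euclidean_motion T \<and> (\<forall>i. q i = T (p i)))"

definition globally_rigid :: "'n::finite set set \<Rightarrow> ('n \<Rightarrow> real ^ 'd) \<Rightarrow> bool" where
  "globally_rigid E p \<longleftrightarrow>
    (\<forall>q. equivalent_frameworks E p q \<longrightarrow> congruent_frameworks p q)"

text \<open>
  A polynomial over $\mathbb{Q}$ in variables of type \<open>'v\<close> is a finitely supported map from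
  monomials to coefficients, a monomial being a finitely supported map from variables to exponents.
\<close>

definition poly_eval_rat :: "(('v \<Rightarrow>\<^sub>0 nat) \<Rightarrow>\<^sub>0 rat) \<Rightarrow> ('v \<Rightarrow> real) \<Rightarrow> real" where
  "poly_eval_rat P x =
    (\<Sum>m\<in>Poly_Mapping.keys P. of_rat (Poly_Mapping.lookup P m) *
      (\<Prod>v\<in>Poly_Mapping.keys m. x v ^ Poly_Mapping.lookup m v))"

definition algebraically_independent_rat :: "('v \<Rightarrow> real) \<Rightarrow> bool" where
  "algebraically_independent_rat x \<longleftrightarrow> (\<forall>P. poly_eval_rat P x = 0 \<longrightarrow> P = 0)"

definition generic :: "('n::finite \<Rightarrow> real ^ 'd) \<Rightarrow> bool" where
  "generic p \<longleftrightarrow> algebraically_independent_rat (\<lambda>(i, c). p i $ c)"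

text \<open>The dimension is passed as a type argument, since \<open>E\<close> does not mention it.\<close>

definition generically_globally_rigid :: "'d::finite itself \<Rightarrow> 'n::finite set set \<Rightarrow> bool" where
  "generically_globally_rigid (_ :: 'd itself) E \<longleftrightarrow>
    (\<forall>p :: 'n \<Rightarrow> real ^ 'd. generic p \<longrightarrow> globally_rigid E p)"

text \<open>The all-ones vector is \<open>1 :: real ^ 'n\<close>.\<close>

definition equilibrium_stress_matrix ::
    "'n::finite set set \<Rightarrow> ('n \<Rightarrow> real ^ 'd) \<Rightarrow> real ^ 'n ^ 'n \<Rightarrow> bool" where
  "equilibrium_stress_matrix E p \<Omega> \<longleftrightarrow>
    transpose \<Omega> = \<Omega> \<and>
    (\<forall>i j. i \<noteq> j \<and> {i, j} \<notin> E \<longrightarrow> \<Omega> $ i $ j = 0) \<and>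
    \<Omega> *v 1 = 0 \<and>
    (\<forall>i. (\<Sum>j\<in>UNIV. (\<Omega> $ i $ j) *\<^sub>R p j) = 0)"

text \<open>
  The number $n - d - 1$ is expressed additively to avoid truncated subtraction. Columns are
  treated as an indexed family, so repeated columns count as linearly dependent.
\<close>

definition Gstr :: "nat \<Rightarrow> 'n::finite set set \<Rightarrow> (real ^ 'n ^ 'n) set" where
  "Gstr d E = {\<Omega>.
    transpose \<Omega> = \<Omega> \<and>
    (\<forall>i j. i \<noteq> j \<and> {i, j} \<notin> E \<longrightarrow> \<Omega> $ i $ j = 0) \<and>
    \<Omega> *v 1 = 0 \<and>
    rank \<Omega> + d + 1 = CARD('n) \<and>
    (\<forall>J. card J + d + 1 = CARD('n) \<longrightarrow>
      inj_on (\<lambda>j. column j \<Omega>) J \<and> independent ((\<lambda>j. column j \<Omega>) ` J))}"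

text \<open>
  The points are again an indexed family, so coincident points violate the case $k = 2$.
\<close>

definition affine_general_position :: "('n::finite \<Rightarrow> real ^ 'd) \<Rightarrow> bool" where
  "affine_general_position p \<longleftrightarrow>
    (\<forall>K. card K \<le> CARD('d) + 1 \<longrightarrow>
      \<not> (\<exists>A. affine A \<and> aff_dim A = int (card K) - 2 \<and> p ` K \<subseteq> A))"

definition Gstressable :: "'n::finite set set \<Rightarrow> ('n \<Rightarrow> real ^ 'd) \<Rightarrow> bool" where
  "Gstressable E p \<longleftrightarrow>
    affine_general_position p \<and>
    (\<exists>\<Omega>. equilibrium_stress_matrix E p \<Omega> \<and> rank \<Omega> + CARD('d) + 1 = CARD('n))"

end

theory Submission
  imports Defs
begin

text \<open>
  If no equilibrium stress of a generic configuration $p$ has rank $n - d - 1$, take a stress $\Omega$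
  of $p$ of maximal rank; its kernel $K$ then has dimension at least $d + 2$. Let $A$ be the linear space of
  configurations in equilibrium with $\Omega$, and let $f$ send a configuration to its squared edge lengths.

  \<^item> Since the rank of $\Omega$ is maximal also among stresses of configurations near $p$, moving $p$ and
    $\Omega$ to first order shows that $f(A)$ lies in the linear space spanned by the derivative of $f$ on $A$ at $p$.
    After restriction to a linear slice $B$ of $A$ for the group of motions, $f$ is thus a proper quadratic map
    between spaces of equal dimension, and it is not onto because edge lengths are nonnegative.
  \<^item> Every rational polynomial that vanishes on $A$ vanishes at $p$, so almost every point of $A$ is generic, hence globally
    rigid: modulo the finitely many sign changes that remain in $B$, $f$ is generically injective.
  \<^item> A line in general position leaves the image of $f$ at a boundary point with a preimage at which $f$ folds along the
    line. Next to the fold there are two preimages of every value, and they are not related by a sign change because the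
    configurations fixed by a sign change have codimension at least two. This contradicts generic injectivity.

  So the kernel of $\Omega$ consists of the affine functions of $p$, and the rest is general position.
\<close>

section \<open>Polynomial functions\<close>

text \<open>Pairing squared lengths with a vector \<open>w\<close> gives the quadratic form of the
  stress \<open>w\<close>.

  Equality of dimensions is not free: the derivative at $p$ must be injective on the slice. This
  also comes from global rigidity, because an infinitesimal flex inside the slice could be
  integrated, the lengths being confined to the image of the derivative.

  A proper map that is not onto has degree 0 modulo 2, while unique preimages would give degree 1.
  The fold replaces this count of preimages by a local argument using Sard's theorem, the inverse
  function theorem and the intermediate value theorem.

  The codimension two is $(d+2) - d$: the kernel has dimension at least $d+2$, and the slice imposes
  at most $d$ conditions on a configuration that lives in one coordinate.\<close>

inductive poly_deg :: "nat \<Rightarrow> ('a::euclidean_space \<Rightarrow> real) \<Rightarrow> bool" where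
  const: "poly_deg 0 (\<lambda>x. c)"
| linear: "bounded_linear l \<Longrightarrow> poly_deg 1 l"
| add: "poly_deg n u \<Longrightarrow> poly_deg n w \<Longrightarrow> poly_deg n (\<lambda>x. u x + w x)"
| mult: "poly_deg m u \<Longrightarrow> poly_deg n w \<Longrightarrow> poly_deg (m + n) (\<lambda>x. u x * w x)"
| mono: "poly_deg m u \<Longrightarrow> m \<le> n \<Longrightarrow> poly_deg n u"

lemma real_polynomial_function_poly_deg:
  "real_polynomial_function u \<Longrightarrow> \<exists>n. poly_deg n u"
proof (induction rule: real_polynomial_function.induct)
  case (add u w)
  then obtain m n where "poly_deg m u" "poly_deg n w" by auto
  then show ?case
    using poly_deg.add[of "max m n" u w] poly_deg.mono[of m u "max m n"] poly_deg.mono[of n w "max m n"] by auto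
qed (auto intro: poly_deg.intros)

lemma poly_deg_real_polynomial_function: "poly_deg n u \<Longrightarrow> real_polynomial_function u"
  by (induction rule: poly_deg.induct) (auto intro: real_polynomial_function.intros)

text \<open>\<open>poly_deg\<close> records an upper bound for the degree on which to induct. As
  \<open>n - 1\<close> is truncated at 0, the case \<open>n = 0\<close> must state separately that
  the derivative vanishes, or a descent through derivatives would never end.\<close>

lemma poly_deg_derivative:
  "poly_deg n u \<Longrightarrow> \<exists>u'. (\<forall>x. (u has_derivative (\<lambda>v. u' v x)) (at x)) \<and>
     (\<forall>v. poly_deg (n - 1) (u' v) \<and> (n = 0 \<longrightarrow> u' v = (\<lambda>x. 0)))"
proof (induction rule: poly_deg.induct)
  case (const c)
  show ?case by (rule exI[of _ "\<lambda>v x. 0"]) (auto intro: poly_deg.const)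
next
  case (linear l)
  then show ?case
    by (intro exI[of _ "\<lambda>v x. l v"]) (auto intro: poly_deg.const bounded_linear_imp_has_derivative)
next
  case (add n u w)
  then obtain u' w' where
    u': "\<And>x. (u has_derivative (\<lambda>v. u' v x)) (at x)" "\<And>v. poly_deg (n - 1) (u' v)" "n = 0 \<Longrightarrow> \<forall>v. u' v = (\<lambda>x. 0)" and
    w': "\<And>x. (w has_derivative (\<lambda>v. w' v x)) (at x)" "\<And>v. poly_deg (n - 1) (w' v)" "n = 0 \<Longrightarrow> \<forall>v. w' v = (\<lambda>x. 0)"
    by (elim exE conjE) blast
  show ?case
  proof (intro exI[of _ "\<lambda>v x. u' v x + w' v x"] conjI allI impI)
    show "((\<lambda>x. u x + w x) has_derivative (\<lambda>v. u' v x + w' v x)) (at x)" for x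
      by (intro has_derivative_add u' w')
  qed (use u' w' in \<open>auto intro: poly_deg.add\<close>)
next
  case (mult m u n w)
  then obtain u' w' where
    u': "\<And>x. (u has_derivative (\<lambda>v. u' v x)) (at x)" "\<And>v. poly_deg (m - 1) (u' v)" "m = 0 \<Longrightarrow> \<forall>v. u' v = (\<lambda>x. 0)" and
    w': "\<And>x. (w has_derivative (\<lambda>v. w' v x)) (at x)" "\<And>v. poly_deg (n - 1) (w' v)" "n = 0 \<Longrightarrow> \<forall>v. w' v = (\<lambda>x. 0)"
    by (elim exE conjE) blast
  have d1: "poly_deg (m + n - 1) (\<lambda>x. u x * w' v x)" for v
  proof (cases "n = 0")
    case True
    then show ?thesis using w'(3)
      by (auto intro: poly_deg.mono[OF poly_deg.const])
  next
    case False
    then show ?thesis using poly_deg.mult[OF mult(1) w'(2)[of v]] by simp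
  qed
  have d2: "poly_deg (m + n - 1) (\<lambda>x. u' v x * w x)" for v
  proof (cases "m = 0")
    case True
    then show ?thesis using u'(3)
      by (auto intro: poly_deg.mono[OF poly_deg.const])
  next
    case False
    then show ?thesis using poly_deg.mult[OF u'(2)[of v] mult(2)] by simp
  qed
  show ?case
  proof (intro exI[of _ "\<lambda>v x. u x * w' v x + u' v x * w x"] conjI allI impI)
    show "((\<lambda>x. u x * w x) has_derivative (\<lambda>v. u x * w' v x + u' v x * w x)) (at x)" for x
      using has_derivative_mult[OF u'(1) w'(1)] .
    show "poly_deg (m + n - 1) (\<lambda>x. u x * w' v x + u' v x * w x)" for v
      by (intro poly_deg.add d1 d2)
    show "m + n = 0 \<Longrightarrow> (\<lambda>x. u x * w' v x + u' v x * w x) = (\<lambda>x. 0)" for v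
      using u'(3) w'(3) by auto
  qed
next
  case (mono m u n)
  then obtain u' where "\<And>x. (u has_derivative (\<lambda>v. u' v x)) (at x)" "\<And>v. poly_deg (m - 1) (u' v)" "m = 0 \<Longrightarrow> \<forall>v. u' v = (\<lambda>x. 0)"
    by (elim exE conjE) blast
  moreover have "m - 1 \<le> n - 1" using \<open>m \<le> n\<close> by simp
  ultimately show ?case using \<open>m \<le> n\<close>
    by (intro exI[of _ u']) (auto intro: poly_deg.mono simp del: One_nat_def)
qed

definition dird :: "'a::euclidean_space \<Rightarrow> ('a \<Rightarrow> real) \<Rightarrow> 'a \<Rightarrow> real" where
  "dird v u = (\<lambda>x. frechet_derivative u (at x) v)"

lemma real_polynomial_function_has_derivative:
  fixes u :: "'a::euclidean_space \<Rightarrow> real"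
  assumes "real_polynomial_function u"
  shows "(u has_derivative (\<lambda>v. dird v u x)) (at x)" "real_polynomial_function (dird v u)"
proof -
  obtain n where "poly_deg n u" using real_polynomial_function_poly_deg assms by blast
  then obtain u' where u': "\<And>x. (u has_derivative (\<lambda>v. u' v x)) (at x)" "\<And>v. poly_deg (n - 1) (u' v)"
    using poly_deg_derivative by blast
  have "dird v u = u' v" for v
    unfolding dird_def frechet_derivative_at[OF u'(1), symmetric] ..
  then show "(u has_derivative (\<lambda>v. dird v u x)) (at x)" "real_polynomial_function (dird v u)"
    using u'(1) poly_deg_real_polynomial_function[OF u'(2)] by auto
qed

lemma poly_deg_dird:
  assumes "poly_deg n u" shows "poly_deg (n - 1) (dird v u)" "n = 0 \<Longrightarrow> dird v u = (\<lambda>x. 0)"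
proof -
  obtain u' where u': "\<And>x. (u has_derivative (\<lambda>v. u' v x)) (at x)" "\<And>v. poly_deg (n - 1) (u' v)" "n = 0 \<Longrightarrow> u' v = (\<lambda>x. 0)"
    using poly_deg_derivative[OF assms] by blast
  have "dird v u = u' v" for v
    unfolding dird_def frechet_derivative_at[OF u'(1), symmetric] ..
  then show "poly_deg (n - 1) (dird v u)" "n = 0 \<Longrightarrow> dird v u = (\<lambda>x. 0)" using u' by auto
qed

text \<open>A qualitative Taylor formula: each first partial derivative inherits the hypothesis with
  a smaller degree, hence is zero, so \<open>u\<close> is constant, and the empty list gives its
  value. Any single point \<open>x\<close> will do; later it is a preimage of a boundary
  value.\<close>

lemma poly_deg_eq_0_if_derivatives_vanish:
  assumes "poly_deg n u" "\<And>\<alpha>. set \<alpha> \<subseteq> Basis \<Longrightarrow> foldr dird \<alpha> u x = 0"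
  shows "u = (\<lambda>y. 0)"
  using assms
proof (induction n arbitrary: u rule: less_induct)
  case (less n)
  have z: "dird e u = (\<lambda>y. 0)" if "e \<in> Basis" for e
  proof (cases "n = 0")
    case True
    then show ?thesis using poly_deg_dird(2) less.prems by blast
  next
    case False
    show ?thesis
    proof (rule less.IH)
      show "n - 1 < n" using False by simp
      show "poly_deg (n - 1) (dird e u)" using poly_deg_dird less.prems by blast
      show "foldr dird \<alpha> (dird e u) x = 0" if "set \<alpha> \<subseteq> Basis" for \<alpha>
        using less.prems(2)[of "\<alpha> @ [e]"] that \<open>e \<in> Basis\<close> by simp
    qed
  qed
  have der: "(u has_derivative (\<lambda>v. dird v u y)) (at y)" for y
    using real_polynomial_function_has_derivative poly_deg_real_polynomial_function less.prems by blast
  have "dird v u y = 0" for v y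
  proof -
    have lin: "linear (\<lambda>v. dird v u y)" using der has_derivative_linear by blast
    have "dird v u y = dird (\<Sum>e\<in>Basis. (v \<bullet> e) *\<^sub>R e) u y" by (simp add: euclidean_representation)
    also have "\<dots> = (\<Sum>e\<in>Basis. (v \<bullet> e) *\<^sub>R dird e u y)"
      by (simp add: linear_sum[OF lin] linear_scale[OF lin])
    also have "\<dots> = 0" using z by (simp)
    finally show ?thesis .
  qed
  then have "(u has_derivative (\<lambda>v. 0)) (at y)" for y using der[of y] by simp
  then have "\<exists>c. \<forall>y\<in>UNIV. u y = c"
    by (intro has_derivative_zero_constant) auto
  then show ?case using less.prems(2)[of "[]"] by auto
qed

lemma real_polynomial_function_eq_0_if_derivatives_vanish:
  fixes u :: "'a::euclidean_space \<Rightarrow> real"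
  assumes "real_polynomial_function u" "\<And>\<alpha>. set \<alpha> \<subseteq> Basis \<Longrightarrow> foldr dird \<alpha> u x = 0"
  shows "u = (\<lambda>y. 0)"
  using assms real_polynomial_function_poly_deg poly_deg_eq_0_if_derivatives_vanish by metis

lemma real_polynomial_function_foldr_dird:
  "real_polynomial_function u \<Longrightarrow> real_polynomial_function (foldr dird \<alpha> u)"
  by (induction \<alpha>) (auto intro: real_polynomial_function_has_derivative)

section \<open>Generically injective polynomial maps\<close>

lemma local_inverse:
  fixes f :: "'a::euclidean_space \<Rightarrow> 'a"
  assumes der: "\<And>x. (f has_derivative D x) (at x)"
    and cont: "\<And>v. continuous_on UNIV (\<lambda>x. D x v)"
    and inj: "inj (D x0)"
  obtains U V g where "open U" "x0 \<in> U" "open V" "homeomorphism U V f g"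
    "\<And>y. y \<in> V \<Longrightarrow> (g has_derivative inv (D (g y))) (at y)"
    "\<And>y. y \<in> V \<Longrightarrow> bij (D (g y))"
proof -
  define f' where "f' x = Blinfun (D x)" for x
  have bl: "bounded_linear (D x)" for x using der has_derivative_bounded_linear by blast
  have app: "blinfun_apply (f' x) = D x" for x
    unfolding f'_def using bl by (simp add: bounded_linear_Blinfun_apply)
  have "continuous_on UNIV f'"
    by (rule continuous_on_blinfun_componentwise) (auto simp: app cont)
  have lin: "linear (D x0)" using bl bounded_linear.linear by blast
  have lin': "linear (inv (D x0))" "surj (D x0)"
    using linear_injective_imp_surjective[OF lin inj] inj_linear_imp_inv_linear[OF lin inj] by auto
  define g0 where "g0 = Blinfun (inv (D x0))"
  have g0: "blinfun_apply g0 = inv (D x0)"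
    unfolding g0_def using lin' by (simp add: bounded_linear_Blinfun_apply linear_conv_bounded_linear)
  have "g0 o\<^sub>L f' x0 = id_blinfun"
    by (rule blinfun_eqI) (simp add: g0 app inj)
  then obtain U' V g g' where *: "open U'" "x0 \<in> U'" "open V" "homeomorphism U' V f g"
    "\<And>y. y \<in> V \<Longrightarrow> (g has_derivative (g' y)) (at y)"
    "\<And>y. y \<in> V \<Longrightarrow> g' y = inv (blinfun_apply (f'(g y)))"
    "\<And>y. y \<in> V \<Longrightarrow> bij (blinfun_apply (f'(g y)))"
    using inverse_function_theorem[of UNIV f f' x0 g0] der app \<open>continuous_on UNIV f'\<close>
    by (metis UNIV_I open_UNIV)
  show thesis
    by (rule that[OF *(1-4)]) (use *(5-7) app in auto)
qed

text \<open>Almost every line in direction \<open>v\<close> avoids the values of \<open>f\<close> at those points of the hypersurface \<open>w = 0\<close>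
  where \<open>f\<close>, restricted to the hypersurface and taken modulo \<open>v\<close>, is critical. To stay in equal dimensions, the
  hypersurface is straightened and multiplied by the line.\<close>

lemma Sard_hypersurface:
  fixes f :: "real^'k::{finite,wellorder} \<Rightarrow> real^'k::{finite,wellorder}"
    and w :: "real^'k::{finite,wellorder} \<Rightarrow> real" and v :: "real^'k::{finite,wellorder}"
  assumes f: "\<And>x. (f has_derivative D x) (at x)"
    and w: "\<And>x. (w has_derivative dw x) (at x)" "\<And>u. continuous_on UNIV (\<lambda>x. dw x u)"
  defines "S \<equiv> {x. w x = 0 \<and> (\<exists>u. dw x u \<noteq> 0) \<and> \<not> (\<forall>y. \<exists>u s. dw x u = 0 \<and> y = D x u + s *\<^sub>R v)}"
  shows "negligible {y. \<exists>x\<in>S. \<exists>s. y = f x + s *\<^sub>R v}"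
proof -
  have loc: "\<exists>U. open U \<and> x0 \<in> U \<and> negligible {y. \<exists>x\<in>S\<inter>U. \<exists>s. y = f x + s *\<^sub>R v}" if x0: "x0 \<in> S" for x0
  proof -
    have lw: "linear (dw x)" for x using w(1) has_derivative_linear by blast
    obtain e where e: "e \<in> Basis" "dw x0 e \<noteq> 0"
    proof -
      obtain u where u: "dw x0 u \<noteq> 0" using x0 unfolding S_def by auto
      have "\<not> (\<forall>e\<in>Basis. dw x0 e = 0)"
        using linear_eq_0_on_span[OF lw, of Basis x0 u] u by auto
      then show thesis using that by blast
    qed
    have ee: "e \<bullet> e = 1" using e by (simp add: inner_Basis)
    \<comment> \<open>\<open>\<Phi>\<close> replaces the \<open>e\<close>-coordinate by
      \<open>w\<close>, so it carries \<open>w = 0\<close> to the hyperplane orthogonal to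
      \<open>e\<close>.\<close>
    define \<Phi> where "\<Phi> u = u + (w u - u \<bullet> e) *\<^sub>R e" for u
    define D\<Phi> where "D\<Phi> x u = u + (dw x u - u \<bullet> e) *\<^sub>R e" for x u
    have d1: "(\<Phi> has_derivative D\<Phi> x) (at x)" for x
      unfolding \<Phi>_def D\<Phi>_def by (auto intro!: derivative_eq_intros w)
    have d2: "continuous_on UNIV (\<lambda>x. D\<Phi> x u)" for u
      unfolding D\<Phi>_def by (intro continuous_intros w)
    have De: "D\<Phi> x u \<bullet> e = dw x u" for x u
      unfolding D\<Phi>_def by (simp add: inner_add_left inner_diff_left ee)
    have inj: "inj (D\<Phi> x0)"
    proof -
      have "linear (D\<Phi> x0)" using d1 has_derivative_linear by blast
      moreover have "u = 0" if "D\<Phi> x0 u = 0" for u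
      proof -
        have "dw x0 u = 0" using De[of x0 u] that by simp
        then have "u = (u \<bullet> e) *\<^sub>R e" using that unfolding D\<Phi>_def by simp
        moreover have "dw x0 ((u \<bullet> e) *\<^sub>R e) = (u \<bullet> e) * dw x0 e" using lw linear_scale by fastforce
        ultimately show "u = 0" using \<open>dw x0 u = 0\<close> e by (metis mult_eq_0_iff scale_zero_left)
      qed
      ultimately show ?thesis by (simp add: linear_injective_0)
    qed
    obtain U V g where UV: "open U" "x0 \<in> U" "open V" "homeomorphism U V \<Phi> g"
      "\<And>y. y \<in> V \<Longrightarrow> (g has_derivative inv (D\<Phi> (g y))) (at y)"
      "\<And>y. y \<in> V \<Longrightarrow> bij (D\<Phi> (g y))"
      by (rule local_inverse[of \<Phi> D\<Phi>, OF d1 d2 inj]) blast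
    define pr where "pr y = y - (y \<bullet> e) *\<^sub>R e" for y :: "(real, 'k) vec"
    define Y where "Y = {y. pr y \<in> V \<and> g (pr y) \<in> S}"
    \<comment> \<open>The \<open>e\<close>-coordinate is idle on the straightened hypersurface and
      serves as the parameter \<open>s\<close> of the line. \<open>\<Theta>\<close> is thus a map of
      the space to itself, to which Sard's theorem applies.\<close>
    define \<Theta> where "\<Theta> y = f (g (pr y)) + (y \<bullet> e) *\<^sub>R v" for y
    define D\<Theta> where "D\<Theta> y \<eta> = D (g (pr y)) (inv (D\<Phi> (g (pr y))) (pr \<eta>)) + (\<eta> \<bullet> e) *\<^sub>R v" for y \<eta>
    have sub: "{y. \<exists>x\<in>S\<inter>U. \<exists>s. y = f x + s *\<^sub>R v} \<subseteq> \<Theta> ` Y"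
    proof clarify
      fix x s assume x: "x \<in> S" "x \<in> U"
      define y where "y = \<Phi> x + s *\<^sub>R e"
      have "\<Phi> x \<bullet> e = 0" using x ee unfolding \<Phi>_def S_def by (simp add: inner_add_left inner_diff_left)
      then have ye: "y \<bullet> e = s" "pr y = \<Phi> x" unfolding y_def pr_def using ee by (auto simp: inner_add_left)
      have "\<Phi> x \<in> V" "g (\<Phi> x) = x" using UV(4) x unfolding homeomorphism_def by auto
      then show "f x + s *\<^sub>R v \<in> \<Theta> ` Y" using ye x unfolding \<Theta>_def Y_def by (intro image_eqI[of _ _ y]) auto
    qed
    have "negligible (\<Theta> ` Y)"
    proof (rule baby_Sard)
      fix y assume y: "y \<in> Y"
      have blpr: "bounded_linear pr"
        unfolding pr_def by (intro bounded_linear_intros)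
      have "((\<lambda>y. g (pr y)) has_derivative (\<lambda>\<eta>. inv (D\<Phi> (g (pr y))) (pr \<eta>))) (at y)"
        using has_derivative_compose[OF bounded_linear_imp_has_derivative[OF blpr] UV(5)] y unfolding Y_def by auto
      then have "((\<lambda>y. f (g (pr y))) has_derivative (\<lambda>\<eta>. D (g (pr y)) (inv (D\<Phi> (g (pr y))) (pr \<eta>)))) (at y)"
        using has_derivative_compose[OF _ f] by blast
      then have "(\<Theta> has_derivative D\<Theta> y) (at y)"
        unfolding \<Theta>_def D\<Theta>_def by (auto intro!: derivative_eq_intros)
      then show "(\<Theta> has_derivative D\<Theta> y) (at y within Y)" by (rule has_derivative_at_withinI)
      have lT: "linear (D\<Theta> y)" using \<open>(\<Theta> has_derivative D\<Theta> y) (at y)\<close> has_derivative_linear by blast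
      let ?x = "g (pr y)"
      \<comment> \<open>Surjectivity would say that \<open>v\<close> and the image of the tangent
        hyperplane span the space, which the definition of \<open>S\<close> excludes.\<close>
      have "\<not> surj (D\<Theta> y)"
      proof
        assume su: "surj (D\<Theta> y)"
        have "\<exists>u s. dw ?x u = 0 \<and> z = D ?x u + s *\<^sub>R v" for z
        proof -
          obtain \<eta> where \<eta>: "z = D\<Theta> y \<eta>" using su by (metis surjD)
          define u where "u = inv (D\<Phi> ?x) (pr \<eta>)"
          have "D\<Phi> ?x u = pr \<eta>" unfolding u_def using UV(6) y unfolding Y_def
            by (simp add: bij_is_surj surj_f_inv_f)
          then have "dw ?x u = pr \<eta> \<bullet> e" using De by metis
          also have "\<dots> = 0" unfolding pr_def using ee by (simp add: inner_diff_left)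
          finally show ?thesis using \<eta> unfolding D\<Theta>_def u_def by blast
        qed
        then show False using y unfolding Y_def S_def by blast
      qed
      then have "\<not> inj (D\<Theta> y)" using lT linear_injective_imp_surjective by blast
      then show "rank (matrix (D\<Theta> y)) < CARD('k)"
        using less_rank_noninjective[of "matrix (D\<Theta> y)"] lT by (simp add: matrix_works)
    qed simp
    then have "negligible {y. \<exists>x\<in>S\<inter>U. \<exists>s. y = f x + s *\<^sub>R v}" using sub by (rule negligible_subset)
    then show ?thesis using UV(1,2) by blast
  qed
  define U where "U x = (SOME U. open U \<and> x \<in> U \<and> negligible {y. \<exists>z\<in>S\<inter>U. \<exists>s. y = f z + s *\<^sub>R v})" for x
  have U: "open (U x) \<and> x \<in> U x \<and> negligible {y. \<exists>z\<in>S\<inter>U x. \<exists>s. y = f z + s *\<^sub>R v}" if "x \<in> S" for x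
    unfolding U_def by (rule someI_ex[OF loc[OF that]])
  have "\<And>T. T \<in> U ` S \<Longrightarrow> open T" using U by blast
  then obtain \<F> where F: "\<F> \<subseteq> U ` S" "countable \<F>" "\<Union>\<F> = \<Union>(U ` S)"
    using Lindelof by metis
  have "negligible (\<Union>T\<in>\<F>. {y. \<exists>z\<in>S\<inter>T. \<exists>s. y = f z + s *\<^sub>R v})"
    using F U by (intro negligible_countable_Union) auto
  moreover have "{y. \<exists>x\<in>S. \<exists>s. y = f x + s *\<^sub>R v} \<subseteq> (\<Union>T\<in>\<F>. {y. \<exists>z\<in>S\<inter>T. \<exists>s. y = f z + s *\<^sub>R v})"
  proof clarify
    fix x s assume "x \<in> S"
    then have "x \<in> \<Union>\<F>" using F U by blast
    then show "f x + s *\<^sub>R v \<in> (\<Union>T\<in>\<F>. {y. \<exists>z\<in>S\<inter>T. \<exists>s. y = f z + s *\<^sub>R v})" using \<open>x \<in> S\<close> by blast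
  qed
  ultimately show ?thesis by (rule negligible_subset)
qed

text \<open>Sweeping \<open>S\<close> along one orthogonal direction \<open>e\<close> still gives a
  proper subspace, hence a null set. \<open>\<Theta>\<close> reads the \<open>e\<close>-coordinate
  as the parameter of the line and, being differentiable, keeps null sets null.\<close>

lemma negligible_codim2:
  fixes f :: "'a::euclidean_space \<Rightarrow> 'a"
  assumes f: "\<And>x. (f has_derivative D x) (at x)" and S: "subspace S" "dim S + 2 \<le> DIM('a)"
  shows "negligible {y. \<exists>x\<in>S. \<exists>s. y = f x + s *\<^sub>R v}"
proof -
  have "dim S < DIM('a)" using S(2) by simp
  then obtain e where e: "e \<noteq> 0" "\<And>y. y \<in> span S \<Longrightarrow> orthogonal e y"
    using orthogonal_to_subspace_exists by blast
  define T where "T = span (insert e S)"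
  have "dim T \<le> dim S + 1" unfolding T_def by (simp add: dim_insert)
  then have "negligible T" using S by (intro negligible_lowdim) auto
  define \<Theta> where "\<Theta> y = f (y - ((y \<bullet> e) / (e \<bullet> e)) *\<^sub>R e) + ((y \<bullet> e) / (e \<bullet> e)) *\<^sub>R v" for y
  have "\<Theta> differentiable (at y)" for y
  proof -
    have "((\<lambda>y. y - ((y \<bullet> e) / (e \<bullet> e)) *\<^sub>R e) has_derivative (\<lambda>y. y - ((y \<bullet> e) / (e \<bullet> e)) *\<^sub>R e)) (at y)"
      using e(1) by (auto intro!: derivative_eq_intros)
    then have "((\<lambda>y. f (y - ((y \<bullet> e) / (e \<bullet> e)) *\<^sub>R e)) has_derivative
       (\<lambda>h. D (y - ((y \<bullet> e) / (e \<bullet> e)) *\<^sub>R e) (h - ((h \<bullet> e) / (e \<bullet> e)) *\<^sub>R e))) (at y)"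
      using has_derivative_compose[OF _ f] by blast
    moreover have "((\<lambda>y. ((y \<bullet> e) / (e \<bullet> e)) *\<^sub>R v) has_derivative (\<lambda>y. ((y \<bullet> e) / (e \<bullet> e)) *\<^sub>R v)) (at y)"
      using e(1) by (auto intro!: derivative_eq_intros)
    ultimately have "(\<Theta> has_derivative (\<lambda>h. D (y - ((y \<bullet> e) / (e \<bullet> e)) *\<^sub>R e) (h - ((h \<bullet> e) / (e \<bullet> e)) *\<^sub>R e)
        + ((h \<bullet> e) / (e \<bullet> e)) *\<^sub>R v)) (at y)"
      unfolding \<Theta>_def by (rule has_derivative_add)
    then show ?thesis unfolding differentiable_def by blast
  qed
  then have "negligible (\<Theta> ` T)"
    using \<open>negligible T\<close> by (intro negligible_differentiable_image_negligible)
      (auto simp: differentiable_on_def intro: differentiable_at_withinI)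
  moreover have "{y. \<exists>x\<in>S. \<exists>s. y = f x + s *\<^sub>R v} \<subseteq> \<Theta> ` T"
  proof clarify
    fix x s assume x: "x \<in> S"
    then have "x \<bullet> e = 0" using e span_base orthogonal_def by (metis inner_commute)
    then have "\<Theta> (x + s *\<^sub>R e) = f x + s *\<^sub>R v" unfolding \<Theta>_def using e(1) by (simp add: inner_left_distrib)
    moreover have "x + s *\<^sub>R e \<in> T" unfolding T_def
      by (intro span_add span_scale span_base) (use x in auto)
    ultimately show "f x + s *\<^sub>R v \<in> \<Theta> ` T" by (metis imageI)
  qed
  ultimately show ?thesis by (rule negligible_subset)
qed

text \<open>Only a dense set of points has to be alone in its fibre within \<open>U\<close>, since
  unique realisation will be known on a dense set only. The neighbourhood \<open>U\<close> serves to
  rule out the sign changes.\<close>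

definition generically_inj_at :: "('a::topological_space \<Rightarrow> 'b) \<Rightarrow> 'a \<Rightarrow> bool" where
  "generically_inj_at f x \<longleftrightarrow> (\<exists>U. open U \<and> x \<in> U \<and>
    (\<forall>W. open W \<and> W \<noteq> {} \<and> W \<subseteq> U \<longrightarrow> (\<exists>u\<in>W. \<forall>u'\<in>U. f u' = f u \<longrightarrow> u' = u)))"

text \<open>The zeros of the Jacobian determinant are covered by the hypersurfaces on which an iterated partial
  derivative vanishes to first order. At the last point \<open>b\<close> of the range on a general line, a derivative of
  least order that does not vanish on the whole fibre provides such a hypersurface \<open>w = 0\<close> that contains the fibre, so
  that \<open>w\<close> is a coordinate along the line in which \<open>f\<close> has a strict maximum.\<close>

lemma fold_contradiction_cart:
  fixes f :: "real^'k::{finite,wellorder} \<Rightarrow> real^'k::{finite,wellorder}"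
  assumes poly: "polynomial_function f"
    and der: "\<And>x. (f has_derivative D x) (at x)"
    and closed: "closed (range f)" and nonsurj: "range f \<noteq> UNIV"
    and reg: "inj (D x1)"
    and fin: "finite \<D>" and codim: "\<And>S. S \<in> \<D> \<Longrightarrow> subspace S \<and> dim S + 2 \<le> CARD('k)"
    and loc: "\<And>x. x \<notin> \<Union>\<D> \<Longrightarrow> generically_inj_at f x"
  shows False
proof -
  have lD: "linear (D x)" for x using der has_derivative_linear by blast
  have contf: "continuous_on A f" for A
    using der has_derivative_continuous by (metis continuous_at_imp_continuous_on)
  have comp: "real_polynomial_function (\<lambda>x. f x $ i)" for i
  proof -
    have "real_polynomial_function (\<lambda>x. f x \<bullet> axis i 1)"
      using poly polynomial_function_iff_Basis_inner by fastforce
    then show ?thesis by (simp add: inner_axis)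
  qed
  have Dcomp: "D x v $ i = dird v (\<lambda>x. f x $ i) x" for x v i
  proof -
    have "((\<lambda>x. f x $ i) has_derivative (\<lambda>v. D x v $ i)) (at x)"
      using bounded_linear.has_derivative[OF bounded_linear_vec_nth der] .
    from has_derivative_unique[OF this real_polynomial_function_has_derivative(1)[OF comp]]
    show ?thesis by metis
  qed
  have Dpoly: "real_polynomial_function (\<lambda>x. D x v $ i)" for v i
    unfolding Dcomp using real_polynomial_function_has_derivative(2)[OF comp] by simp
  have rpc: "continuous_on UNIV u" if "real_polynomial_function u" for u :: "(real, 'k) vec \<Rightarrow> real"
    using that continuous_on_polymonial_function real_polynomial_function_eq by blast
  have contD: "continuous_on UNIV (\<lambda>x. D x v)" for v
    using continuous_on_vec_lambda[of UNIV "\<lambda>i x. D x v $ i"] rpc[OF Dpoly] by simp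
  define h where "h x = det (matrix (D x))" for x
  have hpoly: "real_polynomial_function h"
    unfolding h_def det_def matrix_def
    by (intro real_polynomial_function_sum real_polynomial_function.intros(2,4) real_polynomial_function_prod finite_permutations)
       (auto intro: Dpoly)
  have h0: "h x = 0 \<longleftrightarrow> \<not> inj (D x)" for x
    unfolding h_def using det_nz_iff_inj[OF lD] by blast
  have regint: "f x \<in> interior (range f)" if inj: "inj (D x)" for x
  proof -
    obtain U V g where "open U" "x \<in> U" "open V" "homeomorphism U V f g"
      by (rule local_inverse[OF der contD inj]) blast
    then have "f x \<in> V" "V \<subseteq> range f" unfolding homeomorphism_def by auto
    then show ?thesis using \<open>open V\<close> interiorI by metis
  qed
  obtain b0 where b0: "b0 \<notin> range f" using nonsurj by blast
  \<comment> \<open>One direction is fixed, from a regular value, which is interior to the range, to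
    a missed value \<open>b0\<close>. Only the starting point \<open>a\<close> of the segment is
    varied.\<close>
  define v where "v = b0 - f x1"
  define S where "S \<alpha> = {x. foldr dird \<alpha> h x = 0 \<and> (\<exists>u. dird u (foldr dird \<alpha> h) x \<noteq> 0) \<and>
      \<not> (\<forall>y. \<exists>u s. dird u (foldr dird \<alpha> h) x = 0 \<and> y = D x u + s *\<^sub>R v)}" for \<alpha>
  \<comment> \<open>\<open>Bad\<close> is invariant under translation along \<open>v\<close>, so
    \<open>a \<notin> Bad\<close> speaks about all preimages of all points of the line through
    \<open>a\<close>.\<close>
  define Bad where "Bad = (\<Union>\<alpha>\<in>lists Basis. {y. \<exists>x\<in>S \<alpha>. \<exists>s. y = f x + s *\<^sub>R v})
     \<union> (\<Union>S\<in>\<D>. {y. \<exists>x\<in>S. \<exists>s. y = f x + s *\<^sub>R v})"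
  have wpoly: "real_polynomial_function (foldr dird \<alpha> h)" for \<alpha>
    using real_polynomial_function_foldr_dird hpoly by blast
  have wder: "(foldr dird \<alpha> h has_derivative (\<lambda>u. dird u (foldr dird \<alpha> h) x)) (at x)"
    "continuous_on UNIV (\<lambda>x. dird u (foldr dird \<alpha> h) x)" for \<alpha> u x
    using real_polynomial_function_has_derivative[OF wpoly] rpc by auto
  have "negligible {y. \<exists>x\<in>S \<alpha>. \<exists>s. y = f x + s *\<^sub>R v}" for \<alpha>
    unfolding S_def by (rule Sard_hypersurface[OF der wder])
  moreover have "negligible {y. \<exists>x\<in>S. \<exists>s. y = f x + s *\<^sub>R v}" if "S \<in> \<D>" for S
    using negligible_codim2[OF der, of S v] codim[OF that] by simp
  moreover have "countable (lists (Basis :: ((real, 'k) vec) set))"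
    by (intro countable_lists countable_finite) simp
  ultimately have "negligible Bad"
    unfolding Bad_def using fin
    by (intro negligible_Un negligible_countable_Union) (auto intro: countable_finite)
  define W where "W = interior (range f) \<inter> (\<lambda>a. a + v) -` (- range f)"
  have "open W" unfolding W_def using closed
    by (intro open_Int open_vimage) (auto intro!: continuous_intros)
  moreover have "f x1 \<in> W" using regint[OF reg] b0 unfolding W_def v_def by auto
  ultimately have "\<not> negligible W" using open_not_negligible by blast
  then obtain a where a: "a \<in> W" "a \<notin> Bad" using negligible_subset \<open>negligible Bad\<close> by blast
  have v0: "v \<noteq> 0" using b0 unfolding v_def by auto
  define C where "C = {0..1} \<inter> (\<lambda>t. a + t *\<^sub>R v) -` range f"
  have "compact C" unfolding C_def
    by (intro closed_vimage compact_Int_closed closed continuous_intros) auto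
  moreover have "0 \<in> C" using a(1) interior_subset unfolding C_def W_def by auto
  ultimately obtain ts where ts: "ts \<in> C" "\<And>t. t \<in> C \<Longrightarrow> t \<le> ts"
    using compact_attains_sup[of C] by blast
  have "ts \<noteq> 1" using ts(1) a(1) unfolding C_def W_def by auto
  then have ts1: "0 \<le> ts" "ts < 1" using ts(1) unfolding C_def by auto
  have out: "a + t *\<^sub>R v \<notin> range f" if "ts < t" "t \<le> 1" for t
    using ts(2)[of t] that ts1 unfolding C_def by auto
  define b where "b = a + ts *\<^sub>R v"
  have "b \<in> range f" using ts(1) unfolding C_def b_def by auto
  \<comment> \<open>At a regular preimage \<open>b\<close> would be interior to the range, and the
    segment could be followed further.\<close>
  have crit: "\<not> inj (D x)" if "f x = b" for x
  proof
    assume "inj (D x)"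
    then have "b \<in> interior (range f)" using regint that by blast
    then obtain r where r: "r > 0" "ball b r \<subseteq> range f" using mem_interior by blast
    define t where "t = min (1 - ts) (r / (2 * norm v))"
    have "t > 0" "t \<le> 1 - ts" "t * norm v < r"
      using ts1 r v0 by (auto simp: t_def min_def field_simps)
    then have "b + t *\<^sub>R v \<in> ball b r" by (simp add: dist_norm)
    then have "a + (ts + t) *\<^sub>R v \<in> range f" using r unfolding b_def by (auto simp: algebra_simps)
    then show False using out[of "ts + t"] \<open>t > 0\<close> \<open>t \<le> 1 - ts\<close> by auto
  qed
  have "\<exists>\<alpha> x. set \<alpha> \<subseteq> Basis \<and> f x = b \<and> foldr dird \<alpha> h x \<noteq> 0"
  proof (rule ccontr)
    assume c: "\<not> ?thesis"
    obtain x where "f x = b" using \<open>b \<in> range f\<close> by auto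
    then have "h = (\<lambda>y. 0)"
      using real_polynomial_function_eq_0_if_derivatives_vanish[OF hpoly, of x] c by blast
    then show False using reg h0[of x1] by simp
  qed
  \<comment> \<open>The minimal length is taken over all preimages of \<open>b\<close> together.
    Dropping the outermost derivative \<open>e\<close> therefore leaves a \<open>w\<close> that
    vanishes at every preimage of \<open>b\<close>, although its derivative along \<open>e\<close>
    at \<open>x0\<close> is nonzero.\<close>
  then obtain \<alpha>0 where \<alpha>0: "\<exists>x. set \<alpha>0 \<subseteq> Basis \<and> f x = b \<and> foldr dird \<alpha>0 h x \<noteq> 0"
    and min: "\<And>\<beta>. (\<exists>x. set \<beta> \<subseteq> Basis \<and> f x = b \<and> foldr dird \<beta> h x \<noteq> 0) \<Longrightarrow> length \<alpha>0 \<le> length \<beta>"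
    using ex_has_least_nat[of "\<lambda>\<alpha>. \<exists>x. set \<alpha> \<subseteq> Basis \<and> f x = b \<and> foldr dird \<alpha> h x \<noteq> 0" _ length] by metis
  then obtain x0 where x0: "set \<alpha>0 \<subseteq> Basis" "f x0 = b" "foldr dird \<alpha>0 h x0 \<noteq> 0" by blast
  have "\<alpha>0 \<noteq> []" using x0 crit h0 by auto
  then obtain e \<alpha> where \<alpha>: "\<alpha>0 = e # \<alpha>" by (cases \<alpha>0) auto
  define w where "w = foldr dird \<alpha> h"
  have wz: "w x = 0" if "f x = b" for x
    using min[of \<alpha>] that x0(1) unfolding w_def \<alpha> by fastforce
  have we: "dird e w x0 \<noteq> 0" using x0(3) unfolding w_def \<alpha> by simp
  define dw where "dw x u = dird u w x" for x u
  have dw: "(w has_derivative dw x) (at x)" "continuous_on UNIV (\<lambda>x. dw x u)" for x u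
    unfolding dw_def w_def using wder by auto
  have ldw: "linear (dw x)" for x using dw has_derivative_linear by blast
  have aeq: "a = f x0 + (- ts) *\<^sub>R v" using x0(2) unfolding b_def by simp
  \<comment> \<open>As \<open>a\<close> is not in \<open>Bad\<close>, \<open>x0\<close> is not in
    \<open>S \<alpha>\<close>: the restriction of \<open>f\<close> to the hypersurface
    \<open>w = 0\<close> is transverse to \<open>v\<close> at \<open>x0\<close>.\<close>
  have star: "\<exists>u s. dw x0 u = 0 \<and> y = D x0 u + s *\<^sub>R v" for y
  proof -
    have "\<alpha> \<in> lists Basis" using x0(1) unfolding \<alpha> by auto
    then have "x0 \<notin> S \<alpha>" using aeq a(2) unfolding Bad_def by blast
    then show ?thesis using wz[OF x0(2)] we unfolding S_def dw_def w_def by auto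
  qed
  have x0D: "x0 \<notin> \<Union>\<D>" using aeq a(2) unfolding Bad_def by blast
  have vnot: "v \<notin> range (D x0)"
  proof
    assume "v \<in> range (D x0)"
    then obtain q where q: "v = D x0 q" by auto
    have "y \<in> range (D x0)" for y
    proof -
      obtain u s where "y = D x0 u + s *\<^sub>R v" using star by blast
      then have "y = D x0 (u + s *\<^sub>R q)" using q lD by (simp add: linear_add linear_scale)
      then show ?thesis by blast
    qed
    then have "surj (D x0)" by blast
    then show False using linear_surjective_imp_injective[OF lD] crit[OF x0(2)] by blast
  qed
  have "subspace (range (D x0))" using lD linear_subspace_image subspace_UNIV by blast
  then obtain r z where rz: "r \<in> range (D x0)" "v = r + z" "\<And>y. y \<in> range (D x0) \<Longrightarrow> orthogonal z y"
    using orthogonal_subspace_decomp_exists[of "range (D x0)" v] by (metis span_eq_iff)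
  have "z \<noteq> 0" using rz vnot by auto
  have "z \<bullet> r = 0" using rz(1,3) unfolding orthogonal_def by blast
  then have "v \<bullet> z = z \<bullet> z" unfolding rz(2) by (simp add: inner_add inner_commute)
  then have vz: "v \<bullet> z \<noteq> 0" using \<open>z \<noteq> 0\<close> by simp
  \<comment> \<open>The functional that kills the range of \<open>D x0\<close> and takes the value 1
    at \<open>v\<close>; \<open>z\<close> is the part of \<open>v\<close> orthogonal to that
    range.\<close>
  define l where "l y = (y \<bullet> z) / (v \<bullet> z)" for y
  have ll: "linear l" unfolding l_def by (auto intro!: linearI simp: inner_add_left add_divide_distrib)
  have bll: "bounded_linear l" using ll linear_conv_bounded_linear by blast
  have lv: "l v = 1" unfolding l_def using vz by simp
  have l0: "l (D x0 u) = 0" for u unfolding l_def using rz(3)[of "D x0 u"] by (simp add: orthogonal_def inner_commute)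
  \<comment> \<open>\<open>\<Phi>\<close> agrees with \<open>f\<close> modulo \<open>v\<close> and
    has \<open>w\<close> as its coordinate \<open>l\<close>. In this chart \<open>f\<close> moves
    points along \<open>v\<close> only, changing the coordinate \<open>l y\<close> into
    \<open>\<tau> y\<close>, so on each line it is a function of one variable.\<close>
  define \<Phi> where "\<Phi> u = f u + (w u - l (f u)) *\<^sub>R v" for u
  define D\<Phi> where "D\<Phi> x u = D x u + (dw x u - l (D x u)) *\<^sub>R v" for x u
  have d1: "(\<Phi> has_derivative D\<Phi> x) (at x)" for x
    unfolding \<Phi>_def D\<Phi>_def
    by (auto intro!: derivative_eq_intros dw der bounded_linear.has_derivative[OF bll])
  have d2: "continuous_on UNIV (\<lambda>x. D\<Phi> x u)" for u
    unfolding D\<Phi>_def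
    by (intro continuous_intros dw contD bounded_linear.continuous_on[OF bll])
  have inj\<Phi>: "inj (D\<Phi> x0)"
  proof -
    \<comment> \<open>By \<open>star\<close>, \<open>M\<close> is onto and hence injective. On the
      kernel of \<open>D\<Phi> x0\<close> the form \<open>dw x0\<close> vanishes, and there
      \<open>M\<close> agrees with \<open>D\<Phi> x0\<close>.\<close>
    define M where "M \<eta> = D x0 (\<eta> - (dw x0 \<eta> / dw x0 e) *\<^sub>R e) + dw x0 \<eta> *\<^sub>R v" for \<eta>
    have "linear M" unfolding M_def
      by (rule linearI) (auto simp: linear_add[OF lD] linear_diff[OF lD] linear_scale[OF lD] linear_add[OF ldw] linear_scale[OF ldw] algebra_simps add_divide_distrib)
    moreover have "surj M"
    proof -
      have "\<exists>\<eta>. y = M \<eta>" for y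
      proof -
        obtain u s where us: "dw x0 u = 0" "y = D x0 u + s *\<^sub>R v" using star by blast
        have "dw x0 (u + (s / dw x0 e) *\<^sub>R e) = s"
          using us we unfolding linear_add[OF ldw] linear_scale[OF ldw] by (simp add: dw_def)
        then have "M (u + (s / dw x0 e) *\<^sub>R e) = y" unfolding M_def using us by simp
        then show ?thesis by blast
      qed
      then show ?thesis by blast
    qed
    ultimately have "inj M" using linear_surjective_imp_injective by blast
    have "\<eta> = 0" if "D\<Phi> x0 \<eta> = 0" for \<eta>
    proof -
      have "D x0 \<eta> + dw x0 \<eta> *\<^sub>R v = 0" using that l0 unfolding D\<Phi>_def by simp
      then have "l (D x0 \<eta> + dw x0 \<eta> *\<^sub>R v) = 0" using linear_0[OF ll] by simp
      then have "dw x0 \<eta> = 0" using l0 lv by (simp add: linear_add[OF ll] linear_scale[OF ll])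
      then have "M \<eta> = 0" using that l0 unfolding M_def D\<Phi>_def by simp
      then show ?thesis using \<open>inj M\<close> \<open>linear M\<close> linear_injective_0 by blast
    qed
    then show ?thesis using d1 has_derivative_linear linear_injective_0 by blast
  qed
  obtain U V G where UV: "open U" "x0 \<in> U" "open V" "homeomorphism U V \<Phi> G"
    by (rule local_inverse[OF d1 d2 inj\<Phi>]) blast
  obtain U0 where U0: "open U0" "x0 \<in> U0"
    "\<And>W. open W \<Longrightarrow> W \<noteq> {} \<Longrightarrow> W \<subseteq> U0 \<Longrightarrow> \<exists>u\<in>W. \<forall>u'\<in>U0. f u' = f u \<longrightarrow> u' = u"
    using loc[OF x0D] unfolding generically_inj_at_def by (elim exE conjE) simp
  define y0 where "y0 = \<Phi> x0"
  have contG: "continuous_on V G" using UV(4) unfolding homeomorphism_def by blast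
  have "open (V \<inter> G -` U0)" using contG UV(3) U0(1) continuous_on_open_vimage by (metis Int_commute)
  moreover have "y0 \<in> V \<inter> G -` U0" using UV U0 unfolding y0_def homeomorphism_def by auto
  ultimately obtain \<rho> where \<rho>: "\<rho> > 0" "ball y0 \<rho> \<subseteq> V \<inter> G -` U0" using open_contains_ball by blast
  define B where "B = ball y0 \<rho>"
  have BV: "B \<subseteq> V" "\<And>y. y \<in> B \<Longrightarrow> G y \<in> U \<inter> U0" "\<And>y. y \<in> B \<Longrightarrow> \<Phi> (G y) = y"
    using \<rho> UV(4) unfolding B_def homeomorphism_def by auto
  define \<tau> where "\<tau> y = l (f (G y))" for y
  have wG: "w (G y) = l y" if "y \<in> B" for y
  proof -
    have "l y = l (\<Phi> (G y))" using BV that by simp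
    also have "\<dots> = w (G y)" unfolding \<Phi>_def by (simp add: linear_add[OF ll] linear_scale[OF ll] lv)
    finally show ?thesis by simp
  qed
  have fG: "f (G y) = y + (\<tau> y - l y) *\<^sub>R v" if "y \<in> B" for y
  proof -
    have "y = f (G y) + (l y - \<tau> y) *\<^sub>R v" using BV(3)[OF that] wG[OF that] unfolding \<Phi>_def \<tau>_def by simp
    from arg_cong[OF this, of "\<lambda>u. u + (\<tau> y - l y) *\<^sub>R v"]
    have "y + (\<tau> y - l y) *\<^sub>R v = f (G y)" by (simp only: add.assoc scaleR_add_left[symmetric]) simp
    then show ?thesis by (rule sym)
  qed
  have cont\<tau>: "continuous_on B \<tau>"
    unfolding \<tau>_def
    by (intro bounded_linear.continuous_on[OF bll] continuous_on_compose2[OF contf[of UNIV]] continuous_on_subset[OF contG BV(1)]) auto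
  have y0B: "y0 \<in> B" unfolding B_def using \<rho> by simp
  have G0: "G y0 = x0" using UV unfolding y0_def homeomorphism_def by auto
  define \<tau>0 where "\<tau>0 = l b"
  have \<tau>0: "\<tau> y0 = \<tau>0" unfolding \<tau>_def \<tau>0_def G0 x0(2) ..
  have ly0: "l y0 = 0" using wG[OF y0B] wz[OF x0(2)] G0 by simp
  have y0b: "b = y0 + \<tau>0 *\<^sub>R v" using fG[OF y0B] G0 x0(2) \<tau>0 ly0 by simp
  have lin1: "l (y0 + t *\<^sub>R v) = t" for t using ly0 lv by (simp add: linear_add[OF ll] linear_scale[OF ll])
  have fG1: "f (G (y0 + t *\<^sub>R v)) = b + (\<tau> (y0 + t *\<^sub>R v) - \<tau>0) *\<^sub>R v" if "y0 + t *\<^sub>R v \<in> B" for t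
    using fG[OF that] unfolding lin1 y0b by (simp add: algebra_simps)
  \<comment> \<open>Such a point would be mapped to \<open>b\<close>, so \<open>w\<close> would
    vanish there as on the whole fibre; but \<open>w\<close> equals \<open>t\<close> in the
    chart.\<close>
  have claim1: "\<tau> (y0 + t *\<^sub>R v) \<noteq> \<tau>0" if "y0 + t *\<^sub>R v \<in> B" "t \<noteq> 0" for t
  proof
    assume "\<tau> (y0 + t *\<^sub>R v) = \<tau>0"
    then have "w (G (y0 + t *\<^sub>R v)) = 0" using fG1[OF that(1)] wz by simp
    then show False using wG[OF that(1)] lin1 that(2) by simp
  qed
  have "continuous_on {t. y0 + t *\<^sub>R v \<in> B} (\<lambda>t. \<tau> (y0 + t *\<^sub>R v))"
    by (intro continuous_on_compose2[OF cont\<tau>] continuous_intros) auto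
  moreover have "open {t. y0 + t *\<^sub>R v \<in> B}"
    unfolding vimage_def[symmetric] B_def by (intro open_vimage open_ball continuous_intros)
  ultimately have isC: "isCont (\<lambda>t. \<tau> (y0 + t *\<^sub>R v)) 0"
    using y0B by (simp add: continuous_on_eq_continuous_at)
  then obtain \<delta> where \<delta>: "\<delta> > 0" "\<And>t. \<bar>t\<bar> < \<delta> \<Longrightarrow> \<bar>\<tau> (y0 + t *\<^sub>R v) - \<tau>0\<bar> < 1 - ts"
    unfolding continuous_at_eps_delta using ts1 \<tau>0 by (force simp: dist_norm dest: spec[of _ "1 - ts"])
  define \<epsilon> where "\<epsilon> = min (\<delta> / 2) (\<rho> / (2 * norm v))"
  have \<epsilon>: "\<epsilon> > 0" "\<epsilon> < \<delta>" "\<epsilon> * norm v < \<rho>"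
    using \<delta>(1) \<rho>(1) v0 by (auto simp: \<epsilon>_def min_def field_simps)
  have inB: "y0 + t *\<^sub>R v \<in> B" if "\<bar>t\<bar> \<le> \<epsilon>" for t
  proof -
    have "\<bar>t\<bar> * norm v \<le> \<epsilon> * norm v" using that by (simp add: mult_right_mono)
    then show ?thesis using \<epsilon> unfolding B_def by (simp add: dist_norm)
  qed
  \<comment> \<open>A value above \<open>\<tau>0\<close> would lie in the range beyond
    \<open>b\<close> but not beyond \<open>a + v\<close>, against the choice of \<open>ts\<close>.
    So \<open>\<tau>\<close> has a strict maximum at \<open>t = 0\<close> along the line: the
    fold.\<close>
  have claim2: "\<tau> (y0 + t *\<^sub>R v) < \<tau>0" if "\<bar>t\<bar> \<le> \<epsilon>" "t \<noteq> 0" for t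
  proof -
    let ?d = "\<tau> (y0 + t *\<^sub>R v) - \<tau>0"
    have "a + (ts + ?d) *\<^sub>R v = f (G (y0 + t *\<^sub>R v))"
      unfolding fG1[OF inB[OF that(1)]] b_def by (simp only: add.assoc scaleR_add_left)
    then have "a + (ts + ?d) *\<^sub>R v \<in> range f" by simp
    then have "\<not> (ts < ts + ?d \<and> ts + ?d \<le> 1)" using out by blast
    moreover have "\<bar>?d\<bar> < 1 - ts" using \<delta>(2) that \<epsilon> by auto
    ultimately have "?d \<le> 0" by argo
    then show ?thesis using claim1[OF inB[OF that(1)] that(2)] by argo
  qed
  \<comment> \<open>\<open>ym y\<close> and \<open>yz y\<close> are the points with
    \<open>l = -\<epsilon>\<close> and \<open>l = 0\<close> on the line through \<open>y\<close>. On
    \<open>O'\<close> the value \<open>\<tau> y\<close> lies between the values there, so a point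
    with \<open>l \<le> 0\<close> has the same image as \<open>y\<close>, where
    \<open>l y > 0\<close>.\<close>
  define ym where "ym y = y - (l y + \<epsilon>) *\<^sub>R v" for y
  define yz where "yz y = y - l y *\<^sub>R v" for y
  define B1 where "B1 = B \<inter> ym -` B \<inter> yz -` B"
  have contl: "continuous_on A l" for A using bll linear_continuous_on by blast
  have cm: "continuous_on A ym" and cz: "continuous_on A yz" for A
    unfolding ym_def yz_def by (intro continuous_intros contl)+
  have "open B1" unfolding B1_def B_def
    by (intro open_Int open_vimage cm cz) auto
  define O' where "O' = {y\<in>B1. 0 < l y} \<inter> {y\<in>B1. \<tau> (ym y) < \<tau> y} \<inter> {y\<in>B1. \<tau> y < \<tau> (yz y)}"
  have lt_open: "open {y\<in>B1. p y < q y}" if "continuous_on B1 p" "continuous_on B1 q" for p q :: "(real, 'k) vec \<Rightarrow> real"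
  proof -
    have "continuous_on B1 (\<lambda>y. q y - p y)" using that by (intro continuous_intros)
    then have "open (B1 \<inter> (\<lambda>y. q y - p y) -` {0<..})"
      using continuous_on_open_vimage[OF \<open>open B1\<close>] by (metis Int_commute open_greaterThan)
    moreover have "B1 \<inter> (\<lambda>y. q y - p y) -` {0<..} = {y\<in>B1. p y < q y}" by auto
    ultimately show ?thesis by simp
  qed
  have "open O'" unfolding O'_def
    by (intro open_Int lt_open contl continuous_intros continuous_on_compose2[OF cont\<tau> cm] continuous_on_compose2[OF cont\<tau> cz] continuous_on_subset[OF cont\<tau>])
       (auto simp: B1_def)
  have "O' \<noteq> {}"
  proof -
    have "\<tau> (y0 + (-\<epsilon>) *\<^sub>R v) < \<tau>0" using claim2[of "-\<epsilon>"] \<epsilon> by simp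
    then obtain \<delta>' where \<delta>': "\<delta>' > 0" "\<And>t. \<bar>t\<bar> < \<delta>' \<Longrightarrow> \<bar>\<tau> (y0 + t *\<^sub>R v) - \<tau>0\<bar> < \<tau>0 - \<tau> (y0 + (-\<epsilon>) *\<^sub>R v)"
      using isC unfolding continuous_at_eps_delta using \<tau>0
      by (force simp: dist_norm dest: spec[of _ "\<tau>0 - \<tau> (y0 + (-\<epsilon>) *\<^sub>R v)"])
    define t where "t = min \<epsilon> (\<delta>' / 2)"
    have t: "t > 0" "t \<le> \<epsilon>" "t < \<delta>'" using \<epsilon> \<delta>' by (auto simp: t_def)
    have m: "ym (y0 + t *\<^sub>R v) = y0 + (-\<epsilon>) *\<^sub>R v" "yz (y0 + t *\<^sub>R v) = y0"
      unfolding ym_def yz_def lin1 by (auto simp: algebra_simps)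
    have "y0 + t *\<^sub>R v \<in> B1" unfolding B1_def using m inB[of t] inB[of "-\<epsilon>"] t \<epsilon> y0B by auto
    moreover have "\<tau> (y0 + t *\<^sub>R v) < \<tau>0" using claim2[of t] t by auto
    moreover have "\<tau> (y0 + (-\<epsilon>) *\<^sub>R v) < \<tau> (y0 + t *\<^sub>R v)" using \<delta>'(2)[of t] t by auto
    ultimately have "y0 + t *\<^sub>R v \<in> O'" unfolding O'_def using m lin1 t \<tau>0 by auto
    then show ?thesis by blast
  qed
  define W where "W = {u\<in>U \<inter> U0. \<Phi> u \<in> O'}"
  have "open W"
  proof -
    have "continuous_on (U \<inter> U0) \<Phi>"
      using d1 has_derivative_continuous by (metis continuous_at_imp_continuous_on)
    then have "open (\<Phi> -` O' \<inter> (U \<inter> U0))"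
      using continuous_on_open_vimage[of "U \<inter> U0" \<Phi>] UV(1) U0(1) \<open>open O'\<close> by blast
    moreover have "W = \<Phi> -` O' \<inter> (U \<inter> U0)" unfolding W_def by auto
    ultimately show ?thesis by simp
  qed
  moreover have "W \<noteq> {}"
  proof -
    obtain y where "y \<in> O'" using \<open>O' \<noteq> {}\<close> by blast
    moreover then have "y \<in> B" unfolding O'_def B1_def by auto
    ultimately have "G y \<in> W" unfolding W_def using BV by auto
    then show ?thesis by blast
  qed
  ultimately obtain u where u: "u \<in> W" "\<And>u'. u' \<in> U0 \<Longrightarrow> f u' = f u \<Longrightarrow> u' = u"
    using U0(3)[of W] unfolding W_def by blast
  define y where "y = \<Phi> u"
  have y: "y \<in> O'" "G y = u" using u UV(4) unfolding y_def W_def homeomorphism_def by auto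
  then have y': "y \<in> B" "ym y \<in> B" "yz y \<in> B" "0 < l y" "\<tau> (ym y) < \<tau> y" "\<tau> y < \<tau> (yz y)"
    unfolding O'_def B1_def by auto
  have seg: "yz y + s *\<^sub>R v \<in> B" if "-\<epsilon> \<le> s" "s \<le> 0" for s
  proof -
    have "convex B" unfolding B_def by simp
    moreover have "yz y + s *\<^sub>R v = (1 - (- s / \<epsilon>)) *\<^sub>R yz y + (- s / \<epsilon>) *\<^sub>R ym y"
      unfolding yz_def ym_def using \<epsilon> by (simp add: algebra_simps)
    moreover have "0 \<le> - s / \<epsilon>" "- s / \<epsilon> \<le> 1" using that \<epsilon> by (auto simp: field_simps)
    ultimately show ?thesis using y'(2,3) convexD_alt by metis
  qed
  have "continuous_on {-\<epsilon>..0} (\<lambda>s. \<tau> (yz y + s *\<^sub>R v))"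
    by (intro continuous_on_compose2[OF cont\<tau>] continuous_intros) (use seg in auto)
  moreover have "yz y + (-\<epsilon>) *\<^sub>R v = ym y" unfolding yz_def ym_def by (simp add: algebra_simps)
  ultimately obtain s where s: "-\<epsilon> \<le> s" "s \<le> 0" "\<tau> (yz y + s *\<^sub>R v) = \<tau> y"
    using IVT'[of "\<lambda>s. \<tau> (yz y + s *\<^sub>R v)" "-\<epsilon>" "\<tau> y" 0] y'(5,6) \<epsilon> by auto
  let ?u = "G (yz y + s *\<^sub>R v)"
  have ls: "l (yz y + s *\<^sub>R v) = s" unfolding yz_def by (simp add: linear_add[OF ll] linear_diff[OF ll] linear_scale[OF ll] lv)
  have "f ?u = yz y + s *\<^sub>R v + (\<tau> y - s) *\<^sub>R v"
    using fG[OF seg[OF s(1,2)]] unfolding ls s(3) .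
  also have "\<dots> = y + (\<tau> y - l y) *\<^sub>R v" unfolding yz_def by (simp add: algebra_simps)
  also have "\<dots> = f u" using fG[OF y'(1)] unfolding y(2) by simp
  finally have "f ?u = f u" .
  then have "?u = u" using u(2) BV(2)[OF seg[OF s(1,2)]] by blast
  then have "w ?u = w u" by simp
  then show False using wG[OF seg[OF s(1,2)]] wG[OF y'(1)] y(2) ls s(2) y'(4) by simp
qed

text \<open>\<open>baby_Sard\<close> needs a well-ordered index type.\<close>

typedef (overloaded) 'a dim_index = "{..<DIM('a::euclidean_space)}"
  by (auto intro: exI[of _ 0])

instantiation dim_index :: (euclidean_space) "{finite, wellorder}"
begin

definition less_eq_dim_index :: "'a dim_index \<Rightarrow> 'a dim_index \<Rightarrow> bool" where
  "less_eq_dim_index i j \<longleftrightarrow> Rep_dim_index i \<le> Rep_dim_index j"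

definition less_dim_index :: "'a dim_index \<Rightarrow> 'a dim_index \<Rightarrow> bool" where
  "less_dim_index i j \<longleftrightarrow> Rep_dim_index i < Rep_dim_index j"

instance
proof
  show "finite (UNIV :: 'a dim_index set)"
    using type_definition.univ[OF type_definition_dim_index] by (metis finite_imageI finite_lessThan)
next
  fix P :: "'a dim_index \<Rightarrow> bool" and a
  assume step: "\<And>x. (\<And>y. y < x \<Longrightarrow> P y) \<Longrightarrow> P x"
  show "P a"
    by (induction a rule: measure_induct_rule[of Rep_dim_index]) (auto intro: step simp: less_dim_index_def)
qed (auto simp: less_eq_dim_index_def less_dim_index_def Rep_dim_index_inject)

end

lemma card_dim_index: "CARD('a::euclidean_space dim_index) = DIM('a)"
  by (simp add: type_definition.card[OF type_definition_dim_index])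

theorem fold_contradiction:
  fixes f :: "'a::euclidean_space \<Rightarrow> 'a"
  assumes poly: "polynomial_function f"
    and der: "\<And>x. (f has_derivative D x) (at x)"
    and closed: "closed (range f)" and nonsurj: "range f \<noteq> UNIV"
    and reg: "inj (D x1)"
    and fin: "finite \<D>" and codim: "\<And>S. S \<in> \<D> \<Longrightarrow> subspace S \<and> dim S + 2 \<le> DIM('a)"
    and loc: "\<And>x. x \<notin> \<Union>\<D> \<Longrightarrow> generically_inj_at f x"
  shows False
proof -
  have "DIM((real, 'a dim_index) vec) = DIM('a)" by (simp add: card_dim_index)
  then obtain \<phi> :: "(real, 'a dim_index) vec \<Rightarrow> 'a" and \<psi> where
    lin: "linear \<phi>" "linear \<psi>" and inv: "\<And>x. \<psi> (\<phi> x) = x" "\<And>y. \<phi> (\<psi> y) = y"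
    using isomorphisms_UNIV_UNIV by metis
  have bl: "bounded_linear \<phi>" "bounded_linear \<psi>" using lin linear_conv_bounded_linear by auto
  have cont: "continuous_on A \<phi>" "continuous_on B \<psi>" for A B
    using lin linear_continuous_on[OF bl(1)] linear_continuous_on[OF bl(2)] by auto
  define f' where "f' x = \<psi> (f (\<phi> x))" for x
  have rf: "range f' = \<phi> -` range f"
  proof
    show "range f' \<subseteq> \<phi> -` range f" unfolding f'_def by (auto simp: inv)
    show "\<phi> -` range f \<subseteq> range f'"
    proof
      fix x assume "x \<in> \<phi> -` range f"
      then obtain y where "\<phi> x = f y" by auto
      then have "x = f' (\<psi> y)" unfolding f'_def inv by (metis inv(1))
      then show "x \<in> range f'" by blast
    qed
  qed
  have op: "open (\<phi> ` W)" if "open W" for W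
  proof -
    have "\<phi> ` W = \<psi> -` W" using inv by (auto simp: image_iff) (metis inv(2))
    then show ?thesis using open_vimage[OF that cont(2)] by simp
  qed
  show False
  proof (rule fold_contradiction_cart[of f' "\<lambda>x u. \<psi> (D (\<phi> x) (\<phi> u))" "\<psi> x1" "(`) \<psi> ` \<D>"])
    have "polynomial_function (\<psi> \<circ> f \<circ> \<phi>)"
      by (intro polynomial_function_compose poly polynomial_function_bounded_linear bl)
    then show "polynomial_function f'" unfolding f'_def o_def .
    show "(f' has_derivative (\<lambda>u. \<psi> (D (\<phi> x) (\<phi> u)))) (at x)" for x
    proof -
      have "((\<lambda>x. f (\<phi> x)) has_derivative (\<lambda>u. D (\<phi> x) (\<phi> u))) (at x)"
        using has_derivative_compose[OF bounded_linear_imp_has_derivative[OF bl(1)] der] .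
      then show ?thesis unfolding f'_def by (rule bounded_linear.has_derivative[OF bl(2)])
    qed
    show "closed (range f')" unfolding rf using closed_vimage[OF closed cont(1)] .
    show "range f' \<noteq> UNIV"
    proof
      assume "range f' = UNIV"
      then have "\<phi> x \<in> range f" for x unfolding rf by blast
      then have "y \<in> range f" for y using inv(2) by metis
      then show False using nonsurj by blast
    qed
    show "inj (\<lambda>u. \<psi> (D (\<phi> (\<psi> x1)) (\<phi> u)))"
      using reg inv by (intro injI) (metis injD)
    show "finite ((`) \<psi> ` \<D>)" using fin by simp
    show "subspace S \<and> dim S + 2 \<le> CARD('a dim_index)" if S: "S \<in> (`) \<psi> ` \<D>" for S
    proof -
      obtain T where T: "T \<in> \<D>" "S = \<psi> ` T" using S by blast
      have "dim (\<psi> ` T) \<le> dim T" using dim_image_le lin by blast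
      then show ?thesis using codim[OF T(1)] linear_subspace_image[OF lin(2)] unfolding T(2) card_dim_index by force
    qed
    fix x assume x: "x \<notin> \<Union> ((`) \<psi> ` \<D>)"
    have "\<phi> x \<notin> \<Union>\<D>"
    proof
      assume "\<phi> x \<in> \<Union>\<D>"
      then have "\<psi> (\<phi> x) \<in> \<Union> ((`) \<psi> ` \<D>)" by blast
      then show False using x inv by simp
    qed
    from loc[OF this, unfolded generically_inj_at_def] obtain U where U: "open U" "\<phi> x \<in> U"
      "\<forall>W. open W \<and> W \<noteq> {} \<and> W \<subseteq> U \<longrightarrow> (\<exists>u\<in>W. \<forall>u'\<in>U. f u' = f u \<longrightarrow> u' = u)" by (elim exE conjE)
    show "generically_inj_at f' x"
      unfolding generically_inj_at_def
    proof (intro exI[of _ "\<phi> -` U"] conjI allI impI)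
      show "open (\<phi> -` U)" using open_vimage[OF U(1) cont(1)] .
      show "x \<in> \<phi> -` U" using U(2) by simp
      fix W assume W: "open W \<and> W \<noteq> {} \<and> W \<subseteq> \<phi> -` U"
      then have "open (\<phi> ` W) \<and> \<phi> ` W \<noteq> {} \<and> \<phi> ` W \<subseteq> U" using op by auto
      with U(3) obtain u where u: "u \<in> \<phi> ` W" "\<forall>u'\<in>U. f u' = f u \<longrightarrow> u' = u" by blast
      then obtain y where y: "y \<in> W" "u = \<phi> y" by blast
      show "\<exists>u\<in>W. \<forall>u'\<in>\<phi> -` U. f' u' = f' u \<longrightarrow> u' = u"
      proof (intro bexI[of _ y] ballI impI)
        fix u' assume u': "u' \<in> \<phi> -` U" "f' u' = f' y"
        then have "f (\<phi> u') = f u" unfolding f'_def y(2) using inv(2) by metis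
        then have "\<phi> u' = \<phi> y" using u(2) u'(1) y(2) by simp
        then show "u' = y" using inv(1) by metis
      qed (use y in simp)
    qed
  qed
qed

section \<open>Rational polynomials at generic points\<close>

text \<open>A class of functions closed under the ring operations lets determinants and Cramer's
  rule be recognised as rational polynomials without handling coefficients; the passage to
  \<open>poly_eval_rat\<close> is made only once.\<close>

inductive rat_poly :: "(('v \<Rightarrow> real) \<Rightarrow> real) \<Rightarrow> bool" where
  const: "c \<in> \<rat> \<Longrightarrow> rat_poly (\<lambda>x. c)"
| var: "rat_poly (\<lambda>x. x v)"
| add: "rat_poly f \<Longrightarrow> rat_poly g \<Longrightarrow> rat_poly (\<lambda>x. f x + g x)"
| mult: "rat_poly f \<Longrightarrow> rat_poly g \<Longrightarrow> rat_poly (\<lambda>x. f x * g x)"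

lemma rat_poly_sum: "(\<And>i. i \<in> I \<Longrightarrow> rat_poly (\<lambda>x. f x i)) \<Longrightarrow> rat_poly (\<lambda>x. \<Sum>i\<in>I. f x i)"
  by (induction I rule: infinite_finite_induct) (auto intro: rat_poly.intros)

lemma rat_poly_prod: "(\<And>i. i \<in> I \<Longrightarrow> rat_poly (\<lambda>x. f x i)) \<Longrightarrow> rat_poly (\<lambda>x. \<Prod>i\<in>I. f x i)"
  by (induction I rule: infinite_finite_induct) (auto intro: rat_poly.intros)

lemma rat_poly_cmult: "c \<in> \<rat> \<Longrightarrow> rat_poly f \<Longrightarrow> rat_poly (\<lambda>x. c * f x)"
  by (intro rat_poly.mult rat_poly.const)

lemma rat_poly_diff: "rat_poly f \<Longrightarrow> rat_poly g \<Longrightarrow> rat_poly (\<lambda>x. f x - g x)"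
  using rat_poly.add[OF _ rat_poly_cmult[of "-1" g], of f] by simp

lemma rat_poly_det:
  fixes A :: "('v \<Rightarrow> real) \<Rightarrow> real^'n^'n"
  assumes "\<And>i j. rat_poly (\<lambda>x. A x $ i $ j)"
  shows "rat_poly (\<lambda>x. det (A x))"
  unfolding det_def by (intro rat_poly_sum rat_poly_cmult rat_poly_prod assms) simp

definition mon_eval :: "('v \<Rightarrow>\<^sub>0 nat) \<Rightarrow> ('v \<Rightarrow> real) \<Rightarrow> real" where
  "mon_eval m x = (\<Prod>v\<in>Poly_Mapping.keys m. x v ^ Poly_Mapping.lookup m v)"

lemma mon_eval_superset:
  "finite S \<Longrightarrow> Poly_Mapping.keys m \<subseteq> S \<Longrightarrow> mon_eval m x = (\<Prod>v\<in>S. x v ^ Poly_Mapping.lookup m v)"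
  unfolding mon_eval_def by (rule prod.mono_neutral_left) (auto simp: in_keys_iff)

lemma mon_eval_add: "mon_eval (m + m') x = mon_eval m x * mon_eval m' x"
proof -
  let ?S = "Poly_Mapping.keys m \<union> Poly_Mapping.keys m'"
  have "mon_eval (m + m') x = (\<Prod>v\<in>?S. x v ^ Poly_Mapping.lookup (m + m') v)"
    by (rule mon_eval_superset) (simp_all add: keys_add)
  also have "\<dots> = (\<Prod>v\<in>?S. x v ^ Poly_Mapping.lookup m v) * (\<Prod>v\<in>?S. x v ^ Poly_Mapping.lookup m' v)"
    by (simp add: lookup_add power_add prod.distrib)
  also have "\<dots> = mon_eval m x * mon_eval m' x"
    by (subst (1 2) mon_eval_superset[of ?S]) auto
  finally show ?thesis .
qed

lemma poly_eval_rat_superset: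
  "finite S \<Longrightarrow> Poly_Mapping.keys P \<subseteq> S \<Longrightarrow>
    poly_eval_rat P x = (\<Sum>m\<in>S. of_rat (Poly_Mapping.lookup P m) * mon_eval m x)"
  unfolding poly_eval_rat_def mon_eval_def by (rule sum.mono_neutral_left) (auto simp: in_keys_iff)

lemma poly_eval_rat_add: "poly_eval_rat (P + Q) x = poly_eval_rat P x + poly_eval_rat Q x"
proof -
  let ?S = "Poly_Mapping.keys P \<union> Poly_Mapping.keys Q"
  have "poly_eval_rat (P + Q) x = (\<Sum>m\<in>?S. of_rat (Poly_Mapping.lookup (P + Q) m) * mon_eval m x)"
    by (rule poly_eval_rat_superset) (simp_all add: keys_add)
  also have "\<dots> = (\<Sum>m\<in>?S. of_rat (Poly_Mapping.lookup P m) * mon_eval m x)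
    + (\<Sum>m\<in>?S. of_rat (Poly_Mapping.lookup Q m) * mon_eval m x)"
    by (simp add: lookup_add of_rat_add distrib_right sum.distrib)
  also have "\<dots> = poly_eval_rat P x + poly_eval_rat Q x"
    by (subst (1 2) poly_eval_rat_superset[of ?S]) auto
  finally show ?thesis .
qed

lemma poly_eval_rat_single: "poly_eval_rat (Poly_Mapping.single m c) x = of_rat c * mon_eval m x"
  by (subst poly_eval_rat_superset[of "{m}"]) auto

lemma poly_eval_rat_0: "poly_eval_rat 0 x = 0"
  unfolding poly_eval_rat_def by simp

lemma poly_eval_rat_sum: "finite I \<Longrightarrow> poly_eval_rat (\<Sum>i\<in>I. P i) x = (\<Sum>i\<in>I. poly_eval_rat (P i) x)"
  by (induction I rule: finite_induct) (auto simp: poly_eval_rat_add poly_eval_rat_0)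

lemma rat_poly_imp_poly_eval_rat: "rat_poly f \<Longrightarrow> \<exists>P. \<forall>x. f x = poly_eval_rat P x"
proof (induction rule: rat_poly.induct)
  case (const c)
  then obtain r where "c = of_rat r" by (auto elim: Rats_cases)
  then show ?case by (intro exI[of _ "Poly_Mapping.single 0 r"]) (simp add: poly_eval_rat_single mon_eval_def)
next
  case (var v)
  show ?case
    by (intro exI[of _ "Poly_Mapping.single (Poly_Mapping.single v 1) 1"])
      (simp add: poly_eval_rat_single mon_eval_def)
next
  case (add f g)
  then show ?case by (metis poly_eval_rat_add)
next
  case (mult f g)
  then obtain P Q where P: "\<And>x. f x = poly_eval_rat P x" and Q: "\<And>x. g x = poly_eval_rat Q x" by auto
  let ?R = "\<Sum>m\<in>Poly_Mapping.keys P. \<Sum>m'\<in>Poly_Mapping.keys Q.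
    Poly_Mapping.single (m + m') (Poly_Mapping.lookup P m * Poly_Mapping.lookup Q m')"
  have "f x * g x = poly_eval_rat ?R x" for x
  proof -
    have "f x * g x = (\<Sum>m\<in>Poly_Mapping.keys P. of_rat (Poly_Mapping.lookup P m) * mon_eval m x) *
       (\<Sum>m\<in>Poly_Mapping.keys Q. of_rat (Poly_Mapping.lookup Q m) * mon_eval m x)"
      unfolding P Q poly_eval_rat_def mon_eval_def ..
    also have "\<dots> = poly_eval_rat ?R x"
      by (simp add: poly_eval_rat_sum poly_eval_rat_single sum_product mon_eval_add of_rat_mult mult_ac)
    finally show ?thesis .
  qed
  then show ?case by blast
qed

text \<open>The only way genericity enters the algebra: being nonzero at a single witness
  \<open>x0\<close> makes the polynomial nonzero, hence nonzero at a generic point.\<close>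

lemma rat_poly_nonzero:
  assumes "algebraically_independent_rat p" "rat_poly f" "f x0 \<noteq> 0"
  shows "f p \<noteq> 0"
  using assms rat_poly_imp_poly_eval_rat[OF assms(2)] poly_eval_rat_0
  unfolding algebraically_independent_rat_def by metis

text \<open>Some rows of a matrix, completed by constant rational rows. A nonzero determinant bounds the rank from below,
  and Cramer's rule yields kernel vectors that depend polynomially on the matrix.\<close>

definition fill_rows :: "('a \<Rightarrow> 'r option) \<Rightarrow> ('a \<Rightarrow> real^'a) \<Rightarrow> real^'a^'r \<Rightarrow> real^'a^'a" where
  "fill_rows sel c A = (\<chi> t. case sel t of Some r \<Rightarrow> A $ r | None \<Rightarrow> c t)"

text \<open>A basis taken from the rows is completed by standard basis vectors. The latter are the
  constant rows, which makes them rational.\<close>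

lemma fill_rows_exists:
  fixes A :: "real^'a^'r"
  obtains sel :: "'a \<Rightarrow> 'r option" and c where "det (fill_rows sel c A) \<noteq> 0"
    "card {t. sel t \<noteq> None} = rank A" "\<And>t i. c t $ i \<in> \<rat>"
proof -
  obtain B0 where B0: "B0 \<subseteq> rows A" "independent B0" "rows A \<subseteq> span B0" "card B0 = dim (rows A)"
    using basis_exists by blast
  obtain B where B: "B0 \<subseteq> B" "B \<subseteq> B0 \<union> Basis" "independent B" "B0 \<union> Basis \<subseteq> span B"
    using maximal_independent_subset_extend[of B0 "B0 \<union> Basis"] B0(2) by blast
  have "span Basis \<subseteq> span B" using B(4) span_minimal subspace_span by blast
  then have sB: "span B = UNIV" by auto
  have "card B = CARD('a)"
    using basis_card_eq_dim[of B UNIV] B(3) sB by simp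
  moreover have fB: "finite B" using B(3) independent_imp_finite by blast
  ultimately obtain b where b: "bij_betw b (UNIV :: 'a set) B"
    using finite_same_card_bij by (metis finite)
  define sel where "sel t = (if b t \<in> B0 then Some (SOME r. A $ r = b t) else None)" for t
  have row: "A $ (SOME r. A $ r = b t) = b t" if "b t \<in> B0" for t
  proof -
    have "b t \<in> rows A" using that B0(1) by blast
    then have "\<exists>r. A $ r = b t" unfolding rows_def row_def by (auto simp: vec_lambda_eta)
    then show ?thesis by (rule someI_ex)
  qed
  define c where "c t = (if b t \<in> B0 then 0 else b t)" for t
  have fill: "fill_rows sel c A = (\<chi> t. b t)"
    unfolding fill_rows_def sel_def c_def using row by (auto simp: vec_eq_iff)
  have "rows (\<chi> t. b t) = B"
    using b unfolding rows_def row_def bij_betw_def by (auto simp: vec_lambda_eta)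
  then have "invertible (fill_rows sel c A)"
    unfolding fill invertible_left_inverse matrix_left_invertible_span_rows using sB by simp
  then have 1: "det (fill_rows sel c A) \<noteq> 0" using invertible_det_nz by blast
  have "{t. sel t \<noteq> None} = {t. b t \<in> B0}" unfolding sel_def by auto
  moreover have "bij_betw b {t. b t \<in> B0} B0"
    using b B(1) unfolding bij_betw_def inj_on_def by (auto simp: image_iff)
  ultimately have 2: "card {t. sel t \<noteq> None} = rank A"
    using bij_betw_same_card B0(4) unfolding row_rank_def by fastforce
  have 3: "c t $ i \<in> \<rat>" for t i
  proof (cases "b t \<in> B0")
    case False
    then have "b t \<in> Basis" using b B(2) unfolding bij_betw_def by blast
    then obtain j where "b t = axis j 1" unfolding Basis_vec_def by auto
    then show ?thesis using False unfolding c_def axis_def by auto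
  qed (simp add: c_def)
  show thesis using that 1 2 3 by blast
qed

lemma fill_rows_rank:
  fixes A :: "real^'a^'r"
  assumes "det (fill_rows sel c A) \<noteq> 0"
  shows "card {t. sel t \<noteq> None} \<le> rank A"
    "card {t. sel t \<noteq> None} = rank A \<Longrightarrow> (\<And>t r. sel t = Some r \<Longrightarrow> A $ r \<bullet> w = 0) \<Longrightarrow> A *v w = 0"
proof -
  let ?N = "fill_rows sel c A" and ?T = "{t. sel t \<noteq> None}"
  have "invertible ?N" using assms invertible_det_nz by blast
  then have sp: "span (rows ?N) = UNIV"
    unfolding matrix_left_invertible_span_rows[symmetric] invertible_def by blast
  have rN: "rows ?N = range (\<lambda>t. ?N $ t)" unfolding rows_def row_def by (auto simp: vec_lambda_eta)
  have "CARD('a) \<le> card (rows ?N)"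
    using dim_le_card[of UNIV "rows ?N"] sp rN by simp
  then have card: "card (rows ?N) = CARD('a)"
    using card_image_le[of UNIV "\<lambda>t. ?N $ t"] rN by simp
  then have inj: "inj (\<lambda>t. ?N $ t)" using rN by (intro eq_card_imp_inj_on) auto
  have indep: "independent (rows ?N)"
  proof (rule card_le_dim_spanning[of _ UNIV])
    show "UNIV \<subseteq> span (rows ?N)" using sp by simp
    show "finite (rows ?N)" unfolding rN by simp
    show "card (rows ?N) \<le> dim (UNIV :: (real^'a) set)" using card by simp
  qed simp
  let ?S = "(\<lambda>t. ?N $ t) ` ?T"
  have indS: "independent ?S" by (rule independent_mono[OF indep]) (auto simp: rN)
  have cS: "card ?S = card ?T" by (rule card_image[OF inj_on_subset[OF inj]]) simp
  have SA: "?S \<subseteq> rows A"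
  proof
    fix y assume "y \<in> ?S"
    then obtain t r where "sel t = Some r" "y = ?N $ t" by auto
    then have "y = A $ r" unfolding fill_rows_def by simp
    then show "y \<in> rows A" unfolding rows_def row_def by (auto simp: vec_lambda_eta)
  qed
  show "card ?T \<le> rank A"
    using independent_card_le_dim[OF SA indS] unfolding cS row_rank_def .
  assume eq: "card ?T = rank A" and w: "\<And>t r. sel t = Some r \<Longrightarrow> A $ r \<bullet> w = 0"
  have "rows A \<subseteq> span ?S"
    by (rule card_ge_dim_independent[OF SA indS]) (use eq in \<open>simp only: cS row_rank_def\<close>)
  moreover have "y \<bullet> w = 0" if "y \<in> span ?S" for y
  proof -
    have "subspace {y. y \<bullet> w = 0}" by (auto simp: subspace_def inner_left_distrib)
    moreover have "?S \<subseteq> {y. y \<bullet> w = 0}" using w unfolding fill_rows_def by (auto split: option.splits)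
    ultimately have "span ?S \<subseteq> {y. y \<bullet> w = 0}" using span_minimal by blast
    then show ?thesis using that by blast
  qed
  ultimately have "A $ r \<bullet> w = 0" for r unfolding rows_def row_def by (auto simp: vec_lambda_eta)
  then show "A *v w = 0" by (simp add: vec_eq_iff matrix_vector_mul_component)
qed

lemma rat_poly_fill_rows:
  fixes A :: "('v \<Rightarrow> real) \<Rightarrow> real^'a^'r"
  assumes "\<And>i j. rat_poly (\<lambda>x. A x $ i $ j)" "\<And>t i. c t $ i \<in> \<rat>"
  shows "rat_poly (\<lambda>x. fill_rows sel c (A x) $ i $ j)"
  unfolding fill_rows_def by (cases "sel i") (auto intro: assms rat_poly.const)

text \<open>The determinant that certifies the rank at \<open>x0\<close> is a rational polynomial in
  \<open>x\<close>, so it does not vanish at \<open>p\<close> either.\<close>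

lemma rank_generic_max:
  fixes M :: "('v \<Rightarrow> real) \<Rightarrow> real^'a^'r"
  assumes p: "algebraically_independent_rat p" and M: "\<And>i j. rat_poly (\<lambda>x. M x $ i $ j)"
  shows "rank (M x0) \<le> rank (M p)"
proof -
  obtain sel :: "'a \<Rightarrow> 'r option" and c where f: "det (fill_rows sel c (M x0)) \<noteq> 0"
    "card {t. sel t \<noteq> None} = rank (M x0)" "\<And>t i. c t $ i \<in> \<rat>"
    by (rule fill_rows_exists[of "M x0"]) blast
  have "det (fill_rows sel c (M p)) \<noteq> 0"
    by (rule rat_poly_nonzero[where f = "\<lambda>x. det (fill_rows sel c (M x))", OF p rat_poly_det f(1)])
      (intro rat_poly_fill_rows M f(3))
  from fill_rows_rank(1)[OF this] show ?thesis using f(2) by simp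
qed

text \<open>Kernel vectors of \<open>M x\<close> are real combinations of vectors that are
  polynomial in \<open>x\<close>. The determinant certifying the rank of \<open>\<Lambda> s\<close>
  stays nonzero when the coefficients are perturbed to rational ones; it is then a rational
  polynomial in \<open>x\<close>, and the same combination works at \<open>p\<close>.\<close>

lemma rank_kernel_generic_max:
  fixes M :: "('v \<Rightarrow> real) \<Rightarrow> real^'a^'r" and \<Lambda> :: "real^'a \<Rightarrow> real^'m^'m"
  assumes p: "algebraically_independent_rat p" and M: "\<And>i j. rat_poly (\<lambda>x. M x $ i $ j)"
    and eq: "rank (M x0) = rank (M p)" and s: "M x0 *v s = 0"
    and L: "\<And>i j a. L i j a \<in> \<rat>" "\<And>w i j. \<Lambda> w $ i $ j = (\<Sum>a\<in>UNIV. L i j a * w $ a)"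
  shows "\<exists>s'. M p *v s' = 0 \<and> rank (\<Lambda> s) \<le> rank (\<Lambda> s')"
proof -
  obtain sel :: "'a \<Rightarrow> 'r option" and c where f: "det (fill_rows sel c (M x0)) \<noteq> 0"
    "card {t. sel t \<noteq> None} = rank (M x0)" "\<And>t i. c t $ i \<in> \<rat>"
    by (rule fill_rows_exists[of "M x0"]) blast
  define N where "N x = fill_rows sel c (M x)" for x
  have Npoly: "rat_poly (\<lambda>x. N x $ i $ j)" for i j
    unfolding N_def by (intro rat_poly_fill_rows M f(3))
  have dx: "det (N x0) \<noteq> 0" using f(1) N_def by simp
  have dp: "det (N p) \<noteq> 0"
    by (rule rat_poly_nonzero[where f = "\<lambda>x. det (N x)", OF p rat_poly_det dx]) (rule Npoly)
  \<comment> \<open>Cramer's numerators: a column of the adjugate of \<open>N x\<close>, that is,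
    \<open>det (N x)\<close> times the solution for the right side \<open>axis t 1\<close>.\<close>
  define W where "W t x = (\<chi> k. det (\<chi> i j. if j = k then axis t 1 $ i else N x $ i $ j))" for t x
  have Wpoly: "rat_poly (\<lambda>x. W t x $ k)" for t k
  proof -
    have "rat_poly (\<lambda>x. det (\<chi> i j. if j = k then axis t 1 $ i else N x $ i $ j))"
    proof (rule rat_poly_det)
      show "rat_poly (\<lambda>x. (\<chi> i j. if j = k then axis t 1 $ i else N x $ i $ j) $ i $ j)" for i j
        by (cases "j = k") (auto intro: Npoly rat_poly.const simp: axis_def)
    qed
    then show ?thesis unfolding W_def by simp
  qed
  have NW: "N x *v W t x = det (N x) *\<^sub>R axis t 1" if "det (N x) \<noteq> 0" for t x
  proof -
    define z where "z = (\<chi> k. det (\<chi> i j. if j = k then axis t 1 $ i else N x $ i $ j) / det (N x))"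
    have "N x *v z = axis t 1" using cramer[OF that, of z "axis t 1"] unfolding z_def by blast
    moreover have "W t x = det (N x) *\<^sub>R z" unfolding W_def z_def using that by (simp add: vec_eq_iff)
    ultimately show ?thesis by (simp add: matrix_vector_mult_scaleR)
  qed
  \<comment> \<open>\<open>N p\<close> sends \<open>W t p\<close> to a multiple of the unit vector
    at the unselected index \<open>t\<close>, so all selected rows of \<open>M p\<close> annihilate
    it. Equality of ranks makes these rows span the row space.\<close>
  have Wp: "M p *v W t p = 0" if "sel t = None" for t
  proof (rule fill_rows_rank(2))
    show "det (fill_rows sel c (M p)) \<noteq> 0" using dp N_def by simp
    show "card {t. sel t \<noteq> None} = rank (M p)" using f(2) eq by simp
    fix t' r assume r: "sel t' = Some r"
    then have "t' \<noteq> t" using that by auto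
    have "M p $ r = N p $ t'" unfolding N_def fill_rows_def using r by simp
    then have "M p $ r \<bullet> W t p = (N p *v W t p) $ t'" by (simp add: matrix_vector_mul_component)
    also have "\<dots> = 0" using NW[OF dp, of t] \<open>t' \<noteq> t\<close> by (simp add: axis_def)
    finally show "M p $ r \<bullet> W t p = 0" .
  qed
  define T where "T = {t. sel t = None}"
  define comb where "comb a x = (\<Sum>t\<in>T. a $ t *\<^sub>R W t x)" for a :: "real^'a" and x
  define a0 where "a0 = (\<chi> t. (N x0 *v s) $ t / det (N x0))"
  have "s = comb a0 x0"
  proof -
    have "(N x0 *v s) $ t = 0" if "t \<notin> T" for t
    proof -
      obtain r where r: "sel t = Some r" using \<open>t \<notin> T\<close> unfolding T_def by auto
      then have "(N x0 *v s) $ t = (M x0 *v s) $ r"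
        unfolding N_def fill_rows_def by (simp add: matrix_vector_mul_component)
      then show ?thesis using s by simp
    qed
    then have "N x0 *v s = (\<Sum>t\<in>T. (N x0 *v s) $ t *\<^sub>R axis t 1)"
      by (auto simp: vec_eq_iff axis_def if_distrib cong: if_cong)
    also have "\<dots> = N x0 *v comb a0 x0"
      unfolding comb_def using dx
      by (simp add: linear_sum[OF matrix_vector_mul_linear] matrix_vector_mult_scaleR NW a0_def)
    finally have "N x0 *v s = N x0 *v comb a0 x0" .
    moreover have "inj ((*v) (N x0))"
      using dx invertible_det_nz inj_matrix_vector_mult by blast
    ultimately show ?thesis by (meson injD)
  qed
  obtain sel' :: "'m \<Rightarrow> 'm option" and c' where f': "det (fill_rows sel' c' (\<Lambda> s)) \<noteq> 0"
    "card {t. sel' t \<noteq> None} = rank (\<Lambda> s)" "\<And>t i. c' t $ i \<in> \<rat>"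
    by (rule fill_rows_exists[of "\<Lambda> s"]) blast
  define F where "F a x = det (fill_rows sel' c' (\<Lambda> (comb a x)))" for a x
  have "continuous_on UNIV (\<lambda>a. F a x0)"
  proof -
    have ent: "continuous_on UNIV (\<lambda>a. fill_rows sel' c' (\<Lambda> (comb a x0)) $ i $ j)" for i j
    proof (cases "sel' i")
      case None
      then show ?thesis unfolding fill_rows_def by simp
    next
      case (Some r)
      then have "fill_rows sel' c' (\<Lambda> (comb a x0)) $ i $ j = (\<Sum>b\<in>UNIV. L r j b * comb a x0 $ b)" for a
        by (simp add: fill_rows_def L(2))
      then show ?thesis unfolding comb_def by (auto intro!: continuous_intros)
    qed
    then show ?thesis unfolding F_def det_def by (intro continuous_on_sum continuous_on_mult continuous_on_const continuous_on_prod ent)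
  qed
  \<comment> \<open>The admissible coefficient vectors form a nonempty open set, which therefore
    contains a rational one.\<close>
  then have "open {a. F a x0 \<noteq> 0}"
    by (intro open_Collect_neq) auto
  moreover have "a0 \<in> {a. F a x0 \<noteq> 0}" using f'(1) \<open>s = comb a0 x0\<close> unfolding F_def by simp
  moreover define Q where "Q = (\<Union>f \<in> Basis \<rightarrow> \<rat>. { \<Sum>i :: real^'a \<in> Basis. f i *\<^sub>R i })"
  moreover have "a0 \<in> closure Q" unfolding Q_def closure_rational_coordinates by simp
  ultimately have "{a. F a x0 \<noteq> 0} \<inter> Q \<noteq> {}"
    using open_Int_closure_eq_empty[of "{a. F a x0 \<noteq> 0}" Q] by blast
  then obtain a where a: "F a x0 \<noteq> 0" "a \<in> Q" by blast
  have aR: "a $ t \<in> \<rat>" for t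
  proof -
    obtain g where g: "g \<in> Basis \<rightarrow> \<rat>" "a = (\<Sum>i\<in>Basis. g i *\<^sub>R i)" using a(2) unfolding Q_def by auto
    have "a $ t = a \<bullet> axis t 1" by (simp add: inner_axis)
    also have "\<dots> = g (axis t 1)" unfolding g(2) by (rule inner_sum_left_Basis) (simp add: axis_in_Basis_iff)
    finally show ?thesis using g(1) by (auto simp: axis_in_Basis_iff)
  qed
  have "F a p \<noteq> 0"
  proof (rule rat_poly_nonzero[where f = "F a", OF p _ a(1)])
    show "rat_poly (F a)"
      unfolding F_def
    proof (rule rat_poly_det, rule rat_poly_fill_rows[OF _ f'(3)])
      show "rat_poly (\<lambda>x. \<Lambda> (comb a x) $ i $ j)" for i j
        unfolding L comb_def sum_component vector_scaleR_component real_scaleR_def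
        by (intro rat_poly_sum rat_poly_cmult L aR Wpoly)
    qed
  qed
  then have "card {t. sel' t \<noteq> None} \<le> rank (\<Lambda> (comb a p))"
    unfolding F_def by (rule fill_rows_rank(1))
  moreover have "M p *v comb a p = 0"
    unfolding comb_def T_def by (simp add: linear_sum[OF matrix_vector_mul_linear] matrix_vector_mult_scaleR Wp)
  ultimately show ?thesis using f'(2) by metis
qed

section \<open>Stresses\<close>

lemma subspace_linear_kernel: "linear T \<Longrightarrow> subspace {x. T x = 0}"
  by (simp add: subspace_def linear_0 linear_add linear_scale)

text \<open>\<open>T0\<close> is bounded below on the orthogonal complement \<open>C\<close> of its
  kernel, and so is every nearby \<open>T\<close>. Hence kernels cannot grow; if the kernel does not
  shrink either, it is complementary to \<open>C\<close>, and every value of \<open>T\<close> has a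
  preimage in \<open>C\<close> with a bound uniform in \<open>T\<close>.\<close>

lemma linear_almost_inverse:
  fixes T0 :: "'a::euclidean_space \<Rightarrow> 'b::euclidean_space"
  assumes T0: "linear T0"
  obtains \<delta> where "\<delta> > 0"
    "\<And>T. linear T \<Longrightarrow> (\<And>c. norm (T c - T0 c) \<le> \<delta> * norm c) \<Longrightarrow> dim {x. T x = 0} \<le> dim {x. T0 x = 0}"
    "\<And>T x. linear T \<Longrightarrow> (\<And>c. norm (T c - T0 c) \<le> \<delta> * norm c) \<Longrightarrow> dim {x. T0 x = 0} \<le> dim {x. T x = 0} \<Longrightarrow>
       \<exists>c. T c = T x \<and> \<delta> * norm c \<le> norm (T x)"
proof -
  define C where "C = {y \<in> UNIV. \<forall>x\<in>{x. T0 x = 0}. orthogonal x y}"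
  have sk: "subspace {x. T x = 0}" if "linear T" for T :: "'a \<Rightarrow> 'b"
    using that subspace_linear_kernel by blast
  have dC: "dim C + dim {x. T0 x = 0} = DIM('a)"
    using dim_subspace_orthogonal_to_vectors[OF sk[OF T0] subspace_UNIV] unfolding C_def by simp
  have sC: "subspace C"
    unfolding C_def by (auto simp: subspace_def orthogonal_def inner_right_distrib)
  have inj: "\<forall>x\<in>C. T0 x = 0 \<longrightarrow> x = 0"
    unfolding C_def orthogonal_def by auto
  obtain e where e: "e > 0" "\<And>x. x \<in> C \<Longrightarrow> e * norm x \<le> norm (T0 x)"
    using injective_imp_isometric[OF closed_subspace[OF sC] sC _ inj] T0 linear_conv_bounded_linear
    by blast
  define \<delta> where "\<delta> = e / 2"
  have low: "\<delta> * norm c \<le> norm (T c)" if "\<And>c. norm (T c - T0 c) \<le> \<delta> * norm c" "c \<in> C" for T c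
    using that(1)[of c] e(2)[OF that(2)] norm_triangle_ineq4[of "T c" "T c - T0 c"] unfolding \<delta>_def by simp
  have int: "{x. T x = 0} \<inter> C = {0}" if "linear T" "\<And>c. norm (T c - T0 c) \<le> \<delta> * norm c" for T
  proof -
    have "x = 0" if "T x = 0" "x \<in> C" for x
    proof -
      have "\<delta> * norm x \<le> 0" using low[OF \<open>\<And>c. norm (T c - T0 c) \<le> \<delta> * norm c\<close> that(2)] that(1) by simp
      then show ?thesis using e(1) unfolding \<delta>_def by (simp add: mult_le_0_iff)
    qed
    moreover have "0 \<in> C" "T 0 = 0" using sC subspace_0 linear_0 that by blast+
    ultimately show ?thesis by blast
  qed
  have sums: "dim {x + y |x y. x \<in> {x. T x = 0} \<and> y \<in> C} = dim {x. T x = 0} + dim C"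
    if "linear T" "\<And>c. norm (T c - T0 c) \<le> \<delta> * norm c" for T
    using dim_sums_Int[OF sk[OF that(1)] sC] unfolding int[OF that] by simp
  show thesis
  proof (rule that)
    show "\<delta> > 0" using e(1) unfolding \<delta>_def by simp
    fix T :: "'a \<Rightarrow> 'b" assume T: "linear T" "\<And>c. norm (T c - T0 c) \<le> \<delta> * norm c"
    have "dim {x + y |x y. x \<in> {x. T x = 0} \<and> y \<in> C} \<le> DIM('a)" by (rule dim_subset_UNIV)
    then show "dim {x. T x = 0} \<le> dim {x. T0 x = 0}" using sums[OF T] dC by simp
    fix x assume ge: "dim {x. T0 x = 0} \<le> dim {x. T x = 0}"
    have "subspace {x + y |x y. x \<in> {x. T x = 0} \<and> y \<in> C}" by (rule subspace_sums[OF sk[OF T(1)] sC])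
    moreover have "dim {x + y |x y. x \<in> {x. T x = 0} \<and> y \<in> C} = DIM('a)"
      using \<open>dim {x + y |x y. x \<in> {x. T x = 0} \<and> y \<in> C} \<le> DIM('a)\<close> sums[OF T] dC ge by simp
    moreover have "S = UNIV" if "subspace S" "dim S = DIM('a)" for S :: "'a set"
      using dim_eq_full[of S] that by (simp add: span_eq_iff[THEN iffD2])
    ultimately have "{x + y |x y. x \<in> {x. T x = 0} \<and> y \<in> C} = UNIV" by blast
    then obtain k c where kc: "x = k + c" "T k = 0" "c \<in> C" by blast
    then have "T x = T c" using T(1) by (simp add: linear_add)
    then show "\<exists>c. T c = T x \<and> \<delta> * norm c \<le> norm (T x)" using low[OF T(2) kc(3)] by metis
  qed
qed

lemma selfadjoint_range:
  fixes T :: "'a::euclidean_space \<Rightarrow> 'a"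
  assumes "linear T" "\<And>x y. T x \<bullet> y = x \<bullet> T y" "\<And>k. T k = 0 \<Longrightarrow> z \<bullet> k = 0"
  obtains y where "z = T y"
proof -
  have "subspace (range T)" using assms(1) linear_subspace_image subspace_UNIV by blast
  then obtain r s where rs: "r \<in> range T" "z = r + s" "\<And>y. y \<in> range T \<Longrightarrow> orthogonal s y"
    using orthogonal_subspace_decomp_exists[of "range T" z] by (metis span_eq_iff)
  have "T s \<bullet> T s = 0" using rs(3)[of "T (T s)"] assms(2) unfolding orthogonal_def by simp
  then have "z \<bullet> s = 0" using assms(3)[of s] by simp
  moreover have "r \<bullet> s = 0" using rs(1) rs(3)[of r] by (simp add: orthogonal_def inner_commute)
  ultimately have "s = 0" unfolding rs(2) by (simp add: inner_add)
  then show thesis using rs that by auto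
qed

text \<open>A stress is given by arbitrary weights on ordered pairs of vertices, of which only \<open>w(i,j) + w(j,i)\<close> on edges
  matters; this makes the stresses of a configuration the kernel of one linear map on a fixed space.\<close>

definition stress_act :: "'n set set \<Rightarrow> real^('n \<times> 'n) \<Rightarrow> 'v::real_vector^'n \<Rightarrow> 'v^'n" where
  "stress_act E w q = (\<chi> i. \<Sum>j\<in>UNIV. (if {i, j} \<in> E then w $ (i, j) + w $ (j, i) else 0) *\<^sub>R (q $ i - q $ j))"

text \<open>The polar form of the map to squared edge lengths: the diagonal
  \<open>edge_form E q q\<close> lists them, and twice \<open>edge_form E q\<close> is the
  derivative at \<open>q\<close>.\<close>

definition edge_form :: "'n set set \<Rightarrow> 'v::real_inner^'n \<Rightarrow> 'v^'n \<Rightarrow> real^('n \<times> 'n)" where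
  "edge_form E q q' = (\<chi> e. if {fst e, snd e} \<in> E then (q $ fst e - q $ snd e) \<bullet> (q' $ fst e - q' $ snd e) else 0)"

text \<open>By this adjunction the stresses of \<open>q\<close> are the vectors orthogonal to the
  range of the derivative of the squared lengths at \<open>q\<close>.\<close>

lemma inner_edge_form:
  fixes q :: "'v::real_inner^'n::finite"
  shows "w \<bullet> edge_form E q q' = stress_act E w q \<bullet> q'"
proof -
  let ?d = "\<lambda>i j. if {i, j} \<in> E then 1 else (0::real)"
  have "w \<bullet> edge_form E q q' = (\<Sum>e\<in>UNIV. w $ e * (?d (fst e) (snd e) * ((q $ fst e - q $ snd e) \<bullet> (q' $ fst e - q' $ snd e))))"
    unfolding edge_form_def inner_vec_def by (auto intro!: sum.cong)
  also have "\<dots> = (\<Sum>i\<in>UNIV. \<Sum>j\<in>UNIV. w $ (i, j) * (?d i j * ((q $ i - q $ j) \<bullet> (q' $ i - q' $ j))))"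
    by (simp add: sum.cartesian_product UNIV_Times_UNIV[symmetric] del: UNIV_Times_UNIV)
       (auto intro!: sum.cong)
  also have "\<dots> = (\<Sum>i\<in>UNIV. \<Sum>j\<in>UNIV. w $ (i, j) * (?d i j * ((q $ i - q $ j) \<bullet> q' $ i)))
     + (\<Sum>i\<in>UNIV. \<Sum>j\<in>UNIV. w $ (i, j) * (?d i j * ((q $ j - q $ i) \<bullet> q' $ j)))"
    by (simp add: sum.distrib[symmetric] inner_diff algebra_simps)
  also have "(\<Sum>i\<in>UNIV. \<Sum>j\<in>UNIV. w $ (i, j) * (?d i j * ((q $ j - q $ i) \<bullet> q' $ j)))
     = (\<Sum>i\<in>UNIV. \<Sum>j\<in>UNIV. w $ (j, i) * (?d i j * ((q $ i - q $ j) \<bullet> q' $ i)))"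
    by (subst sum.swap) (simp add: insert_commute)
  also have "(\<Sum>i\<in>UNIV. \<Sum>j\<in>UNIV. w $ (i, j) * (?d i j * ((q $ i - q $ j) \<bullet> q' $ i))) + \<dots>
     = (\<Sum>i\<in>UNIV. \<Sum>j\<in>UNIV. (w $ (i, j) + w $ (j, i)) * (?d i j * ((q $ i - q $ j) \<bullet> q' $ i)))"
    by (simp add: sum.distrib[symmetric] algebra_simps)
  also have "\<dots> = stress_act E w q \<bullet> q'"
    unfolding stress_act_def inner_vec_def by (auto simp: inner_sum_left intro!: sum.cong)
  finally show ?thesis .
qed

lemma edge_form_commute: "edge_form E q q' = edge_form E q' q"
  unfolding edge_form_def by (simp add: vec_eq_iff inner_commute)

lemma stress_act_selfadjoint:
  fixes q :: "'v::real_inner^'n::finite"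
  shows "stress_act E w q \<bullet> q' = q \<bullet> stress_act E w q'"
  using inner_edge_form[of w E q q'] inner_edge_form[of w E q' q] edge_form_commute[of E q q'] by (simp add: inner_commute)

lemma bilinear_stress_act: "bilinear (stress_act E :: real^('n::finite \<times> 'n) \<Rightarrow> 'v::real_vector^'n \<Rightarrow> _)"
proof -
  have 1: "linear (stress_act E w :: 'v^'n \<Rightarrow> 'v^'n)" for w
  proof (rule linearI)
    show "stress_act E w (x + y) = stress_act E w x + stress_act E w y" for x y :: "'v^'n"
      unfolding stress_act_def vec_eq_iff by (simp add: sum.distrib[symmetric] algebra_simps)
    show "stress_act E w (c *\<^sub>R x) = c *\<^sub>R stress_act E w x" for c and x :: "'v^'n"
      unfolding stress_act_def vec_eq_iff by (simp add: scaleR_sum_right algebra_simps)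
  qed
  have 2: "linear (\<lambda>w. stress_act E w (q :: 'v^'n))" for q
  proof (rule linearI)
    show "stress_act E (x + y) q = stress_act E x q + stress_act E y q" for x y
      unfolding stress_act_def vec_eq_iff
      by (auto simp: sum.distrib[symmetric] scaleR_add_left[symmetric] intro!: sum.cong)
    show "stress_act E (c *\<^sub>R x) q = c *\<^sub>R stress_act E x q" for c x
      unfolding stress_act_def vec_eq_iff
      by (auto simp: scaleR_sum_right distrib_left[symmetric] intro!: sum.cong)
  qed
  show ?thesis unfolding bilinear_def using 1 2 by blast
qed

lemma linear_stress_act: "linear (stress_act E w :: 'v::real_vector^'n::finite \<Rightarrow> 'v^'n)"
  using bilinear_stress_act unfolding bilinear_def by blast

lemma linear_stress_act_left: "linear (\<lambda>w. stress_act E w (q :: 'v::real_vector^'n::finite))"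
  using bilinear_stress_act unfolding bilinear_def by blast

lemma bilinear_edge_form: "bilinear (edge_form E :: 'v::real_inner^'n::finite \<Rightarrow> _)"
proof -
  have "linear (edge_form E q)" for q :: "'v^'n"
    by (rule linearI) (auto simp: edge_form_def vec_eq_iff inner_add_right inner_diff_right algebra_simps)
  moreover from this have "linear (\<lambda>x. edge_form E x q)" for q :: "'v^'n"
    by (subst edge_form_commute)
  ultimately show ?thesis unfolding bilinear_def by blast
qed

lemma linear_edge_form: "linear (edge_form E (q :: 'v::real_inner^'n::finite))"
  using bilinear_edge_form unfolding bilinear_def by blast

lemma stress_act_component:
  fixes q :: "real^'d^'n::finite"
  shows "stress_act E w q $ i $ b = stress_act E w (\<chi> i. q $ i $ b) $ i"
  unfolding stress_act_def by simp

text \<open>The condition on \<open>w\<close> says that \<open>w0 + t w\<close> is, to first order, a stress of \<open>P + t P'\<close> for some \<open>P'\<close>. Since the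
  rank cannot increase along a curve of stresses with this tangent, \<open>w\<close> vanishes on the kernel of \<open>w0\<close>.\<close>

lemma stress_flatness_rows:
  fixes P :: "real^'d::finite^'n::finite" and x y :: "real^'n"
  assumes P: "stress_act E w0 P = 0"
    and max1: "\<And>Q :: real^'d^'n. dim {w. stress_act E w P = 0} \<le> dim {w. stress_act E w Q = 0}"
    and max2: "\<And>(Q :: real^'d^'n) w. dim {w. stress_act E w P = 0} = dim {w. stress_act E w Q = 0} \<Longrightarrow>
       stress_act E w Q = 0 \<Longrightarrow> dim {u :: real^'n. stress_act E w0 u = 0} \<le> dim {u :: real^'n. stress_act E w u = 0}"
    and w: "\<And>q :: real^'d^'n. stress_act E w0 q = 0 \<Longrightarrow> w \<bullet> edge_form E P q = 0"
    and x: "stress_act E w0 x = 0" and y: "stress_act E w0 y = 0"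
  shows "stress_act E w x \<bullet> y = 0"
proof -
  note bil = bilinear_stress_act[of E] and lin = linear_stress_act[of E] and linR = linear_stress_act_left[of E]
  \<comment> \<open>The hypothesis on \<open>w\<close> says that \<open>stress_act E w P\<close> is
    orthogonal to the kernel of the self-adjoint map of \<open>w0\<close>, hence lies in its range.
    Its negative \<open>P'\<close> is the velocity that cancels the first-order term.\<close>
  obtain P'' where "stress_act E w P = stress_act E w0 P''"
  proof (rule selfadjoint_range[OF lin[of w0] stress_act_selfadjoint])
    show "stress_act E w P \<bullet> k = 0" if "stress_act E w0 k = 0" for k
      using w[OF that] unfolding inner_edge_form .
  qed
  define P' where "P' = - P''"
  have P': "stress_act E w P + stress_act E w0 P' = 0"
    using \<open>stress_act E w P = stress_act E w0 P''\<close> unfolding P'_def by (simp add: linear_neg[OF lin])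
  obtain B1 where B1: "B1 > 0" "\<And>w (q :: real^'d^'n). norm (stress_act E w q) \<le> B1 * norm w * norm q"
    using bilinear_bounded_pos[OF bil] by blast
  obtain B2 where B2: "B2 > 0" "\<And>w (q :: real^'n). norm (stress_act E w q) \<le> B2 * norm w * norm q"
    using bilinear_bounded_pos[OF bil] by blast
  obtain \<delta> where \<delta>: "\<delta> > 0"
    "\<And>T. linear T \<Longrightarrow> (\<And>c. norm (T c - stress_act E c P) \<le> \<delta> * norm c) \<Longrightarrow>
        dim {x. T x = 0} \<le> dim {x. stress_act E x P = 0}"
    "\<And>T x. linear T \<Longrightarrow> (\<And>c. norm (T c - stress_act E c P) \<le> \<delta> * norm c) \<Longrightarrow>
        dim {x. stress_act E x P = 0} \<le> dim {x. T x = 0} \<Longrightarrow> \<exists>c. T c = T x \<and> \<delta> * norm c \<le> norm (T x)"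
    using linear_almost_inverse[OF linR[of P]] by metis
  obtain \<epsilon> where \<epsilon>: "\<epsilon> > 0"
    "\<And>T (x :: real^'n). linear T \<Longrightarrow> (\<And>c. norm (T c - stress_act E w0 c) \<le> \<epsilon> * norm c) \<Longrightarrow>
        dim {x :: real^'n. stress_act E w0 x = 0} \<le> dim {x. T x = 0} \<Longrightarrow> \<exists>c. T c = T x \<and> \<epsilon> * norm c \<le> norm (T x)"
    using linear_almost_inverse[OF lin[of w0]] by metis
  define K where "K = norm (stress_act E w P') / \<delta>"
  define M where "M = norm w + K"
  have K0: "K \<ge> 0" unfolding K_def using \<delta>(1) by simp
  have M0: "M \<ge> 0" unfolding M_def using K0 by simp
  define \<eta> where "\<eta> = min 1 (min (\<delta> / (B1 * norm P' + 1)) (\<epsilon> / (B2 * M + 1)))"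
  have \<eta>: "\<eta> > 0" unfolding \<eta>_def using \<delta>(1) \<epsilon>(1) B1(1) B2(1) M0
    by (auto intro!: divide_pos_pos add_nonneg_pos mult_nonneg_nonneg)
  define Z where "Z = B2 * M * norm y * (B2 * M * norm x / \<epsilon>) + B2 * K * norm x * norm y"
  have main: "t * \<bar>stress_act E w x \<bullet> y\<bar> \<le> t\<^sup>2 * Z" if t: "0 < t" "t < \<eta>" for t
  proof -
    have t1: "t < 1" "t * (B1 * norm P') \<le> \<delta>" "t * (B2 * M) \<le> \<epsilon>"
    proof -
      show "t < 1" using t unfolding \<eta>_def by simp
      have p1: "B1 * norm P' + 1 > 0" "B2 * M + 1 > 0"
        using B1(1) B2(1) M0 by (auto intro!: add_nonneg_pos mult_nonneg_nonneg)
      have "t < \<delta> / (B1 * norm P' + 1)" "t < \<epsilon> / (B2 * M + 1)" using t unfolding \<eta>_def by auto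
      then have "t * (B1 * norm P' + 1) < \<delta>" "t * (B2 * M + 1) < \<epsilon>" using p1 by (simp_all add: pos_less_divide_eq)
      then show "t * (B1 * norm P') \<le> \<delta>" "t * (B2 * M) \<le> \<epsilon>" using t by (auto simp: distrib_left)
    qed
    let ?Q = "P + t *\<^sub>R P'"
    have Q: "stress_act E c ?Q = stress_act E c P + t *\<^sub>R stress_act E c P'" for c
      by (simp add: linear_add[OF lin] linear_scale[OF lin])
    have near: "norm (stress_act E c ?Q - stress_act E c P) \<le> \<delta> * norm c" for c
    proof -
      have "norm (stress_act E c ?Q - stress_act E c P) = t * norm (stress_act E c P')"
        unfolding Q using t by simp
      also have "\<dots> \<le> t * (B1 * norm c * norm P')" using B1(2) t by (intro mult_left_mono) auto
      also have "\<dots> = t * (B1 * norm P') * norm c" by simp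
      also have "\<dots> \<le> \<delta> * norm c" using t1(2) by (intro mult_right_mono) auto
      finally show ?thesis .
    qed
    have d1: "dim {x. stress_act E x P = 0} = dim {x. stress_act E x ?Q = 0}"
      using \<delta>(2)[OF linR[of ?Q] near] max1[of ?Q] by simp
    \<comment> \<open>\<open>w0 + t w\<close> fails to be a stress of \<open>?Q\<close> only by a
      term of order $t^2$. Since the stress space does not shrink from \<open>P\<close> to
      \<open>?Q\<close>, a correction \<open>c\<close> of the same order makes it the exact stress
      \<open>wt\<close>.\<close>
    obtain c where c: "stress_act E c ?Q = stress_act E (w0 + t *\<^sub>R w) ?Q"
       "\<delta> * norm c \<le> norm (stress_act E (w0 + t *\<^sub>R w) ?Q)"
      using \<delta>(3)[OF linR[of ?Q] near max1] by blast
    have "stress_act E (w0 + t *\<^sub>R w) ?Q = t *\<^sub>R (stress_act E w P + stress_act E w0 P') + t\<^sup>2 *\<^sub>R stress_act E w P'"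
      unfolding Q by (simp add: linear_add[OF linR] linear_scale[OF linR] P algebra_simps power2_eq_square)
    then have e: "stress_act E (w0 + t *\<^sub>R w) ?Q = t\<^sup>2 *\<^sub>R stress_act E w P'" using P' by simp
    then have cn: "norm c \<le> K * t\<^sup>2" using c(2) \<delta>(1) unfolding K_def by (simp add: field_simps)
    define wt where "wt = w0 + (t *\<^sub>R w - c)"
    have "stress_act E wt ?Q = 0" unfolding wt_def using c(1)
      by (simp add: linear_add[OF linR] linear_diff[OF linR] del: scaleR_add_right)
    then have d2: "dim {u :: real^'n. stress_act E w0 u = 0} \<le> dim {u :: real^'n. stress_act E wt u = 0}"
      using max2[OF d1] by blast
    have tt: "t\<^sup>2 \<le> t" using t t1(1) by (simp add: power2_eq_square)
    have "norm (t *\<^sub>R w - c) \<le> t * norm w + K * t\<^sup>2"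
      using norm_triangle_ineq4[of "t *\<^sub>R w" c] cn t by simp
    also have "\<dots> \<le> t * norm w + K * t" using mult_left_mono[OF tt K0] by simp
    also have "\<dots> = t * M" unfolding M_def by (simp add: algebra_simps)
    finally have nt: "norm (t *\<^sub>R w - c) \<le> t * M" .
    have wtu: "stress_act E wt u = stress_act E w0 u + stress_act E (t *\<^sub>R w - c) u" for u :: "real^'n"
      unfolding wt_def by (simp add: linear_add[OF linR])
    have small: "norm (stress_act E (t *\<^sub>R w - c) u) \<le> t * (B2 * M * norm u)" for u :: "real^'n"
    proof -
      have "norm (stress_act E (t *\<^sub>R w - c) u) \<le> B2 * norm (t *\<^sub>R w - c) * norm u" by (rule B2(2))
      also have "\<dots> \<le> B2 * (t * M) * norm u" using nt B2(1) by (intro mult_right_mono mult_left_mono) auto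
      finally show ?thesis by (simp add: mult_ac)
    qed
    have near2: "norm (stress_act E wt u - stress_act E w0 u) \<le> \<epsilon> * norm u" for u :: "real^'n"
    proof -
      have "norm (stress_act E wt u - stress_act E w0 u) \<le> t * (B2 * M) * norm u"
        using small[of u] unfolding wtu by (simp add: mult_ac)
      also have "\<dots> \<le> \<epsilon> * norm u" using t1(3) by (intro mult_right_mono) auto
      finally show ?thesis .
    qed
    \<comment> \<open>The kernel of \<open>wt\<close> is no smaller than that of \<open>w0\<close>,
      so the value of \<open>wt\<close> at \<open>x\<close> is attained at some \<open>v\<close> of
      order \<open>t\<close>. Moving \<open>wt\<close> across the inner product gives two factors of
      order \<open>t\<close>, which beats the first-order term
      \<open>t * (stress_act E w x \<bullet> y)\<close>.\<close>
    obtain v where v: "stress_act E wt v = stress_act E wt x" "\<epsilon> * norm v \<le> norm (stress_act E wt x)"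
      using \<epsilon>(2)[OF lin near2 d2] by blast
    have nx: "norm (stress_act E wt x) \<le> t * (B2 * M * norm x)" and ny: "norm (stress_act E wt y) \<le> t * (B2 * M * norm y)"
      using small unfolding wtu x y by simp_all
    have nv: "norm v \<le> t * (B2 * M * norm x / \<epsilon>)"
      using v(2) nx \<epsilon>(1) by (simp add: field_simps)
    have "\<bar>stress_act E wt x \<bullet> y\<bar> = \<bar>v \<bullet> stress_act E wt y\<bar>"
      unfolding v(1)[symmetric] stress_act_selfadjoint ..
    also have "\<dots> \<le> norm v * norm (stress_act E wt y)" by (rule Cauchy_Schwarz_ineq2)
    also have "\<dots> \<le> (t * (B2 * M * norm x / \<epsilon>)) * (t * (B2 * M * norm y))"
      using nv ny by (intro mult_mono) (auto intro: order_trans[OF norm_ge_zero])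
    finally have b1: "\<bar>stress_act E wt x \<bullet> y\<bar> \<le> t\<^sup>2 * (B2 * M * norm y * (B2 * M * norm x / \<epsilon>))"
      by (simp add: power2_eq_square mult_ac)
    have "\<bar>stress_act E c x \<bullet> y\<bar> \<le> norm (stress_act E c x) * norm y" by (rule Cauchy_Schwarz_ineq2)
    also have "\<dots> \<le> (B2 * norm c * norm x) * norm y" using B2(2) by (intro mult_right_mono) auto
    also have "\<dots> \<le> (B2 * (K * t\<^sup>2) * norm x) * norm y" using cn B2(1) by (intro mult_right_mono mult_left_mono) auto
    finally have b2: "\<bar>stress_act E c x \<bullet> y\<bar> \<le> t\<^sup>2 * (B2 * K * norm x * norm y)" by (simp add: mult_ac)
    have "stress_act E wt x \<bullet> y = t * (stress_act E w x \<bullet> y) - stress_act E c x \<bullet> y"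
      unfolding wtu x by (simp add: linear_diff[OF linR] linear_scale[OF linR] inner_diff_left)
    then have "t * \<bar>stress_act E w x \<bullet> y\<bar> = \<bar>stress_act E wt x \<bullet> y + stress_act E c x \<bullet> y\<bar>"
      using t by (simp add: abs_mult)
    also have "\<dots> \<le> t\<^sup>2 * Z" unfolding Z_def distrib_left using b1 b2 by linarith
    finally show ?thesis .
  qed
  have le: "\<bar>stress_act E w x \<bullet> y\<bar> \<le> t * Z" if "0 < t" "t < \<eta>" for t
    using main[OF that] that by (simp add: power2_eq_square mult.assoc)
  show ?thesis
  proof (rule ccontr)
    assume "stress_act E w x \<bullet> y \<noteq> 0"
    then have pos: "\<bar>stress_act E w x \<bullet> y\<bar> > 0" by simp
    define t where "t = min (\<eta> / 2) (\<bar>stress_act E w x \<bullet> y\<bar> / (2 * (\<bar>Z\<bar> + 1)))"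
    have t: "0 < t" "t < \<eta>" unfolding t_def using \<eta> pos by (auto simp: min_less_iff_disj)
    have "t * Z \<le> t * (\<bar>Z\<bar> + 1)" using t by (intro mult_left_mono) auto
    also have "\<dots> \<le> (\<bar>stress_act E w x \<bullet> y\<bar> / (2 * (\<bar>Z\<bar> + 1))) * (\<bar>Z\<bar> + 1)"
      unfolding t_def by (intro mult_right_mono) auto
    also have "\<dots> = \<bar>stress_act E w x \<bullet> y\<bar> / 2" by (simp add: field_simps)
    also have "\<dots> < \<bar>stress_act E w x \<bullet> y\<bar>" using pos by simp
    finally show False using le[OF t] by simp
  qed
qed

text \<open>The part \<open>w\<close> of the lengths of \<open>q\<close> orthogonal to the linear
  space satisfies the hypothesis of \<open>stress_flatness_rows\<close>. Each coordinate of
  \<open>q\<close> lies in the kernel of \<open>w0\<close>, and summing over coordinates shows that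
  \<open>w\<close> is orthogonal to the lengths of \<open>q\<close>, hence zero.\<close>

lemma stress_flatness:
  fixes P q :: "real^'d::finite^'n::finite"
  assumes "stress_act E w0 P = 0"
    and "\<And>Q :: real^'d^'n. dim {w. stress_act E w P = 0} \<le> dim {w. stress_act E w Q = 0}"
    and "\<And>(Q :: real^'d^'n) w. dim {w. stress_act E w P = 0} = dim {w. stress_act E w Q = 0} \<Longrightarrow>
       stress_act E w Q = 0 \<Longrightarrow> dim {u :: real^'n. stress_act E w0 u = 0} \<le> dim {u :: real^'n. stress_act E w u = 0}"
    and q: "stress_act E w0 q = 0"
  shows "edge_form E q q \<in> edge_form E P ` {a. stress_act E w0 a = 0}"
proof -
  let ?A = "{a :: real^'d^'n. stress_act E w0 a = 0}"
  have "subspace (edge_form E P ` ?A)"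
    by (intro linear_subspace_image linear_edge_form subspace_linear_kernel linear_stress_act)
  then obtain r w where rw: "r \<in> edge_form E P ` ?A" "edge_form E q q = r + w"
      "\<And>y. y \<in> edge_form E P ` ?A \<Longrightarrow> orthogonal w y"
    using orthogonal_subspace_decomp_exists[of "edge_form E P ` ?A" "edge_form E q q"] by (metis span_eq_iff)
  have w: "w \<bullet> edge_form E P a = 0" if "stress_act E w0 a = 0" for a
    using rw(3)[of "edge_form E P a"] that by (auto simp: orthogonal_def)
  have "w \<bullet> edge_form E q q = 0"
  proof -
    have "stress_act E w (\<chi> i. q $ i $ b) \<bullet> (\<chi> i. q $ i $ b) = 0" for b
    proof -
      have "stress_act E w0 (\<chi> i. q $ i $ b) = 0"
        using q stress_act_component[of E w0 q _ b] by (simp add: vec_eq_iff)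
      from stress_flatness_rows[OF assms(1-3) w this this] show ?thesis .
    qed
    then have "(\<Sum>b\<in>UNIV. \<Sum>i\<in>UNIV. stress_act E w q $ i $ b * q $ i $ b) = 0"
      unfolding stress_act_component[of E w q] inner_vec_def by simp
    then show ?thesis by (subst (asm) sum.swap) (simp add: inner_edge_form, simp add: inner_vec_def)
  qed
  moreover have "w \<bullet> r = 0" using rw(1) rw(3)[of r] by (simp add: orthogonal_def)
  ultimately have "w = 0" unfolding rw(2) by (simp add: inner_add_right)
  then show ?thesis using rw by simp
qed

section \<open>Density of generic configurations\<close>

lemma countable_poly_mapping:
  assumes "countable (UNIV :: 'a set)" "countable (UNIV :: 'b::zero set)"
  shows "countable (UNIV :: ('a \<Rightarrow>\<^sub>0 'b) set)"
proof -
  define g where "g P = (\<lambda>k. (k, Poly_Mapping.lookup P k)) ` Poly_Mapping.keys P" for P :: "'a \<Rightarrow>\<^sub>0 'b"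
  have "inj g"
  proof (rule injI)
    fix P Q assume eq: "g P = g Q"
    have *: "Poly_Mapping.lookup P k = Poly_Mapping.lookup Q k" if "g P = g Q" "k \<in> Poly_Mapping.keys P" for P Q k
    proof -
      have "(k, Poly_Mapping.lookup P k) \<in> g P" using that(2) unfolding g_def by blast
      then have "(k, Poly_Mapping.lookup P k) \<in> g Q" using that(1) by blast
      then show ?thesis unfolding g_def by auto
    qed
    show "P = Q"
    proof (rule poly_mapping_eqI)
      fix k
      show "Poly_Mapping.lookup P k = Poly_Mapping.lookup Q k"
        using *[OF eq, of k] *[OF eq[symmetric], of k] unfolding in_keys_iff by argo
    qed
  qed
  have "countable (UNIV :: ('a \<times> 'b) set)"
    using countable_SIGMA[OF assms(1), of "\<lambda>_. UNIV"] assms(2) by simp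
  then have "countable {F :: ('a \<times> 'b) set. finite F \<and> F \<subseteq> UNIV}" by (rule countable_Collect_finite_subset)
  moreover have "range g \<subseteq> {F. finite F \<and> F \<subseteq> UNIV}" unfolding g_def by auto
  ultimately have "countable (range g)" by (rule countable_subset[rotated])
  then show ?thesis using \<open>inj g\<close> by (rule countable_image_inj_on)
qed

text \<open>On the line through \<open>u\<close> and \<open>P\<close> each nonzero rational
  polynomial restricts to a polynomial in \<open>s\<close> that is nonzero at \<open>s = 1\<close>,
  where the point is \<open>P\<close>; so it has finitely many roots, and there are countably many
  such polynomials.\<close>

lemma generic_line:
  fixes P u :: "real^'d::finite^'n::finite"
  assumes P: "generic (($) P)"
  shows "countable {s. \<not> generic (($) (u + s *\<^sub>R (P - u)))}"
proof -
  define Z where "Z Q = {s. poly_eval_rat Q (\<lambda>(i, c). (u + s *\<^sub>R (P - u)) $ i $ c) = 0}" for Q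
  have fin: "finite (Z Q)" if "Q \<noteq> 0" for Q
  proof -
    let ?g = "\<lambda>s. poly_eval_rat Q (\<lambda>(i, c). (u + s *\<^sub>R (P - u)) $ i $ c)"
    have lin: "real_polynomial_function (\<lambda>s :: real. u $ i $ c + s * (P $ i $ c - u $ i $ c))" for i c
      by (intro real_polynomial_function.intros(2,3,4) real_polynomial_function.intros(1)[of "\<lambda>x. x"]) simp
    have "real_polynomial_function ?g"
      unfolding poly_eval_rat_def
    proof (intro real_polynomial_function_sum real_polynomial_function.intros(2,4) real_polynomial_function_prod real_polynomial_function_power finite_keys)
      fix v :: "'n \<times> 'd"
      show "real_polynomial_function (\<lambda>s. case v of (i, c) \<Rightarrow> (u + s *\<^sub>R (P - u)) $ i $ c)"
        using lin by (cases v) simp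
    qed
    then obtain a n where an: "?g = (\<lambda>x. \<Sum>i\<le>n. a i * x ^ i)" using real_polynomial_function_imp_sum by blast
    have "?g 1 \<noteq> 0" using P that unfolding generic_def algebraically_independent_rat_def by auto
    moreover have "?g 1 = (\<Sum>i\<le>n. a i * 1 ^ i)" by (rule fun_cong[OF an])
    ultimately have "(\<Sum>i\<le>n. a i * 1 ^ i) \<noteq> 0" by argo
    then have "\<exists>k\<le>n. a k \<noteq> 0" using sum.neutral[of "{..n}" "\<lambda>i. a i * 1 ^ i"] by fastforce
    then have "finite {z. (\<Sum>i\<le>n. a i * z ^ i) = 0}" using polyfun_finite_roots by blast
    then show ?thesis unfolding Z_def fun_cong[OF an] .
  qed
  have "countable (UNIV :: ((('n \<times> 'd) \<Rightarrow>\<^sub>0 nat) \<Rightarrow>\<^sub>0 rat) set)"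
    by (intro countable_poly_mapping) (auto intro: countable_finite)
  then have "countable (\<Union>Q\<in>- {0}. Z Q)"
    using fin by (intro countable_UN countable_subset[of "- {0}" UNIV]) (auto intro: countable_finite)
  moreover have "{s. \<not> generic (($) (u + s *\<^sub>R (P - u)))} \<subseteq> (\<Union>Q\<in>- {0}. Z Q)"
    unfolding generic_def algebraically_independent_rat_def Z_def by blast
  ultimately show ?thesis by (rule countable_subset[rotated])
qed

text \<open>\<open>A\<close> may be a proper subspace with irrational equations, such as the
  configurations in equilibrium with one stress. A single generic point in it suffices for
  density.\<close>

lemma generic_dense_subspace:
  fixes P u :: "real^'d::finite^'n::finite"
  assumes P: "generic (($) P)" "P \<in> A" "subspace A" "u \<in> A" "\<epsilon> > 0"
  obtains q where "q \<in> A" "generic (($) q)" "norm (q - u) < \<epsilon>"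
proof -
  define \<eta> where "\<eta> = \<epsilon> / (norm (P - u) + 1)"
  have "\<eta> > 0" unfolding \<eta>_def using assms(5) by (simp add: add_nonneg_pos)
  then have "uncountable {0<..<\<eta>}" using uncountable_open_interval by blast
  then obtain s where s: "0 < s" "s < \<eta>" "generic (($) (u + s *\<^sub>R (P - u)))"
    using countable_subset[OF _ generic_line[OF P(1), of u], of "{0<..<\<eta>}"] by fastforce
  have "u + s *\<^sub>R (P - u) \<in> A" using P by (intro subspace_add subspace_scale subspace_diff)
  moreover have "norm (u + s *\<^sub>R (P - u) - u) < \<epsilon>"
  proof -
    have "norm (u + s *\<^sub>R (P - u) - u) = s * norm (P - u)" using s by simp
    also have "\<dots> \<le> s * (norm (P - u) + 1)" using s by simp
    also have "\<dots> < \<eta> * (norm (P - u) + 1)" using s by (intro mult_strict_right_mono add_nonneg_pos) auto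
    also have "\<dots> = \<epsilon>" unfolding \<eta>_def using add_nonneg_pos[OF norm_ge_zero zero_less_one, of "P - u"] by simp
    finally show ?thesis .
  qed
  ultimately show thesis using that s(3) by blast
qed

section \<open>QR decomposition, with the coordinates ordered by \<open>\<rho>\<close>\<close>

definition upper_tri :: "('d \<Rightarrow> nat) \<Rightarrow> real^'d^'d \<Rightarrow> bool" where
  "upper_tri \<rho> Z \<longleftrightarrow> (\<forall>i j. \<rho> j < \<rho> i \<longrightarrow> Z $ i $ j = 0)"

text \<open>The uniqueness half of the QR decomposition, by induction over the columns of
  \<open>F\<close>. Triangularity of \<open>F ** Z\<close> and the nonzero diagonal of
  \<open>Z\<close> clear the rows of larger index; orthogonality to the earlier columns, already
  unit vectors up to sign, clears those of smaller index.\<close>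

lemma orthogonal_upper_tri_diagonal:
  fixes F Z :: "real^'d::finite^'d"
  assumes \<rho>: "inj \<rho>" and F: "orthogonal_matrix F" and Z: "upper_tri \<rho> Z" "\<And>b. Z $ b $ b \<noteq> 0"
    and FZ: "upper_tri \<rho> (F ** Z)"
  shows "\<exists>\<epsilon>. (\<forall>b. \<epsilon> b = 1 \<or> \<epsilon> b = - 1) \<and> (\<forall>i j. F $ i $ j = (if i = j then \<epsilon> i else 0))"
proof -
  have orth: "(\<Sum>k\<in>UNIV. F $ k $ i * F $ k $ j) = (if i = j then 1 else 0)" for i j
  proof -
    have "(transpose F ** F) $ i $ j = (if i = j then 1 else 0)"
      using F unfolding orthogonal_matrix_def by (simp add: mat_def)
    then show ?thesis by (simp add: matrix_matrix_mult_def transpose_def)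
  qed
  have main: "(\<forall>i. i \<noteq> b \<longrightarrow> F $ i $ b = 0) \<and> (F $ b $ b = 1 \<or> F $ b $ b = - 1)" for b
  proof (induction "\<rho> b" arbitrary: b rule: less_induct)
    case less
    have IH: "F $ i $ b' = 0" "F $ b' $ b' = 1 \<or> F $ b' $ b' = - 1" if "\<rho> b' < \<rho> b" "i \<noteq> b'" for b' i
      using less[OF that(1)] that(2) by auto
    have above: "F $ i $ b = 0" if "\<rho> b < \<rho> i" for i
    proof -
      have "0 = (F ** Z) $ i $ b" using FZ that unfolding upper_tri_def by simp
      also have "\<dots> = (\<Sum>k\<in>UNIV. F $ i $ k * Z $ k $ b)" by (simp add: matrix_matrix_mult_def)
      also have "\<dots> = (\<Sum>k\<in>UNIV. if k = b then F $ i $ b * Z $ b $ b else 0)"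
      proof (rule sum.cong[OF refl])
        fix k
        consider "k = b" | "\<rho> k < \<rho> b" | "\<rho> b < \<rho> k" using \<rho> by (metis injD nat_neq_iff)
        then show "F $ i $ k * Z $ k $ b = (if k = b then F $ i $ b * Z $ b $ b else 0)"
        proof cases
          case 2
          then have "i \<noteq> k" using that by auto
          then have "F $ i $ k = 0" using IH(1)[OF 2] by blast
          then show ?thesis using 2 by auto
        next
          case 3
          then show ?thesis using Z(1) unfolding upper_tri_def by auto
        qed auto
      qed
      also have "\<dots> = F $ i $ b * Z $ b $ b" by simp
      finally show ?thesis using Z(2)[of b] by simp
    qed
    have below: "F $ i $ b = 0" if "\<rho> i < \<rho> b" for i
    proof -
      have ib: "i \<noteq> b" using that by auto
      have "0 = (\<Sum>k\<in>UNIV. F $ k $ i * F $ k $ b)" using orth[of i b] ib by simp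
      also have "\<dots> = (\<Sum>k\<in>UNIV. if k = i then F $ i $ i * F $ i $ b else 0)"
        using IH(1)[OF that] by (intro sum.cong) auto
      also have "\<dots> = F $ i $ i * F $ i $ b" by simp
      finally show ?thesis using IH(2)[OF that ib[symmetric]] by auto
    qed
    have z: "F $ i $ b = 0" if "i \<noteq> b" for i
      using above below that \<rho> by (metis injD nat_neq_iff)
    have "1 = (\<Sum>k\<in>UNIV. F $ k $ b * F $ k $ b)" using orth[of b b] by simp
    also have "\<dots> = (\<Sum>k\<in>UNIV. if k = b then F $ b $ b * F $ b $ b else 0)"
      using z by (intro sum.cong) auto
    also have "\<dots> = F $ b $ b * F $ b $ b" by simp
    finally have "F $ b $ b = 1 \<or> F $ b $ b = - 1" by (metis square_eq_1_iff)
    then show ?case using z by blast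
  qed
  show ?thesis by (rule exI[of _ "\<lambda>b. F $ b $ b"]) (use main in auto)
qed

text \<open>The existence half, for singular \<open>Z\<close> too. Rows of \<open>R\<close> are
  chosen from the largest index downwards: each must avoid the columns of \<open>Z\<close> of
  smaller index and the rows of larger index, \<open>d - 1\<close> vectors in all.\<close>

lemma orthogonal_to_upper_tri:
  fixes Z :: "real^'d::finite^'d"
  assumes \<rho>: "inj \<rho>"
  obtains R where "orthogonal_matrix R" "upper_tri \<rho> (R ** Z)"
proof -
  have "finite (range \<rho>)" by simp
  then obtain N where "\<forall>n\<in>range \<rho>. n < N" using finite_nat_set_iff_bounded[of "range \<rho>"] by blast
  then have N: "\<And>b :: 'd. \<rho> b < N" by blast
  have "\<exists>r :: 'd \<Rightarrow> real^'d. \<forall>b'. N \<le> \<rho> b' + k \<longrightarrow> norm (r b') = 1 \<and>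
      (\<forall>b. \<rho> b < \<rho> b' \<longrightarrow> r b' \<bullet> column b Z = 0) \<and> (\<forall>b. \<rho> b' < \<rho> b \<longrightarrow> r b' \<bullet> r b = 0)" for k
  proof (induction k)
    case 0
    have "\<not> N \<le> \<rho> b' + 0" for b' using N[of b'] by simp
    then show ?case by blast
  next
    case (Suc k)
    then obtain r :: "'d \<Rightarrow> real^'d" where r: "\<And>b'. N \<le> \<rho> b' + k \<Longrightarrow> norm (r b') = 1 \<and>
      (\<forall>b. \<rho> b < \<rho> b' \<longrightarrow> r b' \<bullet> column b Z = 0) \<and> (\<forall>b. \<rho> b' < \<rho> b \<longrightarrow> r b' \<bullet> r b = 0)" by blast
    show ?case
    proof (cases "\<exists>b0. N = \<rho> b0 + Suc k")
      case False
      then have "N \<le> \<rho> b' + Suc k \<Longrightarrow> N \<le> \<rho> b' + k" for b' by (metis le_SucE add_Suc_right)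
      then show ?thesis using r by blast
    next
      case True
      then obtain b0 where b0: "N = \<rho> b0 + Suc k" by blast
      let ?S = "(\<lambda>b. if \<rho> b < \<rho> b0 then column b Z else r b) ` (UNIV - {b0})"
      have "dim ?S \<le> card ?S" by (rule dim_le_card) (auto intro: span_base)
      also have "\<dots> \<le> card (UNIV - {b0})" by (rule card_image_le) simp
      also have "\<dots> < CARD('d)" by (rule psubset_card_mono) auto
      finally have "dim ?S < DIM(real^'d)" by simp
      then obtain e where e: "e \<noteq> 0" "\<And>y. y \<in> span ?S \<Longrightarrow> orthogonal e y"
        using orthogonal_to_subspace_exists by blast
      define e' where "e' = e /\<^sub>R norm e"
      have e'1: "norm e' = 1" unfolding e'_def using e(1) by simp
      have e'2: "e' \<bullet> (if \<rho> b < \<rho> b0 then column b Z else r b) = 0" if "b \<noteq> b0" for b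
        using e(2)[OF span_base, of "if \<rho> b < \<rho> b0 then column b Z else r b"] that unfolding e'_def orthogonal_def by auto
      show ?thesis
      proof (rule exI[of _ "r(b0 := e')"], intro allI impI)
        fix b' assume b': "N \<le> \<rho> b' + Suc k"
        show "norm ((r(b0 := e')) b') = 1 \<and>
          (\<forall>b. \<rho> b < \<rho> b' \<longrightarrow> (r(b0 := e')) b' \<bullet> column b Z = 0) \<and>
          (\<forall>b. \<rho> b' < \<rho> b \<longrightarrow> (r(b0 := e')) b' \<bullet> (r(b0 := e')) b = 0)"
        proof (cases "b' = b0")
          case True
          have "e' \<bullet> column b Z = 0" if "\<rho> b < \<rho> b0" for b using e'2[of b] that by auto
          moreover have "e' \<bullet> r b = 0 \<and> b \<noteq> b0" if "\<rho> b0 < \<rho> b" for b using e'2[of b] that by auto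
          ultimately show ?thesis unfolding True using e'1 by auto
        next
          case False
          then have "\<rho> b' \<noteq> \<rho> b0" using \<rho> by (metis injD)
          then have "\<rho> b0 < \<rho> b'" "N \<le> \<rho> b' + k" using b' b0 by auto
          then show ?thesis using r[of b'] False by auto
        qed
      qed
    qed
  qed
  from this[of N] obtain r :: "'d \<Rightarrow> real^'d" where r: "\<And>b'. norm (r b') = 1"
      "\<And>b b'. \<rho> b < \<rho> b' \<Longrightarrow> r b' \<bullet> column b Z = 0" "\<And>b b'. \<rho> b' < \<rho> b \<Longrightarrow> r b' \<bullet> r b = 0"
    by (metis le_add2)
  define R :: "real^'d^'d" where "R = (\<chi> b. r b)"
  have rr: "r i \<bullet> r j = (if i = j then 1 else 0)" for i j
  proof -
    consider "i = j" | "\<rho> i < \<rho> j" | "\<rho> j < \<rho> i" using \<rho> by (metis injD nat_neq_iff)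
    then show ?thesis
    proof cases
      case 1
      then show ?thesis using r(1)[of j] by (simp add: norm_eq_1)
    next
      case 2
      then show ?thesis using r(3)[OF 2] by auto
    next
      case 3
      then show ?thesis using r(3)[OF 3] by (auto simp: inner_commute)
    qed
  qed
  have "R ** transpose R = mat 1"
    using rr unfolding R_def matrix_matrix_mult_def transpose_def mat_def inner_vec_def by (simp add: vec_eq_iff)
  then have "orthogonal_matrix R" unfolding orthogonal_matrix_def using matrix_left_right_inverse by blast
  moreover have "upper_tri \<rho> (R ** Z)"
    unfolding upper_tri_def
  proof (intro allI impI)
    fix i j assume "\<rho> j < \<rho> i"
    have "(R ** Z) $ i $ j = r i \<bullet> column j Z"
      unfolding R_def matrix_matrix_mult_def column_def inner_vec_def by simp
    then show "(R ** Z) $ i $ j = 0" using r(2)[OF \<open>\<rho> j < \<rho> i\<close>] by simp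
  qed
  ultimately show thesis using that by blast
qed

section \<open>Motions, congruence and properness\<close>

lemma stress_act_map:
  fixes q :: "'v::real_vector^'n::finite"
  assumes "linear f"
  shows "stress_act E w (\<chi> i. f (q $ i)) = (\<chi> i. f (stress_act E w q $ i))"
  unfolding stress_act_def
  by (simp add: linear_sum[OF assms] linear_scale[OF assms] linear_diff[OF assms])

lemma stress_act_const: "stress_act E w (\<chi> i. a) = 0"
  unfolding stress_act_def by (simp add: vec_eq_iff)

lemma edge_form_translate: "edge_form E (q - (\<chi> i. a)) q' = edge_form E q q'"
  unfolding edge_form_def by (simp add: vec_eq_iff)

lemma edge_form_eq_iff_equivalent:
  "edge_form E q q = edge_form E q' q' \<longleftrightarrow> equivalent_frameworks E (($) q) (($) q')"
  unfolding edge_form_def equivalent_frameworks_def vec_eq_iff by (auto simp: norm_eq)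

lemma congruent_frameworks_trans:
  fixes p q r :: "'n::finite \<Rightarrow> real^'d::finite"
  assumes "congruent_frameworks p q" "congruent_frameworks q r"
  shows "congruent_frameworks p r"
proof -
  obtain a f where f: "orthogonal_transformation f" "\<And>i. q i = a + f (p i)"
    using assms(1) unfolding congruent_frameworks_def euclidean_motion_def by auto
  obtain b g where g: "orthogonal_transformation g" "\<And>i. r i = b + g (q i)"
    using assms(2) unfolding congruent_frameworks_def euclidean_motion_def by auto
  have lg: "linear g" using g(1) orthogonal_transformation_def by blast
  have "r i = (b + g a) + (g \<circ> f) (p i)" for i unfolding g(2) f(2) by (simp add: linear_add[OF lg])
  moreover have "orthogonal_transformation (g \<circ> f)" using f g orthogonal_transformation_compose by blast
  ultimately show ?thesis unfolding congruent_frameworks_def euclidean_motion_def by blast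
qed

lemma congruent_imp_equivalent:
  fixes p q :: "'n::finite \<Rightarrow> real^'d::finite"
  assumes "congruent_frameworks p q"
  shows "equivalent_frameworks E p q"
proof -
  obtain a f where f: "orthogonal_transformation f" "\<And>i. q i = a + f (p i)"
    using assms unfolding congruent_frameworks_def euclidean_motion_def by auto
  have "linear f" using f(1) orthogonal_transformation_def by blast
  then have "q i - q j = f (p i - p j)" for i j unfolding f(2) by (simp add: linear_diff)
  then have "norm (q i - q j) = norm (p i - p j)" for i j using f(1) orthogonal_transformation by metis
  then show ?thesis unfolding equivalent_frameworks_def by simp
qed

lemma globally_rigid_congruent:
  fixes p q :: "'n::finite \<Rightarrow> real^'d::finite"
  assumes p: "globally_rigid E p" and qp: "congruent_frameworks q p" and pq: "congruent_frameworks p q"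
  shows "globally_rigid E q"
  unfolding globally_rigid_def
proof (intro allI impI)
  fix r assume "equivalent_frameworks E q r"
  then have "equivalent_frameworks E p r"
    using congruent_imp_equivalent[OF pq, of E] unfolding equivalent_frameworks_def by simp
  then have "congruent_frameworks p r" using p unfolding globally_rigid_def by blast
  then show "congruent_frameworks q r" using congruent_frameworks_trans[OF qp] by blast
qed

lemma closed_range_if_bounded_preimages:
  fixes f :: "'a::euclidean_space \<Rightarrow> 'b::euclidean_space"
  assumes f: "continuous_on UNIV f" and b: "\<And>R. bounded {x. norm (f x) \<le> R}"
  shows "closed (range f)"
proof -
  have "y \<in> range f" if "y \<in> closure (range f)" for y
  proof -
    let ?K = "{x. norm (f x) \<le> norm y + 1}"
    have "closed ?K" by (intro closed_Collect_le continuous_intros f)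
    then have "compact ?K" using b compact_eq_bounded_closed by blast
    then have "closed (f ` ?K)" using compact_continuous_image[OF continuous_on_subset[OF f]] compact_imp_closed by blast
    moreover have "y \<in> closure (f ` ?K)"
      unfolding closure_approachable
    proof (intro allI impI)
      fix e :: real assume "e > 0"
      then have "min e 1 > 0" by simp
      moreover have "\<forall>e>0. \<exists>z\<in>range f. dist z y < e" using that by (simp only: closure_approachable)
      ultimately obtain z where "z \<in> range f" "dist z y < min e 1" by (meson)
      then obtain x where x: "dist (f x) y < min e 1" by blast
      then have "norm (f x) \<le> norm y + 1"
        using norm_triangle_sub[of "f x" y] by (simp add: dist_norm)
      then show "\<exists>z\<in>f ` ?K. dist z y < e" using x by auto
    qed
    ultimately have "y \<in> f ` ?K" by (simp only: closure_closed)
    then show "y \<in> range f" by blast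
  qed
  then show ?thesis using closure_subset_eq by blast
qed

section \<open>Pinned configurations\<close>

text \<open>The situation to be refuted: \<open>dimK\<close> denies that the stress
  \<open>w0\<close> has rank $n - d - 1$. The \<open>c b\<close> are functionals dual to the
  coordinates of \<open>P\<close> that ignore translations, and \<open>i0\<close> is the vertex to
  be pinned at the origin.\<close>

locale pinned =
  fixes E :: "'n::finite set set" and P :: "real^'d::finite^'n" and w0 :: "real^('n \<times> 'n)"
    and c :: "'d \<Rightarrow> real^'n" and \<rho> :: "'d \<Rightarrow> nat" and i0 :: 'n
  assumes stress: "stress_act E w0 P = 0"
    and \<rho>: "inj \<rho>"
    and c0: "\<And>b. (\<Sum>i\<in>UNIV. c b $ i) = 0"
    and c1: "\<And>b b'. (\<Sum>i\<in>UNIV. c b $ i * P $ i $ b') = (if b = b' then 1 else 0)"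
    and gen: "generic (($) P)"
    and ggr: "generically_globally_rigid TYPE('d) E"
    and flat: "\<And>q :: real^'d^'n. stress_act E w0 q = 0 \<Longrightarrow> edge_form E q q \<in> edge_form E P ` {a. stress_act E w0 a = 0}"
    and conn: "\<And>(q :: real^'d^'n) i j. edge_form E q q = 0 \<Longrightarrow> q $ i = q $ j"
    and dimK: "CARD('d) + 2 \<le> dim {u :: real^'n. stress_act E w0 u = 0}"
begin

definition A :: "(real^'d^'n) set" where "A = {q. stress_act E w0 q = 0}"

text \<open>\<open>Z q\<close> is a linear part of the configuration \<open>q\<close>, normalised by \<open>Z P = 1\<close>. Requiring it to be upper triangular
  fixes a configuration up to reflections in the coordinate hyperplanes.\<close>

definition Z :: "real^'d^'n \<Rightarrow> real^'d^'d" where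
  "Z q = (\<chi> b' b. \<Sum>i\<in>UNIV. c b $ i * q $ i $ b')"

definition B :: "(real^'d^'n) set" where "B = {q \<in> A. q $ i0 = 0 \<and> upper_tri \<rho> (Z q)}"

definition P0 :: "real^'d^'n" where "P0 = P - (\<chi> i. P $ i0)"

lemma subspace_A: "subspace A"
  unfolding A_def by (rule subspace_linear_kernel[OF linear_stress_act])

lemma linear_Z: "linear Z"
  by (rule linearI) (auto simp: Z_def vec_eq_iff sum.distrib sum_distrib_left algebra_simps)

lemma Z_translate: "Z (q - (\<chi> i. a)) = Z q"
proof -
  have "Z (\<chi> i. a) $ b' $ b = (\<Sum>i\<in>UNIV. c b $ i) * a $ b'" for b b'
    unfolding Z_def by (simp add: sum_distrib_right)
  then have "Z (\<chi> i. a) = 0" by (simp add: vec_eq_iff c0)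
  then show ?thesis by (simp add: linear_diff[OF linear_Z])
qed

lemma Z_map: "Z (\<chi> i. R *v (q $ i)) = R ** Z q"
proof -
  have "(\<Sum>i\<in>UNIV. c b $ i * (\<Sum>k\<in>UNIV. R $ b' $ k * q $ i $ k))
      = (\<Sum>k\<in>UNIV. R $ b' $ k * (\<Sum>i\<in>UNIV. c b $ i * q $ i $ k))" for b b'
    unfolding sum_distrib_left by (subst sum.swap) (simp add: mult_ac)
  then show ?thesis
    unfolding Z_def matrix_matrix_mult_def matrix_vector_mult_def by (simp add: vec_eq_iff)
qed

lemma Z_P0: "Z P0 = mat 1"
  unfolding P0_def Z_translate by (auto simp: Z_def c1 mat_def vec_eq_iff)

lemma A_map: "q \<in> A \<Longrightarrow> (\<chi> i. R *v (q $ i)) \<in> A"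
  unfolding A_def by (simp add: stress_act_map[OF matrix_vector_mul_linear] zero_vec_def[symmetric])

lemma A_translate: "q \<in> A \<Longrightarrow> q - (\<chi> i. a) \<in> A"
  unfolding A_def by (simp add: linear_diff[OF linear_stress_act] stress_act_const)

lemma P_A: "P \<in> A" and P0_A: "P0 \<in> A"
  using stress A_translate unfolding A_def P0_def by auto

lemma subspace_upper: "subspace {q. upper_tri \<rho> (Z q)}"
  unfolding subspace_def upper_tri_def
  by (auto simp: linear_0[OF linear_Z] linear_add[OF linear_Z] linear_scale[OF linear_Z])

lemma subspace_B: "subspace B"
proof -
  have "subspace {q :: real^'d^'n. q $ i0 = 0}" by (auto simp: subspace_def)
  moreover have "B = A \<inter> {q. q $ i0 = 0} \<inter> {q. upper_tri \<rho> (Z q)}" unfolding B_def by auto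
  ultimately show ?thesis using subspace_A subspace_upper by (simp add: subspace_inter)
qed

lemma P0_B: "P0 \<in> B"
  unfolding B_def using P0_A by (auto simp: Z_P0 upper_tri_def mat_def) (simp add: P0_def)

lemma edge_form_P0: "edge_form E P = edge_form E P0"
  unfolding P0_def by (simp add: edge_form_translate fun_eq_iff)

text \<open>Infinitesimal motions of \<open>P0\<close> have zero derivative of lengths. As
  \<open>Z P0\<close> is the identity, subtracting the rotation by the skew matrix \<open>S\<close>
  with the lower part of \<open>Z q\<close> makes \<open>Z\<close> triangular, and a translation
  then pins \<open>i0\<close>.\<close>

lemma image_A_eq_image_B: "edge_form E P ` A = edge_form E P0 ` B"
proof
  show "edge_form E P0 ` B \<subseteq> edge_form E P ` A" unfolding edge_form_P0 B_def by blast
  show "edge_form E P ` A \<subseteq> edge_form E P0 ` B"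
  proof
    fix y assume "y \<in> edge_form E P ` A"
    then obtain q where q: "q \<in> A" "y = edge_form E P0 q" unfolding edge_form_P0 by blast
    define S :: "real^'d^'d" where "S = (\<chi> i j. if \<rho> j < \<rho> i then Z q $ i $ j else if \<rho> i < \<rho> j then - Z q $ j $ i else 0)"
    define q1 where "q1 = q - (\<chi> i. S *v (P0 $ i))"
    define q' where "q' = q1 - (\<chi> i. q1 $ i0)"
    have "q1 \<in> A" unfolding q1_def using q(1) A_map P0_A subspace_A subspace_diff by blast
    then have 1: "q' \<in> A" unfolding q'_def by (rule A_translate)
    have "Z q' = Z q1" unfolding q'_def by (rule Z_translate)
    also have "\<dots> = Z q - S" unfolding q1_def linear_diff[OF linear_Z] Z_map Z_P0 by simp
    finally have "Z q' = Z q - S" .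
    then have "q' \<in> B" unfolding B_def using 1 by (auto simp: upper_tri_def S_def) (simp add: q'_def)
    moreover have "edge_form E P0 q' = y"
    proof -
      have "transpose S = - S" unfolding S_def transpose_def by (auto simp: vec_eq_iff)
      have skew: "x \<bullet> (S *v x) = 0" for x
      proof -
        have "x \<bullet> (S *v x) = (transpose S *v x) \<bullet> x" by (metis dot_lmul_matrix transpose_matrix_vector)
        also have "\<dots> = - (x \<bullet> (S *v x))"
          unfolding \<open>transpose S = - S\<close>
          by (simp add: matrix_vector_mult_def inner_vec_def sum_negf sum_distrib_left mult_ac)
        finally show ?thesis by simp
      qed
      have "edge_form E P0 (\<chi> i. S *v (P0 $ i)) = 0"
        unfolding edge_form_def by (auto simp: vec_eq_iff skew matrix_vector_mult_diff_distrib[symmetric])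
      then show ?thesis unfolding q'_def q1_def q(2)
        by (subst edge_form_commute, subst edge_form_translate, subst edge_form_commute) (simp add: linear_diff[OF linear_edge_form])
    qed
    ultimately show "y \<in> edge_form E P0 ` B" by blast
  qed
qed

lemma flat_B: "q \<in> A \<Longrightarrow> edge_form E q q \<in> edge_form E P0 ` B"
  using flat[of q] image_A_eq_image_B unfolding A_def by auto

text \<open>Global rigidity provides a motion from \<open>q\<close> to \<open>q'\<close>. Pinning
  \<open>i0\<close> removes its translation, uniqueness in QR makes its linear part a diagonal sign
  matrix, and \<open>sgn\<close> fixes the signs.\<close>

lemma rigid_unique:
  assumes q: "q \<in> B" "\<And>b. Z q $ b $ b \<noteq> 0" "globally_rigid E (($) q)"
    and q': "q' \<in> B" "edge_form E q q = edge_form E q' q'"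
    and sgn: "\<And>b. \<exists>i. q $ i $ b * q' $ i $ b > 0"
  shows "q' = q"
proof -
  have "congruent_frameworks (($) q) (($) q')"
    using q(3) q'(2) unfolding edge_form_eq_iff_equivalent globally_rigid_def by blast
  then obtain a f where f: "orthogonal_transformation f" "\<And>i. q' $ i = a + f (q $ i)"
    unfolding congruent_frameworks_def euclidean_motion_def by auto
  have lf: "linear f" using f(1) orthogonal_transformation_def by blast
  have "a = 0" using f(2)[of i0] q(1) q'(1) linear_0[OF lf] unfolding B_def by simp
  define F where "F = matrix f"
  have F: "orthogonal_matrix F" unfolding F_def using f(1) orthogonal_transformation_matrix by blast
  have qF: "q' $ i = F *v (q $ i)" for i unfolding F_def f(2) \<open>a = 0\<close> using lf by (simp add: matrix_works)
  then have "q' = (\<chi> i. F *v (q $ i))" by (simp add: vec_eq_iff)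
  then have "Z q' = F ** Z q" by (simp add: Z_map)
  then have "upper_tri \<rho> (F ** Z q)" "upper_tri \<rho> (Z q)" using q(1) q'(1) unfolding B_def by auto
  then obtain \<epsilon> where \<epsilon>: "\<And>b. \<epsilon> b = 1 \<or> \<epsilon> b = - 1" "\<And>i j. F $ i $ j = (if i = j then \<epsilon> i else 0)"
    using orthogonal_upper_tri_diagonal[OF \<rho> F _ q(2)] by blast
  have comp: "q' $ i $ b = \<epsilon> b * q $ i $ b" for i b
  proof -
    have "(\<Sum>j\<in>UNIV. F $ b $ j * q $ i $ j) = (\<Sum>j\<in>UNIV. if j = b then \<epsilon> b * q $ i $ j else 0)"
      by (rule sum.cong) (auto simp: \<epsilon>(2))
    then show ?thesis unfolding qF matrix_vector_mult_def by simp
  qed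
  have "\<epsilon> b = 1" for b
  proof -
    obtain i where "q $ i $ b * q' $ i $ b > 0" using sgn by blast
    then have "\<epsilon> b * (q $ i $ b)\<^sup>2 > 0" unfolding comp by (simp add: power2_eq_square mult_ac)
    then show ?thesis using \<epsilon>(1)[of b] by (auto simp: zero_less_mult_iff)
  qed
  then show ?thesis by (simp add: vec_eq_iff comp)
qed

lemma congruent_map:
  fixes q :: "real^'d^'n"
  assumes R: "orthogonal_matrix R"
  shows "congruent_frameworks (($) q) (\<lambda>i. R *v (q $ i) - a)" "congruent_frameworks (\<lambda>i. R *v (q $ i) - a) (($) q)"
proof -
  have o: "orthogonal_transformation ((*v) R)" "orthogonal_transformation ((*v) (transpose R))"
    using R by (simp_all add: orthogonal_transformation_matrix orthogonal_matrix_transpose)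
  have "R *v (q $ i) - a = - a + R *v (q $ i)" for i by simp
  then show "congruent_frameworks (($) q) (\<lambda>i. R *v (q $ i) - a)"
    unfolding congruent_frameworks_def euclidean_motion_def using o(1) by blast
  have "q $ i = transpose R *v a + transpose R *v (R *v (q $ i) - a)" for i
    using R unfolding orthogonal_matrix_def by (simp add: matrix_vector_mult_diff_distrib matrix_vector_mul_assoc)
  then show "congruent_frameworks (\<lambda>i. R *v (q $ i) - a) (($) q)"
    unfolding congruent_frameworks_def euclidean_motion_def using o(2) by blast
qed

lemma rigid_P0: "globally_rigid E (($) P0)"
proof -
  have "globally_rigid E (($) P)" using ggr gen unfolding generically_globally_rigid_def by blast
  moreover have "(($) P0) = (\<lambda>i. mat 1 *v (P $ i) - P $ i0)" unfolding P0_def by (auto simp: fun_eq_iff)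
  ultimately show ?thesis using globally_rigid_congruent congruent_map[of "mat 1" P "P $ i0"]
    by (metis orthogonal_matrix_id)
qed

end

section \<open>Density and injectivity on the slice\<close>

lemma tendsto_matrix_mult:
  fixes a :: "real^'a^'b" and b :: "real^'c^'a"
  assumes "(f \<longlongrightarrow> a) F" "(g \<longlongrightarrow> b) F"
  shows "((\<lambda>x. f x ** g x) \<longlongrightarrow> a ** b) F"
  unfolding matrix_matrix_mult_def
  by (intro vec_tendstoI) (auto intro!: tendsto_intros tendsto_vec_nth assms)

lemma tendsto_matrix_vector_mult:
  fixes a :: "real^'a^'b" and b :: "real^'a"
  assumes "(f \<longlongrightarrow> a) F" "(g \<longlongrightarrow> b) F"
  shows "((\<lambda>x. f x *v g x) \<longlongrightarrow> a *v b) F"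
  unfolding matrix_vector_mult_def
  by (intro vec_tendstoI) (auto intro!: tendsto_intros tendsto_vec_nth assms)

lemma tendsto_transpose:
  fixes a :: "real^'a^'b"
  assumes "(f \<longlongrightarrow> a) F"
  shows "((\<lambda>x. transpose (f x)) \<longlongrightarrow> transpose a) F"
  unfolding transpose_def
  by (intro vec_tendstoI) (auto intro!: tendsto_vec_nth assms)

lemma orthogonal_matrix_norm_le:
  fixes R :: "real^'d::finite^'d"
  assumes "orthogonal_matrix R"
  shows "norm R \<le> CARD('d)"
proof -
  have "norm R \<le> (\<Sum>i\<in>UNIV. norm (R $ i))" unfolding norm_vec_def[of R] by (rule L2_set_le_sum) simp
  also have "\<dots> = (\<Sum>i\<in>(UNIV :: 'd set). 1)"
    using assms unfolding orthogonal_matrix_orthonormal_rows row_def by (intro sum.cong) (auto simp: vec_lambda_eta)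
  finally show ?thesis by simp
qed

lemma bilinear_imp_polynomial_function:
  fixes h :: "'a::euclidean_space \<Rightarrow> 'a \<Rightarrow> 'b::euclidean_space"
  assumes h: "bilinear h"
  shows "polynomial_function (\<lambda>x. h x x)"
  unfolding polynomial_function_iff_Basis_inner
proof
  fix e :: 'b
  have l: "linear (h x)" "linear (\<lambda>y. h y x)" for x using h unfolding bilinear_def by auto
  have "h x x = (\<Sum>b\<in>Basis. \<Sum>b'\<in>Basis. (x \<bullet> b) *\<^sub>R (x \<bullet> b') *\<^sub>R h b b')" for x
  proof -
    have "h x x = h (\<Sum>b\<in>Basis. (x \<bullet> b) *\<^sub>R b) x" by (simp add: euclidean_representation)
    also have "\<dots> = (\<Sum>b\<in>Basis. (x \<bullet> b) *\<^sub>R h b x)" by (simp add: linear_sum[OF l(2)] linear_scale[OF l(2)])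
    also have "\<dots> = (\<Sum>b\<in>Basis. (x \<bullet> b) *\<^sub>R h b (\<Sum>b'\<in>Basis. (x \<bullet> b') *\<^sub>R b'))" by (simp add: euclidean_representation)
    finally show ?thesis by (simp add: linear_sum[OF l(1)] linear_scale[OF l(1)] scaleR_sum_right)
  qed
  then have eq: "h x x \<bullet> e = (\<Sum>b\<in>Basis. \<Sum>b'\<in>Basis. (x \<bullet> b) * ((x \<bullet> b') * (h b b' \<bullet> e)))" for x
    by (simp add: inner_sum_left mult.assoc)
  show "real_polynomial_function (\<lambda>x. h x x \<bullet> e)"
    unfolding eq
    by (intro real_polynomial_function_sum real_polynomial_function.intros(1,2,4) bounded_linear_inner_left) auto
qed

context pinned
begin

text \<open>Generic points are dense in \<open>A\<close>, but those found need not lie in the slice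
  \<open>B\<close>. Rotating them into \<open>B\<close> keeps them globally rigid, and compactness
  of the orthogonal group controls the limit.\<close>

lemma rigid_dense:
  assumes q: "q \<in> B" "\<And>b. Z q $ b $ b \<noteq> 0" and \<epsilon>: "\<epsilon> > 0"
  shows "\<exists>q'\<in>B. norm (q' - q) < \<epsilon> \<and> (\<forall>b. Z q' $ b $ b \<noteq> 0) \<and> globally_rigid E (($) q')"
proof -
  have "\<exists>s. s \<in> A \<and> generic (($) s) \<and> norm (s - q) < inverse (real (Suc n))" for n
    using generic_dense_subspace[OF gen P_A subspace_A, of q "inverse (real (Suc n))"] q(1) unfolding B_def by auto
  then obtain s where s: "\<And>n. s n \<in> A" "\<And>n. generic (($) (s n))" "\<And>n. norm (s n - q) < inverse (real (Suc n))"
    by metis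
  have "(\<lambda>n. s n - q) \<longlonglongrightarrow> 0"
    by (rule Lim_null_comparison[OF _ LIMSEQ_inverse_real_of_nat])
      (intro always_eventually allI less_imp_le s(3))
  then have slim: "s \<longlonglongrightarrow> q" using LIM_zero_cancel by blast
  have "\<exists>R. orthogonal_matrix R \<and> upper_tri \<rho> (R ** Z (s n))" for n
    using orthogonal_to_upper_tri[OF \<rho>, of "Z (s n)"] by metis
  then obtain R where R: "\<And>n. orthogonal_matrix (R n)" "\<And>n. upper_tri \<rho> (R n ** Z (s n))" by metis
  have "bounded (range R)" unfolding bounded_iff using orthogonal_matrix_norm_le[OF R(1)] by auto
  then obtain R0 r where r: "strict_mono (r :: nat \<Rightarrow> nat)" "(R \<circ> r) \<longlonglongrightarrow> R0"
    using bounded_imp_convergent_subsequence by blast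
  then have Rl: "(\<lambda>n. R (r n)) \<longlonglongrightarrow> R0" by (simp add: o_def)
  have sl: "(\<lambda>n. s (r n)) \<longlonglongrightarrow> q" using LIMSEQ_subseq_LIMSEQ[OF slim r(1)] by (simp add: o_def)
  have blZ: "bounded_linear Z" using linear_Z linear_conv_bounded_linear by blast
  have Zl: "(\<lambda>n. Z (s (r n))) \<longlonglongrightarrow> Z q" by (rule bounded_linear.tendsto[OF blZ sl])
  have R0: "orthogonal_matrix R0"
  proof -
    have "(\<lambda>n. transpose (R (r n)) ** R (r n)) \<longlonglongrightarrow> transpose R0 ** R0"
      by (intro tendsto_matrix_mult tendsto_transpose Rl)
    moreover have "transpose (R (r n)) ** R (r n) = mat 1" for n using R(1) unfolding orthogonal_matrix_def by blast
    ultimately have "transpose R0 ** R0 = mat 1" by (simp add: LIMSEQ_const_iff)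
    then show ?thesis unfolding orthogonal_matrix_def using matrix_left_right_inverse by blast
  qed
  have up0: "upper_tri \<rho> (R0 ** Z q)"
    unfolding upper_tri_def
  proof (intro allI impI)
    fix i j assume "\<rho> j < \<rho> i"
    have "(\<lambda>n. (R (r n) ** Z (s (r n))) $ i $ j) \<longlonglongrightarrow> (R0 ** Z q) $ i $ j"
      by (intro tendsto_vec_nth tendsto_matrix_mult Rl Zl)
    moreover have "(R (r n) ** Z (s (r n))) $ i $ j = 0" for n
      using R(2) \<open>\<rho> j < \<rho> i\<close> unfolding upper_tri_def by blast
    ultimately show "(R0 ** Z q) $ i $ j = 0" by (simp add: LIMSEQ_const_iff)
  qed
  have "upper_tri \<rho> (Z q)" using q(1) unfolding B_def by blast
  from orthogonal_upper_tri_diagonal[OF \<rho> R0 this q(2) up0]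
  obtain \<epsilon>' where \<epsilon>': "\<And>i j. R0 $ i $ j = (if i = j then \<epsilon>' i else 0)" by blast
  \<comment> \<open>The limit \<open>R0\<close> is a diagonal sign matrix and need not be the
    identity. Undoing it preserves triangularity and makes the rotations tend to the identity, so
    the rotated points still converge to \<open>q\<close>.\<close>
  define R' where "R' n = transpose R0 ** R (r n)" for n
  have R'o: "orthogonal_matrix (R' n)" for n
    unfolding R'_def using R0 R(1) by (simp add: orthogonal_matrix_mul orthogonal_matrix_transpose)
  have R'l: "R' \<longlonglongrightarrow> mat 1"
  proof -
    have "R' \<longlonglongrightarrow> transpose R0 ** R0" unfolding R'_def by (intro tendsto_matrix_mult tendsto_const Rl)
    then show ?thesis using R0 unfolding orthogonal_matrix_def by simp
  qed
  have R'up: "upper_tri \<rho> (R' n ** Z (s (r n)))" for n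
    unfolding upper_tri_def
  proof (intro allI impI)
    fix i j assume ij: "\<rho> j < \<rho> i"
    have "(transpose R0 ** M) $ i $ j = (\<Sum>k\<in>UNIV. R0 $ k $ i * M $ k $ j)" for M
      unfolding matrix_matrix_mult_def transpose_def by simp
    then have "(R' n ** Z (s (r n))) $ i $ j = (\<Sum>k\<in>UNIV. R0 $ k $ i * (R (r n) ** Z (s (r n))) $ k $ j)"
      unfolding R'_def matrix_mul_assoc[symmetric] by simp
    also have "\<dots> = (\<Sum>k\<in>(UNIV :: 'd set). 0)"
    proof (rule sum.cong[OF refl])
      fix k
      show "R0 $ k $ i * (R (r n) ** Z (s (r n))) $ k $ j = 0"
        using R(2)[of "r n"] ij \<epsilon>'[of k i] unfolding upper_tri_def by (cases "k = i") auto
    qed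
    finally show "(R' n ** Z (s (r n))) $ i $ j = 0" by simp
  qed
  define q' where "q' n = (\<chi> i. R' n *v (s (r n) $ i)) - (\<chi> i. R' n *v (s (r n) $ i0))" for n
  have Zq': "Z (q' n) = R' n ** Z (s (r n))" for n unfolding q'_def Z_translate Z_map ..
  have q'B: "q' n \<in> B" for n
    unfolding B_def using A_translate[OF A_map[OF s(1)]] R'up unfolding Zq'[symmetric] by (simp add: q'_def)
  have q'r: "globally_rigid E (($) (q' n))" for n
  proof -
    have "globally_rigid E (($) (s (r n)))" using ggr s(2) unfolding generically_globally_rigid_def by blast
    moreover have "(($) (q' n)) = (\<lambda>i. R' n *v (s (r n) $ i) - R' n *v (s (r n) $ i0))"
      unfolding q'_def by (auto simp: fun_eq_iff)
    ultimately show ?thesis using globally_rigid_congruent[OF _ congruent_map(2,1)[OF R'o]] by metis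
  qed
  have "q' \<longlonglongrightarrow> (\<chi> i. mat 1 *v (q $ i)) - (\<chi> i. mat 1 *v (q $ i0))"
    unfolding q'_def
    by (intro tendsto_diff vec_tendstoI) (auto simp del: matrix_vector_mul_lid intro!: tendsto_matrix_vector_mult R'l tendsto_vec_nth sl)
  then have q'l: "q' \<longlonglongrightarrow> q" using q(1) unfolding B_def by (simp add: zero_vec_def[symmetric])
  have "eventually (\<lambda>n. norm (q' n - q) < \<epsilon>) sequentially"
    using q'l \<epsilon> unfolding tendsto_iff dist_norm by blast
  moreover have "eventually (\<lambda>n. \<forall>b. Z (q' n) $ b $ b \<noteq> 0) sequentially"
  proof (rule eventually_all_finite)
    fix b
    have "(\<lambda>n. Z (q' n) $ b $ b) \<longlonglongrightarrow> Z q $ b $ b"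
      by (intro tendsto_vec_nth bounded_linear.tendsto[OF blZ q'l])
    then show "eventually (\<lambda>n. Z (q' n) $ b $ b \<noteq> 0) sequentially" using q(2) by (rule tendsto_imp_eventually_ne)
  qed
  ultimately have "eventually (\<lambda>n. norm (q' n - q) < \<epsilon> \<and> (\<forall>b. Z (q' n) $ b $ b \<noteq> 0)) sequentially"
    by (rule eventually_conj)
  then obtain n where "norm (q' n - q) < \<epsilon>" "\<forall>b. Z (q' n) $ b $ b \<noteq> 0"
    unfolding eventually_sequentially by blast
  then show ?thesis using q'B q'r by blast
qed

lemma edge_form_has_derivative:
  fixes \<pi> :: "real^'d^'n \<Rightarrow> real^'d^'n"
  assumes "bounded_linear \<pi>"
  shows "((\<lambda>x. edge_form E (a + \<pi> x) (a + \<pi> x)) has_derivative (\<lambda>h. 2 *\<^sub>R edge_form E (a + \<pi> x) (\<pi> h))) (at x)"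
proof -
  have bb: "bounded_bilinear (edge_form E :: real^'d^'n \<Rightarrow> _)"
    using bilinear_edge_form bilinear_conv_bounded_bilinear by blast
  have d: "((\<lambda>x. a + \<pi> x) has_derivative \<pi>) (at x)"
    using has_derivative_add[OF has_derivative_const[of a] bounded_linear_imp_has_derivative[OF assms]] by simp
  show ?thesis
    using bounded_bilinear.FDERIV[OF bb d d] unfolding edge_form_commute[of E "\<pi> _" "a + \<pi> x"] scaleR_2 .
qed

lemma P0_row_nonzero: "\<exists>i. P0 $ i $ b \<noteq> 0"
proof (rule ccontr)
  assume "\<not> ?thesis"
  then have "Z P0 $ b $ b = 0" unfolding Z_def by simp
  then show False unfolding Z_P0 mat_def by simp
qed

text \<open>If \<open>a0\<close> were an infinitesimal flex in \<open>B\<close>, it would integrate: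
  by flatness the change of lengths stays in the image of the derivative, so the inverse function
  theorem finds a nonzero small \<open>x\<close> in \<open>B\<close> with \<open>P0 + x\<close>
  equivalent to \<open>P0\<close>, against \<open>rigid_unique\<close>.\<close>

lemma edge_form_inj_on_B: "inj_on (edge_form E P0) B"
proof (rule ccontr)
  assume "\<not> ?thesis"
  then obtain a0 where a0: "a0 \<in> B" "a0 \<noteq> 0" "edge_form E P0 a0 = 0"
    using linear_inj_on_iff_eq_0[OF linear_edge_form subspace_B] by blast
  obtain J where J: "range J \<subseteq> B" "linear J" "\<And>y. y \<in> edge_form E P0 ` B \<Longrightarrow> edge_form E P0 (J y) = y"
    using linear_exists_right_inverse_on[OF linear_edge_form subspace_B] by metis
  obtain \<pi> where \<pi>: "range \<pi> \<subseteq> B" "linear \<pi>" "\<And>v. v \<in> B \<Longrightarrow> \<pi> v = v"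
    using linear_exists_left_inverse_on[of id B] subspace_B linear_id by auto
  have bl: "bounded_linear \<pi>" "bounded_linear J" "bounded_linear (edge_form E P0)"
    using \<pi>(2) J(2) linear_edge_form linear_conv_bounded_linear by auto
  \<comment> \<open>The first term measures the change of lengths, the second the flex component of
    \<open>x\<close>; the factor 2 makes the derivative at 0 equal to \<open>2 *\<^sub>R h\<close>.
    Solving \<open>\<Xi> x = s *\<^sub>R a0\<close> puts \<open>x\<close> in \<open>B\<close> and,
    after applying \<open>edge_form E P0\<close>, forces the change of lengths to be zero.\<close>
  define \<Xi> where "\<Xi> x = J (edge_form E (P0 + \<pi> x) (P0 + \<pi> x) - edge_form E P0 P0) + 2 *\<^sub>R (x - J (edge_form E P0 (\<pi> x)))" for x
  define D where "D x h = J (2 *\<^sub>R edge_form E (P0 + \<pi> x) (\<pi> h)) + 2 *\<^sub>R (h - J (edge_form E P0 (\<pi> h)))" for x h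
  have der: "(\<Xi> has_derivative D x) (at x)" for x
  proof -
    have "((\<lambda>x. J (edge_form E (P0 + \<pi> x) (P0 + \<pi> x) - edge_form E P0 P0)) has_derivative
        (\<lambda>h. J (2 *\<^sub>R edge_form E (P0 + \<pi> x) (\<pi> h)))) (at x)"
      by (rule bounded_linear.has_derivative[OF bl(2)])
        (use has_derivative_diff[OF edge_form_has_derivative[OF bl(1)] has_derivative_const] in simp)
    moreover have "bounded_linear (\<lambda>x. J (edge_form E P0 (\<pi> x)))"
      using bounded_linear_compose[OF bl(2) bounded_linear_compose[OF bl(3) bl(1)]] .
    then have "((\<lambda>x. 2 *\<^sub>R (x - J (edge_form E P0 (\<pi> x)))) has_derivative (\<lambda>h. 2 *\<^sub>R (h - J (edge_form E P0 (\<pi> h))))) (at x)"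
      by (intro bounded_linear_imp_has_derivative bounded_linear_intros)
    ultimately show ?thesis unfolding \<Xi>_def D_def by (rule has_derivative_add)
  qed
  have contD: "continuous_on UNIV (\<lambda>x. D x v)" for v
  proof -
    have "bounded_linear (\<lambda>x. edge_form E x (\<pi> v))"
      using bilinear_edge_form linear_conv_bounded_linear unfolding bilinear_def by blast
    then show ?thesis unfolding D_def
      by (intro continuous_intros bounded_linear.continuous_on[OF bl(2)] bounded_linear.continuous_on[OF bl(1)]
          bounded_linear.continuous_on[where f = "\<lambda>x. edge_form E x (\<pi> v)"])
  qed
  have "D 0 h = 2 *\<^sub>R h" for h
    unfolding D_def by (simp add: linear_0[OF \<pi>(2)] linear_scale[OF J(2)] scaleR_diff_right)
  then have inj: "inj (D 0)" by (auto intro: injI)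
  obtain U V g where UV: "open U" "0 \<in> U" "open V" "homeomorphism U V \<Xi> g"
    by (rule local_inverse[OF der contD inj]) blast
  have \<Xi>0: "\<Xi> 0 = 0" unfolding \<Xi>_def by (simp add: linear_0[OF \<pi>(2)] linear_0[OF J(2)] linear_0[OF linear_edge_form])
  obtain i where i: "\<And>b. P0 $ (i b) $ b \<noteq> 0" using P0_row_nonzero by metis
  define N where "N = U \<inter> (\<Inter>b. {x. P0 $ (i b) $ b * (P0 + x) $ (i b) $ b > 0})"
  have "open N" unfolding N_def
    by (intro open_Int open_INT UV(1)) (auto intro!: open_Collect_less continuous_intros)
  have "0 \<in> N" unfolding N_def using UV(2) i by (auto simp: zero_less_mult_iff) (metis linorder_neqE_linordered_idom)
  have cg: "continuous_on V g" using UV(4) unfolding homeomorphism_def by blast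
  have "open (V \<inter> g -` N)" using cg UV(3) \<open>open N\<close> continuous_on_open_vimage by (metis Int_commute)
  moreover have "0 \<in> V \<inter> g -` N"
    using \<Xi>0 UV(2,4) \<open>0 \<in> N\<close> unfolding homeomorphism_def by force
  ultimately obtain r where r: "r > 0" "ball 0 r \<subseteq> V \<inter> g -` N" using open_contains_ball by blast
  define s where "s = r / (2 * norm a0)"
  have s: "s > 0" "norm (s *\<^sub>R a0) < r" unfolding s_def using r(1) a0(2) by auto
  define x where "x = g (s *\<^sub>R a0)"
  have "s *\<^sub>R a0 \<in> ball 0 r" using s(2) by simp
  then have "s *\<^sub>R a0 \<in> V \<inter> g -` N" using r(2) by blast
  then have x: "x \<in> N" "\<Xi> x = s *\<^sub>R a0" unfolding x_def using UV(4) unfolding homeomorphism_def by auto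
  have "x \<noteq> 0" using x(2) \<Xi>0 s(1) a0(2) by auto
  define y where "y = edge_form E (P0 + \<pi> x) (P0 + \<pi> x) - edge_form E P0 P0"
  have "P0 + \<pi> x \<in> B" using P0_B \<pi>(1) subspace_B subspace_add by blast
  have lB: "subspace (edge_form E P0 ` B)" by (rule linear_subspace_image[OF linear_edge_form subspace_B])
  have yL: "y \<in> edge_form E P0 ` B"
    unfolding y_def using flat_B \<open>P0 + \<pi> x \<in> B\<close> P0_A by (intro subspace_diff[OF lB]) (auto simp: B_def)
  have eq: "J y + 2 *\<^sub>R (x - J (edge_form E P0 (\<pi> x))) = s *\<^sub>R a0" using x(2) unfolding \<Xi>_def y_def .
  have "x = (s / 2) *\<^sub>R a0 - (1 / 2) *\<^sub>R J y + J (edge_form E P0 (\<pi> x))"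
  proof -
    have "(1 / 2) *\<^sub>R (J y + 2 *\<^sub>R (x - J (edge_form E P0 (\<pi> x)))) = (1 / 2) *\<^sub>R (s *\<^sub>R a0)" using eq by simp
    then show ?thesis by (simp add: algebra_simps)
  qed
  moreover have "J z \<in> B" for z using J(1) by blast
  ultimately have "x \<in> B" using a0(1) subspace_B
    by (metis subspace_add subspace_diff subspace_scale)
  then have \<pi>x: "\<pi> x = x" by (rule \<pi>(3))
  have "edge_form E P0 (J y + 2 *\<^sub>R (x - J (edge_form E P0 x))) = 0"
    using eq a0(3) unfolding \<pi>x by (simp add: linear_scale[OF linear_edge_form])
  then have "y = 0"
    using J(3)[OF yL] J(3)[of "edge_form E P0 x"] \<open>x \<in> B\<close>
    by (simp add: linear_add[OF linear_edge_form] linear_scale[OF linear_edge_form] linear_diff[OF linear_edge_form])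
  then have "edge_form E P0 P0 = edge_form E (P0 + x) (P0 + x)" unfolding y_def \<pi>x by simp
  then have "P0 + x = P0"
  proof (rule rigid_unique[OF P0_B _ rigid_P0, rotated 2])
    show "Z P0 $ b $ b \<noteq> 0" for b unfolding Z_P0 mat_def by simp
    show "P0 + x \<in> B" using \<open>P0 + \<pi> x \<in> B\<close> \<pi>x by simp
    show "\<exists>i. P0 $ i $ b * (P0 + x) $ i $ b > 0" for b using x(1) unfolding N_def by auto
  qed
  then show False using \<open>x \<noteq> 0\<close> by simp
qed

lemma inconsistent: False
proof -
  let ?G = "edge_form E P0"
  obtain J where J: "range J \<subseteq> B" "linear J" "\<And>b. b \<in> B \<Longrightarrow> J (?G b) = b"
    using linear_exists_left_inverse_on[OF linear_edge_form subspace_B edge_form_inj_on_B] by auto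
  obtain \<pi> where \<pi>: "range \<pi> \<subseteq> B" "linear \<pi>" "\<And>v. v \<in> B \<Longrightarrow> \<pi> v = v"
    using linear_exists_left_inverse_on[of id B] subspace_B linear_id by auto
  have bl: "bounded_linear \<pi>" "bounded_linear J"
    using \<pi>(2) J(2) linear_conv_bounded_linear by auto
  have \<pi>B: "\<pi> x \<in> B" and JB: "J y \<in> B" for x y using \<pi>(1) J(1) by auto
  have GJ: "?G (J y) = y" if "y \<in> ?G ` B" for y using that J(3) by auto
  have BA: "b \<in> A" if "b \<in> B" for b using that unfolding B_def by blast
  have FL: "edge_form E b b \<in> ?G ` B" if "b \<in> B" for b using flat_B BA that by blast
  have lB: "subspace (?G ` B)" by (rule linear_subspace_image[OF linear_edge_form subspace_B])
  have JF0: "b = 0" if "b \<in> B" "J (edge_form E b b) = 0" for b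
  proof -
    have "edge_form E b b = ?G 0" using GJ[OF FL[OF that(1)]] that(2) by simp
    then have "edge_form E b b = 0" by (simp add: linear_0[OF linear_edge_form])
    then have "b $ i = b $ i0" for i by (rule conn)
    then show ?thesis using that(1) unfolding B_def by (simp add: vec_eq_iff)
  qed
  \<comment> \<open>On \<open>B\<close> this is the squared-length map, identified by
    \<open>J\<close> with a self-map of \<open>B\<close>. The identity on a complement extends it to
    the whole space, as \<open>fold_contradiction\<close> requires.\<close>
  define f where "f x = J (edge_form E (\<pi> x) (\<pi> x)) + (x - \<pi> x)" for x
  define D where "D x h = J (2 *\<^sub>R edge_form E (\<pi> x) (\<pi> h)) + (h - \<pi> h)" for x h
  have \<pi>f: "\<pi> (f x) = J (edge_form E (\<pi> x) (\<pi> x))" for x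
    unfolding f_def using \<pi>(3)[OF JB] \<pi>(3)[OF \<pi>B] by (simp add: linear_add[OF \<pi>(2)] linear_diff[OF \<pi>(2)])
  have fsplit: "x - \<pi> x = f x - \<pi> (f x)" for x unfolding \<pi>f by (simp add: f_def)
  have bilJ: "bilinear (\<lambda>x y. J (edge_form E (\<pi> x) (\<pi> y)))"
    unfolding bilinear_def
  proof (intro conjI allI)
    have l: "linear (edge_form E q)" "linear (\<lambda>x. edge_form E x q)" for q :: "real^'d^'n"
      using bilinear_edge_form unfolding bilinear_def by auto
    show "linear (\<lambda>y. J (edge_form E (\<pi> x) (\<pi> y)))" for x
      using linear_compose[OF linear_compose[OF \<pi>(2) l(1)] J(2)] by (simp add: o_def)
    show "linear (\<lambda>x. J (edge_form E (\<pi> x) (\<pi> y)))" for y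
      using linear_compose[OF linear_compose[OF \<pi>(2) l(2)] J(2)] by (simp add: o_def)
  qed
  have bl\<pi>': "bounded_linear (\<lambda>x. x - \<pi> x)" by (intro bounded_linear_sub bounded_linear_ident bl)
  have poly: "polynomial_function f"
    unfolding f_def
    by (intro polynomial_function_add bilinear_imp_polynomial_function[OF bilJ] polynomial_function_bounded_linear bl\<pi>')
  have der: "(f has_derivative D x) (at x)" for x
  proof -
    have "((\<lambda>x. edge_form E (\<pi> x) (\<pi> x)) has_derivative (\<lambda>h. 2 *\<^sub>R edge_form E (\<pi> x) (\<pi> h))) (at x)"
      using edge_form_has_derivative[OF bl(1), of 0 x] by simp
    from bounded_linear.has_derivative[OF bl(2) this] bounded_linear_imp_has_derivative[OF bl\<pi>', of "at x"]
    show ?thesis unfolding f_def D_def by (rule has_derivative_add)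
  qed
  have contf: "continuous_on UNIV f" by (rule continuous_on_polymonial_function[OF poly])
  \<comment> \<open>Connectedness leaves no nonzero element of \<open>B\<close> with all edge
    lengths zero. Compactness of the unit sphere and homogeneity of degree 2 turn this into the
    growth bound that makes \<open>f\<close> proper.\<close>
  obtain m where m: "m > 0" "\<And>b. b \<in> B \<Longrightarrow> m * (norm b)\<^sup>2 \<le> norm (J (edge_form E b b))"
  proof (cases "B \<inter> sphere 0 1 = {}")
    case True
    have "b = 0" if "b \<in> B" for b
    proof (rule ccontr)
      assume "b \<noteq> 0"
      then have "b /\<^sub>R norm b \<in> B \<inter> sphere 0 1" using that subspace_B subspace_scale by auto
      then show False using True by blast
    qed
    then have "1 * (norm b)\<^sup>2 \<le> norm (J (edge_form E b b))" if "b \<in> B" for b using that by fastforce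
    then show thesis using that[of 1] zero_less_one by blast
  next
    case False
    have "compact (B \<inter> sphere 0 1)" using closed_subspace[OF subspace_B] by (simp add: closed_Int_compact)
    moreover have "continuous_on (B \<inter> sphere 0 1) (\<lambda>b. norm (J (edge_form E b b)))"
    proof -
      have bb: "bounded_bilinear (edge_form E :: real^'d^'n \<Rightarrow> _)"
        using bilinear_edge_form bilinear_conv_bounded_bilinear by blast
      show ?thesis
        by (intro continuous_on_norm bounded_linear.continuous_on[OF bl(2)] bounded_bilinear.continuous_on[OF bb] continuous_on_id)
    qed
    ultimately obtain b0 where b0: "b0 \<in> B \<inter> sphere 0 1"
      "\<And>b. b \<in> B \<inter> sphere 0 1 \<Longrightarrow> norm (J (edge_form E b0 b0)) \<le> norm (J (edge_form E b b))"
      using continuous_attains_inf[OF _ False] by blast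
    define m where "m = norm (J (edge_form E b0 b0))"
    have "m > 0" unfolding m_def using b0(1) JF0[of b0] by auto
    moreover have "m * (norm b)\<^sup>2 \<le> norm (J (edge_form E b b))" if "b \<in> B" for b
    proof (cases "b = 0")
      case False
      define b' where "b' = b /\<^sub>R norm b"
      have "b' \<in> B \<inter> sphere 0 1" unfolding b'_def using that False subspace_B subspace_scale by auto
      then have "m \<le> norm (J (edge_form E b' b'))" using b0(2) unfolding m_def by blast
      moreover have "J (edge_form E b b) = (norm b)\<^sup>2 *\<^sub>R J (edge_form E b' b')"
      proof -
        have b: "b = norm b *\<^sub>R b'" unfolding b'_def using False by simp
        have "edge_form E b b = (norm b)\<^sup>2 *\<^sub>R edge_form E b' b'"
          by (subst (1 2) b) (auto simp: edge_form_def vec_eq_iff power2_eq_square inner_diff algebra_simps simp del: scaleR_conv_of_real)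
        then show ?thesis using linear_scale[OF J(2)] by simp
      qed
      ultimately show ?thesis by (simp add: mult.commute[of m] mult_left_mono)
    qed simp
    ultimately show thesis using that by blast
  qed
  have closed: "closed (range f)"
  proof (rule closed_range_if_bounded_preimages[OF contf])
    fix R
    obtain K where K: "K > 0" "\<And>x. norm (\<pi> x) \<le> norm x * K" using bounded_linear.pos_bounded[OF bl(1)] by blast
    have "norm x \<le> \<bar>R\<bar> + \<bar>R\<bar> * K + (\<bar>R\<bar> * K / m + 1)" if "norm (f x) \<le> R" for x
    proof -
      have 1: "norm (\<pi> (f x)) \<le> \<bar>R\<bar> * K"
        using K(2)[of "f x"] mult_right_mono[of "norm (f x)" "\<bar>R\<bar>" K] K(1) that by linarith
      have "m * (norm (\<pi> x))\<^sup>2 \<le> \<bar>R\<bar> * K" using m(2)[OF \<pi>B[of x]] 1 unfolding \<pi>f by linarith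
      then have "(norm (\<pi> x))\<^sup>2 \<le> \<bar>R\<bar> * K / m" using m(1) by (simp add: pos_le_divide_eq mult.commute)
      moreover have "norm (\<pi> x) \<le> (norm (\<pi> x))\<^sup>2 + 1"
      proof -
        have "0 \<le> (norm (\<pi> x) - 1)\<^sup>2" by simp
        then have "2 * norm (\<pi> x) \<le> (norm (\<pi> x))\<^sup>2 + 1" by (simp add: power2_diff)
        then show ?thesis using norm_ge_zero[of "\<pi> x"] by linarith
      qed
      ultimately have 2: "norm (\<pi> x) \<le> \<bar>R\<bar> * K / m + 1" by linarith
      have "x = f x - \<pi> (f x) + \<pi> x" using fsplit[of x] by (simp add: algebra_simps)
      then have "norm x \<le> norm (f x) + norm (\<pi> (f x)) + norm (\<pi> x)"
        using norm_triangle_ineq[of "f x - \<pi> (f x)" "\<pi> x"] norm_triangle_ineq4[of "f x" "\<pi> (f x)"] by simp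
      then show ?thesis using 1 2 that by linarith
    qed
    then show "bounded {x. norm (f x) \<le> R}" unfolding bounded_iff by blast
  qed
  \<comment> \<open>A preimage would have as squared lengths the negatives of those of
    \<open>P0\<close>. All would be zero, and by connectedness \<open>P0\<close> would collapse to a
    point.\<close>
  have nonsurj: "range f \<noteq> UNIV"
  proof
    assume "range f = UNIV"
    then obtain x where x: "f x = J (- edge_form E P0 P0)" by (metis surjD)
    have "- edge_form E P0 P0 \<in> ?G ` B" using FL[OF P0_B] lB subspace_neg by blast
    moreover have "J (edge_form E (\<pi> x) (\<pi> x)) = J (- edge_form E P0 P0)"
      using \<pi>f[of x] \<pi>(3)[OF JB] unfolding x by simp
    ultimately have eq: "edge_form E (\<pi> x) (\<pi> x) = - edge_form E P0 P0" using GJ[OF FL[OF \<pi>B]] GJ by metis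
    have "edge_form E P0 P0 = 0"
    proof -
      have nn: "edge_form E q q $ e \<ge> 0" for q :: "real^'d^'n" and e unfolding edge_form_def by simp
      have "edge_form E P0 P0 $ e = 0" for e
        using nn[of P0 e] nn[of "\<pi> x" e] arg_cong[OF eq, of "\<lambda>v. v $ e"] by simp
      then show ?thesis by (simp add: vec_eq_iff)
    qed
    then have "P0 $ i = P0 $ i0" for i by (rule conn)
    then have "P0 $ i = 0" for i by (simp add: P0_def)
    then show False using P0_row_nonzero by (metis zero_index)
  qed
  have reg: "inj (D P0)"
  proof -
    have "h = 0" if "D P0 h = 0" for h
    proof -
      have "D P0 h = 2 *\<^sub>R \<pi> h + (h - \<pi> h)"
        unfolding D_def \<pi>(3)[OF P0_B] linear_scale[OF J(2)] J(3)[OF \<pi>B] ..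
      then have e: "2 *\<^sub>R \<pi> h + (h - \<pi> h) = 0" using that by simp
      then have "\<pi> (2 *\<^sub>R \<pi> h + (h - \<pi> h)) = 0" by (simp add: linear_0[OF \<pi>(2)])
      then have "\<pi> h = 0" using \<pi>(3)[OF \<pi>B]
        by (simp add: linear_add[OF \<pi>(2)] linear_diff[OF \<pi>(2)] linear_scale[OF \<pi>(2)])
      then show ?thesis using e by simp
    qed
    then show ?thesis using linear_injective_0[of "D P0"] has_derivative_linear[OF der] by blast
  qed
  \<comment> \<open>The points whose \<open>B\<close>-part lies in the hyperplane of coordinate
    \<open>b\<close>, hence is fixed by the reflection in it.\<close>
  define S where "S b = {x. \<forall>i. \<pi> x $ i $ b = 0}" for b
  have codim: "subspace (S b) \<and> dim (S b) + 2 \<le> DIM(real^'d^'n)" for b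
  proof
    show sS: "subspace (S b)" unfolding S_def
      by (auto simp: subspace_def linear_0[OF \<pi>(2)] linear_add[OF \<pi>(2)] linear_scale[OF \<pi>(2)])
    let ?K = "{u :: real^'n. stress_act E w0 u = 0}"
    \<comment> \<open>Conditions on a kernel vector \<open>u\<close> that place
      \<open>\<iota> u\<close>, which is \<open>u\<close> in coordinate \<open>b\<close> and zero
      elsewhere, in \<open>B\<close>. There are at most \<open>d\<close>, so a space
      \<open>U\<close> of dimension at least 2 remains, and its image meets \<open>S b\<close> only
      in 0.\<close>
    define W where "W = insert (axis i0 1) (c ` (UNIV - {b}))"
    define C where "C = {y \<in> UNIV. \<forall>x\<in>span W. orthogonal x y}"
    define U where "U = ?K \<inter> C"
    have sK: "subspace ?K" by (rule subspace_linear_kernel[OF linear_stress_act])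
    have sC: "subspace C" unfolding C_def by (auto simp: subspace_def orthogonal_def inner_right_distrib)
    have "card W \<le> CARD('d)"
    proof -
      have "card W \<le> Suc (card (c ` (UNIV - {b})))" unfolding W_def by (rule card_insert_le_m1) auto
      also have "card (c ` (UNIV - {b})) \<le> card (UNIV - {b})" by (rule card_image_le) simp
      also have "Suc (card (UNIV - {b})) = CARD('d)" by (simp add: card_Suc_Diff1)
      finally show ?thesis by simp
    qed
    moreover have "dim (span W) \<le> card W" unfolding dim_span by (rule dim_le_card) (auto simp: W_def intro: span_base)
    ultimately have "dim (span W) \<le> CARD('d)" by simp
    moreover have "dim C + dim (span W) = CARD('n)"
      using dim_subspace_orthogonal_to_vectors[OF subspace_span subspace_UNIV, of W] unfolding C_def by simp
    moreover have "dim {x + y |x y. x \<in> ?K \<and> y \<in> C} + dim U = dim ?K + dim C"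
      unfolding U_def by (rule dim_sums_Int[OF sK sC])
    moreover have "dim {x + y |x y. x \<in> ?K \<and> y \<in> C} \<le> CARD('n)" using dim_subset_UNIV[of "{x + y |x y. x \<in> ?K \<and> y \<in> C}"] by simp
    ultimately have dU: "2 \<le> dim U" using dimK by linarith
    define \<iota> :: "real^'n \<Rightarrow> real^'d^'n" where "\<iota> u = (\<chi> i. axis b (u $ i))" for u
    have l\<iota>: "linear \<iota>" unfolding \<iota>_def by (rule linearI) (auto simp: vec_eq_iff axis_def)
    have \<iota>c: "\<iota> u $ i $ b' = (if b' = b then u $ i else 0)" for u i b' unfolding \<iota>_def axis_def by simp
    have inj\<iota>: "inj \<iota>"
    proof (rule injI)
      fix u v assume "\<iota> u = \<iota> v"
      then have "\<iota> u $ i $ b = \<iota> v $ i $ b" for i by simp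
      then show "u = v" unfolding \<iota>c by (simp add: vec_eq_iff)
    qed
    have "\<iota> u \<in> B" if u: "u \<in> U" for u
    proof -
      have uK: "stress_act E w0 u = 0" using u unfolding U_def by blast
      have orth: "x \<bullet> u = 0" if "x \<in> W" for x
        using u span_base[OF that] unfolding U_def C_def orthogonal_def by blast
      have "stress_act E w0 (\<iota> u) $ i $ b' = 0" for i b'
      proof (cases "b' = b")
        case True
        then have "(\<chi> i. \<iota> u $ i $ b') = u" by (simp add: \<iota>c vec_eq_iff)
        then show ?thesis unfolding stress_act_component[of E w0 "\<iota> u"] using uK by simp
      next
        case False
        then have "(\<chi> i. \<iota> u $ i $ b') = (\<chi> i. 0)" by (simp add: \<iota>c)
        then show ?thesis unfolding stress_act_component[of E w0 "\<iota> u"] by (simp only: stress_act_const zero_index)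
      qed
      then have 1: "\<iota> u \<in> A" unfolding A_def by (simp add: vec_eq_iff)
      have "u $ i0 = 0" using orth[of "axis i0 1"] unfolding W_def by (simp add: inner_axis')
      then have 2: "\<iota> u $ i0 = 0" by (simp add: vec_eq_iff \<iota>c)
      have 3: "Z (\<iota> u) $ b1 $ b2 = 0" if "b1 \<noteq> b2" for b1 b2
      proof (cases "b1 = b")
        case True
        then have "c b2 \<bullet> u = 0" using orth[of "c b2"] that unfolding W_def by auto
        then show ?thesis using True unfolding Z_def \<iota>c inner_vec_def by simp
      next
        case False
        then show ?thesis unfolding Z_def \<iota>c by simp
      qed
      have "i \<noteq> j" if "\<rho> j < \<rho> i" for i j using that by auto
      then show ?thesis using 1 2 3 unfolding B_def upper_tri_def by blast
    qed
    then have \<iota>B: "\<iota> ` U \<subseteq> B" by blast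
    have sU: "subspace U" unfolding U_def by (rule subspace_inter[OF sK sC])
    then have sI: "subspace (\<iota> ` U)" using linear_subspace_image[OF l\<iota>] by blast
    have "S b \<inter> \<iota> ` U = {0}"
    proof -
      have "x = 0" if x: "x \<in> S b" "x \<in> \<iota> ` U" for x
      proof -
        obtain u where u: "x = \<iota> u" using x(2) by blast
        have "\<pi> x = x" using \<pi>(3) \<iota>B x(2) by blast
        then have "u $ i = 0" for i using x(1) unfolding S_def u by (auto simp: \<iota>c)
        then have "u = 0" by (simp add: vec_eq_iff)
        then show ?thesis using u linear_0[OF l\<iota>] by simp
      qed
      moreover have "0 \<in> S b" "0 \<in> \<iota> ` U" using sS sI subspace_0 by blast+
      ultimately show ?thesis by blast
    qed
    then have "dim {x + y |x y. x \<in> S b \<and> y \<in> \<iota> ` U} = dim (S b) + dim (\<iota> ` U)"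
      using dim_sums_Int[OF sS sI] by simp
    moreover have "dim (\<iota> ` U) = dim U" using dim_image_eq[OF l\<iota>] inj\<iota> inj_on_subset by blast
    moreover have "dim {x + y |x y. x \<in> S b \<and> y \<in> \<iota> ` U} \<le> DIM(real^'d^'n)" by (rule dim_subset_UNIV)
    ultimately show "dim (S b) + 2 \<le> DIM(real^'d^'n)" using dU by linarith
  qed
  have loc: "generically_inj_at f x" if x: "x \<notin> \<Union>(range S)" for x
  proof -
    have "\<exists>i. \<pi> x $ i $ b \<noteq> 0" for b using x unfolding S_def by blast
    then obtain i where i: "\<And>b. \<pi> x $ (i b) $ b \<noteq> 0" by metis
    define U where "U = (\<Inter>b. {u. \<pi> x $ (i b) $ b * \<pi> u $ (i b) $ b > 0})"
    have c\<pi>: "continuous_on T \<pi>" for T using bl(1) linear_continuous_on by blast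
    have "open U" unfolding U_def
      by (intro open_INT) (auto intro!: open_Collect_less continuous_intros c\<pi>)
    moreover have "x \<in> U" unfolding U_def using i by (auto simp: zero_less_mult_iff) (metis linorder_neqE_linordered_idom)
    moreover have "\<exists>u\<in>W. \<forall>u'\<in>U. f u' = f u \<longrightarrow> u' = u" if W: "open W" "W \<noteq> {}" "W \<subseteq> U" for W
    proof -
      obtain y where y: "y \<in> W" using W(2) by blast
      obtain \<epsilon> where \<epsilon>: "\<epsilon> > 0" "ball y \<epsilon> \<subseteq> W" using W(1) y open_contains_ball by blast
      \<comment> \<open>\<open>rigid_dense\<close> needs a nonzero diagonal of \<open>Z\<close>.
        Adding \<open>s *\<^sub>R P0\<close> shifts every diagonal entry by \<open>s\<close>, so
        only finitely many small \<open>s\<close> are excluded.\<close>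
      define T where "T = (\<lambda>b. - Z (\<pi> y) $ b $ b) ` UNIV"
      define \<eta> where "\<eta> = \<epsilon> / (2 * (norm P0 + 1))"
      have nP: "norm P0 + 1 > 0" by (simp add: add_nonneg_pos)
      have "\<eta> > 0" unfolding \<eta>_def using \<epsilon>(1) nP by simp
      then have "infinite {0<..<\<eta>}" by simp
      moreover have "finite T" unfolding T_def by simp
      ultimately obtain s where s: "s \<in> {0<..<\<eta>} - T"
        by (metis Diff_infinite_finite ex_in_conv finite.emptyI)
      define q where "q = \<pi> y + s *\<^sub>R P0"
      have qB: "q \<in> B" unfolding q_def using \<pi>B P0_B subspace_B by (intro subspace_add subspace_scale)
      have qZ: "Z q $ b $ b \<noteq> 0" for b
      proof -
        have "Z q $ b $ b = Z (\<pi> y) $ b $ b + s"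
          unfolding q_def by (simp add: linear_add[OF linear_Z] linear_scale[OF linear_Z] Z_P0 mat_def)
        moreover have "s \<noteq> - Z (\<pi> y) $ b $ b" using s unfolding T_def by blast
        ultimately show ?thesis by linarith
      qed
      obtain q' where q': "q' \<in> B" "norm (q' - q) < \<epsilon> / 2" "\<And>b. Z q' $ b $ b \<noteq> 0" "globally_rigid E (($) q')"
        using rigid_dense[OF qB qZ, of "\<epsilon> / 2"] \<epsilon>(1) by auto
      define u where "u = y + (q' - \<pi> y)"
      have \<pi>u: "\<pi> u = q'" unfolding u_def
        by (simp add: linear_add[OF \<pi>(2)] linear_diff[OF \<pi>(2)] \<pi>(3)[OF \<pi>B] \<pi>(3)[OF q'(1)])
      have "u \<in> W"
      proof -
        have "norm (s *\<^sub>R P0) \<le> s * (norm P0 + 1)" using s by simp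
        also have "\<dots> < \<eta> * (norm P0 + 1)" using s nP by (intro mult_strict_right_mono) auto
        also have "\<dots> = \<epsilon> / 2" unfolding \<eta>_def using nP by (simp add: field_simps)
        finally have "norm (s *\<^sub>R P0) < \<epsilon> / 2" .
        moreover have "u - y = (q' - q) + s *\<^sub>R P0" unfolding u_def q_def by simp
        ultimately have "norm (u - y) < \<epsilon>" using q'(2) norm_triangle_ineq[of "q' - q" "s *\<^sub>R P0"] by simp
        then show ?thesis using \<epsilon>(2) by (auto simp: dist_norm norm_minus_commute)
      qed
      moreover have "u' = u" if u': "u' \<in> U" "f u' = f u" for u'
      proof -
        have e: "u' - \<pi> u' = u - \<pi> u" using fsplit[of u] fsplit[of u'] u'(2) by simp
        have "J (edge_form E (\<pi> u') (\<pi> u')) = J (edge_form E (\<pi> u) (\<pi> u))" using \<pi>f u'(2) by metis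
        then have F: "edge_form E q' q' = edge_form E (\<pi> u') (\<pi> u')"
          using GJ[OF FL[OF \<pi>B]] unfolding \<pi>u[symmetric] by metis
        have "\<pi> u' = q'"
        proof (rule rigid_unique[OF q'(1) q'(3) q'(4) \<pi>B F])
          fix b
          have a: "\<pi> x $ (i b) $ b * \<pi> u $ (i b) $ b > 0" using \<open>u \<in> W\<close> W(3) unfolding U_def by blast
          have a': "\<pi> x $ (i b) $ b * \<pi> u' $ (i b) $ b > 0" using u'(1) unfolding U_def by blast
          have "\<pi> u $ (i b) $ b * \<pi> u' $ (i b) $ b > 0" using a a' by (auto simp: zero_less_mult_iff)
          then show "\<exists>i. q' $ i $ b * \<pi> u' $ i $ b > 0" unfolding \<pi>u by blast
        qed
        then show ?thesis using e \<pi>u by simp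
      qed
      ultimately show ?thesis by blast
    qed
    ultimately show ?thesis unfolding generically_inj_at_def by blast
  qed
  show False
    by (rule fold_contradiction[OF poly der closed nonsurj reg, of "range S"]) (use codim loc in auto)
qed

end

section \<open>Generic frameworks\<close>

lemma dim_kernel_plus_rank:
  fixes A :: "real^'a^'r"
  shows "dim {w. A *v w = 0} + rank A = CARD('a)"
proof -
  have "A *v w = 0 \<longleftrightarrow> (\<forall>x\<in>span (rows A). orthogonal x w)" for w
  proof
    assume "A *v w = 0"
    then show "\<forall>x\<in>span (rows A). orthogonal x w" using orthogonal_nullspace_rowspace orthogonal_commute by blast
  next
    assume o: "\<forall>x\<in>span (rows A). orthogonal x w"
    have "A $ i \<bullet> w = 0" for i
    proof -
      have "A $ i \<in> rows A" unfolding rows_def row_def by (auto simp: vec_lambda_eta)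
      then show ?thesis using o span_base unfolding orthogonal_def by blast
    qed
    then show "A *v w = 0" by (simp add: vec_eq_iff matrix_vector_mul_component)
  qed
  then have "{w. A *v w = 0} = {w\<in>UNIV. \<forall>x\<in>span (rows A). orthogonal x w}" by auto
  then show ?thesis
    using dim_subspace_orthogonal_to_vectors[OF subspace_span subspace_UNIV, of "rows A"]
    by (simp add: row_rank_def)
qed

section \<open>Stress and rigidity matrices\<close>

definition stress_mat :: "'n::finite set set \<Rightarrow> real^('n \<times> 'n) \<Rightarrow> real^'n^'n" where
  "stress_mat E w = matrix (stress_act E w)"

lemma stress_mat_mult: "stress_mat E w *v u = stress_act E w (u :: real^'n::finite)"
proof -
  have "linear (stress_act E w :: real^'n \<Rightarrow> real^'n)" by (rule linear_stress_act)
  then show ?thesis unfolding stress_mat_def by (simp add: matrix_works)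
qed

lemma stress_mat_nth: "stress_mat E w $ i $ j = stress_act E w (axis j 1 :: real^'n::finite) $ i"
  unfolding stress_mat_def matrix_def by simp

lemma dim_kernel_stress_mat:
  "dim {u :: real^'n::finite. stress_act E w u = 0} + rank (stress_mat E w) = CARD('n)"
  using dim_kernel_plus_rank[of "stress_mat E w"] unfolding stress_mat_mult .

text \<open>Rows are coordinates of vertices and columns are pairs of vertices, so that the kernel
  is the space of stresses and the entries are rational polynomials in the configuration.\<close>

definition rigidity_mat :: "'n::finite set set \<Rightarrow> ('n \<times> 'd::finite \<Rightarrow> real) \<Rightarrow> real^('n \<times> 'n)^('n \<times> 'd)" where
  "rigidity_mat E x = (\<chi> r e. stress_act E (axis e 1) (\<chi> i b. x (i, b)) $ fst r $ snd r)"

lemma sum_axis: "(\<Sum>e\<in>UNIV. w $ e *\<^sub>R axis e 1) = (w :: real^'a::finite)"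
  by (simp add: vec_eq_iff axis_def if_distrib cong: if_cong)

lemma stress_act_sum_axis:
  fixes q :: "'v::real_vector^'n::finite"
  shows "stress_act E w q = (\<Sum>e\<in>UNIV. w $ e *\<^sub>R stress_act E (axis e 1) q)"
proof -
  have "stress_act E (\<Sum>e\<in>UNIV. w $ e *\<^sub>R axis e 1) q = (\<Sum>e\<in>UNIV. w $ e *\<^sub>R stress_act E (axis e 1) q)"
    unfolding linear_sum[OF linear_stress_act_left] linear_scale[OF linear_stress_act_left] ..
  then show ?thesis unfolding sum_axis .
qed

lemma rigidity_mat_mult:
  fixes x :: "'n::finite \<times> 'd::finite \<Rightarrow> real"
  shows "(rigidity_mat E x *v w) $ (i, b) = stress_act E w (\<chi> i b. x (i, b)) $ i $ b"
  unfolding rigidity_mat_def matrix_vector_mult_def stress_act_sum_axis[of E w]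
  by (simp add: mult.commute)

lemma rigidity_mat_kernel:
  fixes x :: "'n::finite \<times> 'd::finite \<Rightarrow> real"
  shows "rigidity_mat E x *v w = 0 \<longleftrightarrow> stress_act E w (\<chi> i b. x (i, b)) = 0"
  by (auto simp: vec_eq_iff rigidity_mat_mult[symmetric] split_paired_all)

lemma dim_stress_space:
  fixes Q :: "real^'d::finite^'n::finite"
  shows "dim {w. stress_act E w Q = 0} + rank (rigidity_mat E (\<lambda>(i, b). Q $ i $ b)) = CARD('n \<times> 'n)"
  using dim_kernel_plus_rank[of "rigidity_mat E (\<lambda>(i, b). Q $ i $ b)"] unfolding rigidity_mat_kernel by simp

lemma Rats_axis: "axis e (1 :: real) $ i \<in> \<rat>"
  unfolding axis_def by auto

lemma rat_poly_rigidity_mat: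
  fixes r :: "'n::finite \<times> 'd::finite"
  shows "rat_poly (\<lambda>x. rigidity_mat E x $ r $ e)"
  unfolding rigidity_mat_def stress_act_def
  by (auto intro!: rat_poly_sum rat_poly_cmult rat_poly_diff rat_poly.var Rats_add Rats_axis)

lemma Rats_stress_act: "stress_act E (axis a 1) (axis j 1 :: real^'n::finite) $ i \<in> \<rat>"
proof -
  have "(\<Sum>k\<in>UNIV. (if {i, k} \<in> E then axis a 1 $ (i, k) + axis a 1 $ (k, i) else 0) *
      (axis j 1 $ i - axis j (1 :: real) $ k)) \<in> \<rat>"
    by (intro Rats_sum Rats_mult Rats_diff Rats_axis) (auto intro!: Rats_add Rats_axis)
  then show ?thesis unfolding stress_act_def by simp
qed

lemma generic_stress_space_min:
  fixes P Q :: "real^'d::finite^'n::finite"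
  assumes "generic (($) P)"
  shows "dim {w. stress_act E w P = 0} \<le> dim {w. stress_act E w Q = 0}"
proof -
  have p: "algebraically_independent_rat (\<lambda>(i, b). P $ i $ b)" using assms unfolding generic_def .
  show ?thesis
    using rank_generic_max[OF p rat_poly_rigidity_mat, of E "\<lambda>(i, b). Q $ i $ b"] dim_stress_space[of E P] dim_stress_space[of E Q] by linarith
qed

lemma generic_stress_rank_max:
  fixes P Q :: "real^'d::finite^'n::finite"
  assumes "generic (($) P)" and eq: "dim {w. stress_act E w P = 0} = dim {w. stress_act E w Q = 0}"
    and w: "stress_act E w Q = 0"
  shows "\<exists>w'. stress_act E w' P = 0 \<and> rank (stress_mat E w) \<le> rank (stress_mat E w')"
proof -
  have p: "algebraically_independent_rat (\<lambda>(i, b). P $ i $ b)" using assms unfolding generic_def by simp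
  have r: "rank (rigidity_mat E (\<lambda>(i, b). Q $ i $ b)) = rank (rigidity_mat E (\<lambda>(i, b). P $ i $ b))"
    using dim_stress_space[of E P] dim_stress_space[of E Q] eq by linarith
  have "rigidity_mat E (\<lambda>(i, b). Q $ i $ b) *v w = 0" unfolding rigidity_mat_kernel using w by simp
  moreover have "stress_mat E w $ i $ j = (\<Sum>a\<in>UNIV. stress_act E (axis a 1) (axis j 1) $ i * w $ a)" for w i j
    unfolding stress_mat_nth by (subst stress_act_sum_axis) (simp add: mult.commute)
  ultimately have "\<exists>w'. rigidity_mat E (\<lambda>(i, b). P $ i $ b) *v w' = 0 \<and> rank (stress_mat E w) \<le> rank (stress_mat E w')"
    by (rule rank_kernel_generic_max[OF p rat_poly_rigidity_mat r _ Rats_stress_act])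
  then show ?thesis unfolding rigidity_mat_kernel by simp
qed

lemma det_nonzero_iff_kernel:
  fixes A :: "real^'a^'a"
  shows "det A \<noteq> 0 \<longleftrightarrow> (\<forall>x. A *v x = 0 \<longrightarrow> x = 0)"
  unfolding invertible_det_nz[symmetric] invertible_left_inverse matrix_left_invertible_ker ..

text \<open>The affine coordinate matrix of \<open>d + 1\<close> vertices. \<open>'d option\<close>
  is an index type of that size, and its element \<open>None\<close> carries the column of
  ones.\<close>

definition vertex_mat :: "('d::finite option \<Rightarrow> 'n) \<Rightarrow> ('n \<times> 'd \<Rightarrow> real) \<Rightarrow> real^('d option)^('d option)" where
  "vertex_mat v x = (\<chi> t s. case s of None \<Rightarrow> 1 | Some b \<Rightarrow> x (v t, b))"

lemma sum_UNIV_option: "(\<Sum>s\<in>(UNIV :: 'd::finite option set). f s) = f None + (\<Sum>b\<in>UNIV. f (Some b))"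
  unfolding UNIV_option_conv by (simp add: sum.reindex)

lemma vertex_mat_mult:
  fixes x :: "'n::finite \<times> 'd::finite \<Rightarrow> real"
  shows "(vertex_mat v x *v y) $ t = y $ None + (\<Sum>b\<in>UNIV. x (v t, b) * y $ Some b)"
  unfolding vertex_mat_def matrix_vector_mult_def by (simp add: sum_UNIV_option)

lemma det_vertex_mat_generic:
  fixes p :: "'n::finite \<Rightarrow> real^'d::finite"
  assumes p: "generic p" and v: "inj v"
  shows "det (vertex_mat v (\<lambda>(i, b). p i $ b)) \<noteq> 0"
proof (rule rat_poly_nonzero[where f = "\<lambda>x. det (vertex_mat v x)"])
  show "algebraically_independent_rat (\<lambda>(i, b). p i $ b)" using p unfolding generic_def .
  show "rat_poly (\<lambda>x. det (vertex_mat v x))"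
  proof (rule rat_poly_det)
    fix t s
    show "rat_poly (\<lambda>x. vertex_mat v x $ t $ s)"
      unfolding vertex_mat_def by (cases s) (auto intro: rat_poly.var rat_poly.const)
  qed
  \<comment> \<open>The witness of a nonzero determinant is the standard simplex:
    \<open>v None\<close> at the origin, \<open>v (Some b)\<close> at the unit vector of
    \<open>b\<close>.\<close>
  define x0 :: "'n \<times> 'd \<Rightarrow> real" where "x0 = (\<lambda>(i, b). if i = v (Some b) then 1 else 0)"
  have "y = 0" if y: "vertex_mat v x0 *v y = 0" for y
  proof -
    have n: "y $ None = 0"
    proof -
      have "y $ None + (\<Sum>b\<in>UNIV. x0 (v None, b) * y $ Some b) = 0"
        unfolding vertex_mat_mult[symmetric] y by simp
      moreover have "x0 (v None, b) = 0" for b using v unfolding x0_def by (auto dest: injD)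
      ultimately show ?thesis by simp
    qed
    have s: "y $ Some b = 0" for b
    proof -
      have "y $ None + (\<Sum>b'\<in>UNIV. x0 (v (Some b), b') * y $ Some b') = 0"
        unfolding vertex_mat_mult[symmetric] y by simp
      moreover have "x0 (v (Some b), b') * y $ Some b' = (if b' = b then y $ Some b else 0)" for b'
        using v unfolding x0_def by (auto dest: injD)
      ultimately show ?thesis using n by simp
    qed
    have "y $ s = 0" for s by (cases s) (use n s in auto)
    then show ?thesis by (simp add: vec_eq_iff)
  qed
  then show "det (vertex_mat v x0) \<noteq> 0" unfolding det_nonzero_iff_kernel by blast
qed

lemma affine_function_zero:
  fixes p :: "'n::finite \<Rightarrow> real^'d::finite" and v :: "'d option \<Rightarrow> 'n"
  assumes p: "generic p" and v: "inj v" and y: "\<And>t. \<alpha> + a \<bullet> p (v t) = 0"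
  shows "\<alpha> = 0 \<and> a = 0"
proof -
  define z :: "real^('d option)" where "z = (\<chi> s. case s of None \<Rightarrow> \<alpha> | Some b \<Rightarrow> a $ b)"
  have "vertex_mat v (\<lambda>(i, b). p i $ b) *v z = 0"
    unfolding vec_eq_iff vertex_mat_mult using y unfolding z_def inner_vec_def by (simp add: mult.commute)
  then have "z = 0" using det_vertex_mat_generic[OF p v] unfolding det_nonzero_iff_kernel by blast
  then have "z $ None = 0" "z $ Some b = 0" for b by simp_all
  then show ?thesis unfolding z_def by (simp add: vec_eq_iff)
qed

lemma affine_dependence_zero:
  fixes p :: "'n::finite \<Rightarrow> real^'d::finite" and v :: "'d option \<Rightarrow> 'n"
  assumes p: "generic p" and v: "inj v" and y: "(\<Sum>t\<in>UNIV. y t) = 0" "(\<Sum>t\<in>UNIV. y t *\<^sub>R p (v t)) = 0"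
  shows "y t = 0"
proof -
  let ?V = "vertex_mat v (\<lambda>(i, b). p i $ b)"
  have "(transpose ?V *v (\<chi> t. y t)) $ s = 0" for s
  proof (cases s)
    case None
    then show ?thesis using y(1) by (simp add: vertex_mat_def transpose_def matrix_vector_mult_def)
  next
    case (Some b)
    have "(\<Sum>t\<in>UNIV. y t *\<^sub>R p (v t)) $ b = 0" using y(2) by simp
    then show ?thesis using Some by (simp add: vertex_mat_def transpose_def matrix_vector_mult_def mult.commute)
  qed
  then have "transpose ?V *v (\<chi> t. y t) = 0" by (simp add: vec_eq_iff)
  moreover have "det (transpose ?V) \<noteq> 0" using det_vertex_mat_generic[OF p v] by simp
  ultimately have "(\<chi> t. y t) = 0" unfolding det_nonzero_iff_kernel by blast
  then have "(\<chi> t. y t) $ t = 0" by simp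
  then show ?thesis by simp
qed

lemma inj_option_range:
  fixes T :: "'n::finite set"
  assumes "card T = CARD('d) + 1"
  obtains v :: "'d::finite option \<Rightarrow> 'n" where "inj v" "range v = T"
proof -
  have "card (UNIV :: 'd option set) = card T" using assms by (simp add: card_UNIV_option)
  then obtain v :: "'d option \<Rightarrow> 'n" where "bij_betw v UNIV T"
    using finite_same_card_bij[of "UNIV :: 'd option set" T] by auto
  then show thesis using that unfolding bij_betw_def by blast
qed

lemma inj_option_exists:
  assumes "CARD('d) + 1 \<le> CARD('n)"
  obtains v :: "'d::finite option \<Rightarrow> 'n::finite" where "inj v"
proof -
  obtain T :: "'n set" where "card T = CARD('d) + 1"
    using assms obtain_subset_with_card_n[of "CARD('d) + 1" "UNIV :: 'n set"] by auto
  then show thesis using that inj_option_range by metis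
qed

lemma generic_affine_general_position:
  fixes p :: "'n::finite \<Rightarrow> real^'d::finite"
  assumes p: "generic p" and n: "CARD('d) + 1 \<le> CARD('n)"
  shows "affine_general_position p"
  unfolding affine_general_position_def
proof (intro allI impI notI)
  fix K :: "'n set" assume K: "card K \<le> CARD('d) + 1"
    and "\<exists>A. affine A \<and> aff_dim A = int (card K) - 2 \<and> p ` K \<subseteq> A"
  then obtain A where A: "aff_dim A = int (card K) - 2" "p ` K \<subseteq> A" by blast
  obtain T where T: "K \<subseteq> T" "card T = CARD('d) + 1"
    using exists_subset_between[of K "CARD('d) + 1" UNIV] K n by auto
  obtain v :: "'d option \<Rightarrow> 'n" where v: "inj v" "range v = T" using inj_option_range[OF T(2)] by metis
  have dep: "y i = 0" if "\<And>i. i \<notin> K \<Longrightarrow> y i = 0" "(\<Sum>i\<in>UNIV. y i) = 0" "(\<Sum>i\<in>UNIV. y i *\<^sub>R p i) = 0" for y i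
  proof (cases "i \<in> T")
    case True
    have "(\<Sum>t\<in>UNIV. y (v t)) = (\<Sum>i\<in>T. y i)" using v by (metis sum.reindex_cong)
    also have "\<dots> = (\<Sum>i\<in>UNIV. y i)" using that(1) T(1) by (intro sum.mono_neutral_left) auto
    finally have 1: "(\<Sum>t\<in>UNIV. y (v t)) = 0" using that(2) by simp
    have "(\<Sum>t\<in>UNIV. y (v t) *\<^sub>R p (v t)) = (\<Sum>i\<in>T. y i *\<^sub>R p i)" using v sum.reindex_cong[of v UNIV T "\<lambda>i. y i *\<^sub>R p i"] by simp
    also have "\<dots> = (\<Sum>i\<in>UNIV. y i *\<^sub>R p i)" using that(1) T(1) by (intro sum.mono_neutral_left) auto
    finally have 2: "(\<Sum>t\<in>UNIV. y (v t) *\<^sub>R p (v t)) = 0" using that(3) by simp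
    obtain t where "i = v t" using True v(2) by blast
    then show ?thesis using affine_dependence_zero[OF p v(1) 1 2] by simp
  next
    case False
    then show ?thesis using that(1) T(1) by blast
  qed
  have inj: "inj_on p K"
  proof (rule inj_onI, rule ccontr)
    fix i j assume ij: "i \<in> K" "j \<in> K" "p i = p j" "i \<noteq> j"
    define y :: "'n \<Rightarrow> real" where "y k = (if k = i then 1 else 0) - (if k = j then 1 else 0)" for k
    have "y i = 0"
    proof (rule dep)
      show "y k = 0" if "k \<notin> K" for k using that ij unfolding y_def by auto
      show "(\<Sum>k\<in>UNIV. y k) = 0" unfolding y_def by (simp add: sum_subtractf)
      have "y k *\<^sub>R p k = (if k = i then p i else 0) - (if k = j then p j else 0)" for k unfolding y_def by simp
      then show "(\<Sum>k\<in>UNIV. y k *\<^sub>R p k) = 0" using ij(3) by (simp add: sum_subtractf)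
    qed
    then show False using ij(4) unfolding y_def by simp
  qed
  have "\<not> affine_dependent (p ` K)"
  proof
    assume "affine_dependent (p ` K)"
    then obtain u where u: "sum u (p ` K) = 0" "\<exists>x\<in>p ` K. u x \<noteq> 0" "(\<Sum>x\<in>p ` K. u x *\<^sub>R x) = 0"
      using affine_dependent_explicit_finite[of "p ` K"] by auto
    define y where "y i = (if i \<in> K then u (p i) else 0)" for i
    have "y i = 0" for i
    proof (rule dep)
      have "(\<Sum>i\<in>UNIV. y i) = (\<Sum>i\<in>K. u (p i))" unfolding y_def by (simp add: sum.If_cases)
      also have "\<dots> = 0" using u(1) sum.reindex[OF inj, of u] by simp
      finally show "(\<Sum>i\<in>UNIV. y i) = 0" .
      have "(\<Sum>i\<in>UNIV. y i *\<^sub>R p i) = (\<Sum>i\<in>UNIV. if i \<in> K then u (p i) *\<^sub>R p i else 0)" unfolding y_def by (intro sum.cong) auto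
      also have "\<dots> = (\<Sum>i\<in>K. u (p i) *\<^sub>R p i)" by (simp add: sum.If_cases)
      also have "\<dots> = 0" using u(3) sum.reindex[OF inj, of "\<lambda>x. u x *\<^sub>R x"] by simp
      finally show "(\<Sum>i\<in>UNIV. y i *\<^sub>R p i) = 0" .
    qed (simp add: y_def)
    then show False using u(2) unfolding y_def by (metis imageE)
  qed
  then have "aff_dim (p ` K) = int (card K) - 1"
    using aff_dim_affine_independent[of "p ` K"] card_image[OF inj] by simp
  moreover have "aff_dim (p ` K) \<le> aff_dim A" using A(2) by (rule aff_dim_subset)
  ultimately show False using A(1) by simp
qed

text \<open>Up to extension by zero the \<open>c b\<close> are the rows of the inverse of a
  \<open>vertex_mat\<close>; the row of \<open>None\<close> is left out, and the column of ones
  gives the zero sums.\<close>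

lemma dual_affine_functions:
  fixes p :: "'n::finite \<Rightarrow> real^'d::finite"
  assumes p: "generic p" and n: "CARD('d) + 1 \<le> CARD('n)"
  obtains c :: "'d \<Rightarrow> real^'n" where "\<And>b. (\<Sum>i\<in>UNIV. c b $ i) = 0"
    "\<And>b b'. (\<Sum>i\<in>UNIV. c b $ i * p i $ b') = (if b = b' then 1 else 0)"
proof -
  obtain v :: "'d option \<Rightarrow> 'n" where v: "inj v" using inj_option_exists[OF n] .
  let ?V = "vertex_mat v (\<lambda>(i, b). p i $ b)"
  have "invertible ?V" using det_vertex_mat_generic[OF p v] invertible_det_nz by blast
  then obtain W where W: "W ** ?V = mat 1" unfolding invertible_def by blast
  define c :: "'d \<Rightarrow> real^'n" where "c b = (\<chi> i. \<Sum>t\<in>UNIV. if v t = i then W $ Some b $ t else 0)" for b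
  have sum: "(\<Sum>i\<in>UNIV. c b $ i * g i) = (\<Sum>t\<in>UNIV. W $ Some b $ t * g (v t))" for b and g :: "'n \<Rightarrow> real"
  proof -
    have "(\<Sum>i\<in>UNIV. c b $ i * g i) = (\<Sum>i\<in>UNIV. \<Sum>t\<in>UNIV. if v t = i then W $ Some b $ t * g (v t) else 0)"
      unfolding c_def by (auto simp: sum_distrib_right intro!: sum.cong)
    also have "\<dots> = (\<Sum>t\<in>UNIV. \<Sum>i\<in>UNIV. if v t = i then W $ Some b $ t * g (v t) else 0)" by (rule sum.swap)
    also have "\<dots> = (\<Sum>t\<in>UNIV. W $ Some b $ t * g (v t))" by simp
    finally show ?thesis .
  qed
  have WV: "(\<Sum>t\<in>UNIV. W $ Some b $ t * ?V $ t $ s) = (if Some b = s then 1 else 0)" for b s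
  proof -
    have "(W ** ?V) $ Some b $ s = (if Some b = s then 1 else 0)" unfolding W mat_def by simp
    then show ?thesis unfolding matrix_matrix_mult_def by simp
  qed
  show thesis
  proof (rule that)
    show "(\<Sum>i\<in>UNIV. c b $ i) = 0" for b
      using sum[of b "\<lambda>_. 1"] WV[of b None] by (simp add: vertex_mat_def)
    show "(\<Sum>i\<in>UNIV. c b $ i * p i $ b') = (if b = b' then 1 else 0)" for b b'
      using sum[of b "\<lambda>i. p i $ b'"] WV[of b "Some b'"] by (simp add: vertex_mat_def)
  qed
qed

lemma connected_edge_form_zero:
  fixes q :: "'v::real_inner^'n::finite"
  assumes "induced_connected E UNIV" "edge_form E q q = 0"
  shows "q $ i = q $ j"
proof -
  have e: "q $ x = q $ y" if "{x, y} \<in> E" for x y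
  proof -
    have "edge_form E q q $ (x, y) = 0" using assms(2) by simp
    then show ?thesis using that unfolding edge_form_def by simp
  qed
  have "(i, j) \<in> {(x, y). x \<in> UNIV \<and> y \<in> UNIV \<and> {x, y} \<in> E}\<^sup>*"
    using assms(1) unfolding induced_connected_def by blast
  then show ?thesis by (induction rule: rtrancl_induct) (use e in auto)
qed

lemma stress_mat_equilibrium:
  fixes p :: "'n::finite \<Rightarrow> real^'d::finite"
  assumes w: "stress_act E w (\<chi> i. p i) = 0"
  shows "equilibrium_stress_matrix E p (stress_mat E w)"
  unfolding equilibrium_stress_matrix_def
proof (intro conjI allI impI)
  show "transpose (stress_mat E w) = stress_mat E w"
  proof -
    have "stress_mat E w $ i $ j = stress_mat E w $ j $ i" for i j
      using stress_act_selfadjoint[of E w "axis j 1" "axis i (1::real)"]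
      unfolding stress_mat_nth by (simp add: inner_axis inner_axis')
    then show ?thesis unfolding transpose_def by (simp add: vec_eq_iff)
  qed
  show "stress_mat E w $ i $ j = 0" if "i \<noteq> j \<and> {i, j} \<notin> E" for i j
    unfolding stress_mat_nth stress_act_def using that by (auto simp: axis_def intro!: sum.neutral)
  have one: "(\<chi> i. 1) = (1 :: real^'n)" by (simp add: vec_eq_iff)
  show "stress_mat E w *v 1 = 0" using stress_act_const[of E w "1 :: real"] unfolding stress_mat_mult one .
  fix i
  have "(\<Sum>j\<in>UNIV. stress_mat E w $ i $ j *\<^sub>R p j) $ b = 0" for b
  proof -
    have "(\<Sum>j\<in>UNIV. stress_mat E w $ i $ j *\<^sub>R p j) $ b = (stress_mat E w *v (\<chi> j. p j $ b)) $ i"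
      unfolding matrix_vector_mult_def by simp
    also have "\<dots> = stress_act E w (\<chi> j. p j) $ i $ b"
      unfolding stress_mat_mult stress_act_component[of E w "\<chi> j. p j"] by simp
    also have "\<dots> = 0" using w by simp
    finally show ?thesis .
  qed
  then show "(\<Sum>j\<in>UNIV. stress_mat E w $ i $ j *\<^sub>R p j) = 0" by (simp add: vec_eq_iff)
qed

text \<open>The kernel contains all affine functions of \<open>p\<close>, a space of dimension
  \<open>d + 1\<close> by genericity; when the rank is as large as this permits, the two spaces
  coincide.\<close>

lemma equilibrium_kernel_affine:
  fixes p :: "'n::finite \<Rightarrow> real^'d::finite"
  assumes p: "generic p" and n: "CARD('d) + 1 \<le> CARD('n)" and eq: "equilibrium_stress_matrix E p \<Omega>"
  shows "rank \<Omega> + CARD('d) + 1 \<le> CARD('n)"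
    "rank \<Omega> + CARD('d) + 1 = CARD('n) \<Longrightarrow> \<Omega> *v y = 0 \<Longrightarrow> \<exists>\<alpha> a. \<forall>i. y $ i = \<alpha> + a \<bullet> p i"
proof -
  obtain v :: "'d option \<Rightarrow> 'n" where v: "inj v" using inj_option_exists[OF n] .
  define g :: "real^('d option) \<Rightarrow> real^'n" where "g z = (\<chi> i. z $ None + (\<Sum>b\<in>UNIV. z $ Some b * p i $ b))" for z
  have lg: "linear g" unfolding g_def
    by (rule linearI) (auto simp: vec_eq_iff sum.distrib sum_distrib_left algebra_simps)
  have inj: "inj g"
  proof -
    have "z = 0" if z: "g z = 0" for z
    proof -
      have "z $ None + (\<chi> b. z $ Some b) \<bullet> p i = 0" for i
        using arg_cong[OF z, of "\<lambda>y. y $ i"] unfolding g_def inner_vec_def by simp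
      from affine_function_zero[OF p v this] have "z $ None = 0" "\<forall>b. z $ Some b = 0" by (auto simp: vec_eq_iff)
      then have "z $ s = 0" for s by (cases s) auto
      then show ?thesis by (simp add: vec_eq_iff)
    qed
    then show ?thesis using linear_injective_0[OF lg] by blast
  qed
  let ?K = "{y. \<Omega> *v y = 0}"
  have "\<Omega> *v g z = 0" for z
  proof -
    have 1: "(\<Sum>j\<in>UNIV. \<Omega> $ i $ j) = 0" for i
    proof -
      have "(\<Omega> *v 1) $ i = 0" using eq unfolding equilibrium_stress_matrix_def by simp
      then show ?thesis unfolding matrix_vector_mult_def by simp
    qed
    have 2: "(\<Sum>j\<in>UNIV. \<Omega> $ i $ j * p j $ b) = 0" for i b
    proof -
      have "(\<Sum>j\<in>UNIV. \<Omega> $ i $ j *\<^sub>R p j) $ b = 0" using eq unfolding equilibrium_stress_matrix_def by simp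
      then show ?thesis by simp
    qed
    have "(\<Omega> *v g z) $ i = (\<Sum>j\<in>UNIV. \<Omega> $ i $ j) * z $ None + (\<Sum>b\<in>UNIV. z $ Some b * (\<Sum>j\<in>UNIV. \<Omega> $ i $ j * p j $ b))" for i
    proof -
      have "(\<Omega> *v g z) $ i = (\<Sum>j\<in>UNIV. \<Omega> $ i $ j * z $ None) + (\<Sum>j\<in>UNIV. \<Sum>b\<in>UNIV. z $ Some b * (\<Omega> $ i $ j * p j $ b))"
        unfolding g_def matrix_vector_mult_def
        by (simp add: distrib_left sum.distrib sum_distrib_left mult_ac)
      also have "(\<Sum>j\<in>UNIV. \<Sum>b\<in>UNIV. z $ Some b * (\<Omega> $ i $ j * p j $ b)) = (\<Sum>b\<in>UNIV. \<Sum>j\<in>UNIV. z $ Some b * (\<Omega> $ i $ j * p j $ b))"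
        by (rule sum.swap)
      finally show ?thesis by (simp add: sum_distrib_left sum_distrib_right)
    qed
    then show ?thesis unfolding 1 2 by (simp add: vec_eq_iff)
  qed
  then have sub: "range g \<subseteq> ?K" by blast
  have d: "dim (range g) = CARD('d) + 1"
    using dim_image_eq[OF lg, of UNIV] inj by (simp add: card_UNIV_option)
  show "rank \<Omega> + CARD('d) + 1 \<le> CARD('n)"
    using dim_subset[OF sub] d dim_kernel_plus_rank[of \<Omega>] by linarith
  assume r: "rank \<Omega> + CARD('d) + 1 = CARD('n)" and y: "\<Omega> *v y = 0"
  have "range g = ?K"
  proof (rule subspace_dim_equal)
    show "subspace (range g)" using linear_subspace_image[OF lg subspace_UNIV] .
    show "subspace ?K" by (rule subspace_linear_kernel) simp
    show "dim ?K \<le> dim (range g)" using d r dim_kernel_plus_rank[of \<Omega>] by linarith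
  qed (rule sub)
  then obtain z where "y = g z" using y by blast
  then have "y $ i = z $ None + (\<chi> b. z $ Some b) \<bullet> p i" for i unfolding g_def inner_vec_def by simp
  then show "\<exists>\<alpha> a. \<forall>i. y $ i = \<alpha> + a \<bullet> p i" by blast
qed

text \<open>An affine function of a generic configuration that vanishes at \<open>d + 1\<close> vertices is zero. Hence, once
  the kernel consists of affine functions, a linear relation among \<open>n - d - 1\<close> columns is trivial.\<close>

lemma equilibrium_imp_Gstr:
  fixes p :: "'n::finite \<Rightarrow> real^'d::finite"
  assumes p: "generic p" and n: "CARD('d) + 1 \<le> CARD('n)" and eq: "equilibrium_stress_matrix E p \<Omega>"
    and r: "rank \<Omega> + CARD('d) + 1 = CARD('n)"
  shows "\<Omega> \<in> Gstr CARD('d) E"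
  unfolding Gstr_def mem_Collect_eq
proof (intro conjI)
  show "\<forall>J. card J + CARD('d) + 1 = CARD('n) \<longrightarrow>
      inj_on (\<lambda>j. column j \<Omega>) J \<and> independent ((\<lambda>j. column j \<Omega>) ` J)"
  proof (intro allI impI)
    fix J :: "'n set" assume J: "card J + CARD('d) + 1 = CARD('n)"
    have "card (- J) = CARD('d) + 1" using J card_Diff_subset[of J UNIV] by (simp add: Compl_eq_Diff_UNIV)
    then obtain v :: "'d option \<Rightarrow> 'n" where v: "inj v" "range v = - J" using inj_option_range by metis
    have zero: "y j = 0" if y: "(\<Sum>j\<in>J. y j *\<^sub>R column j \<Omega>) = 0" "j \<in> J" for y j
    proof -
      define u :: "real^'n" where "u = (\<chi> i. if i \<in> J then y i else 0)"
      have "\<Omega> *v u = (\<Sum>j\<in>UNIV. u $ j *\<^sub>R column j \<Omega>)"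
        unfolding matrix_mult_sum by (simp add: scalar_mult_eq_scaleR)
      also have "\<dots> = (\<Sum>j\<in>UNIV. if j \<in> J then y j *\<^sub>R column j \<Omega> else 0)"
        unfolding u_def by (intro sum.cong) auto
      also have "\<dots> = 0" using y(1) by (simp add: sum.If_cases)
      finally obtain \<alpha> a where a: "\<And>i. u $ i = \<alpha> + a \<bullet> p i" using equilibrium_kernel_affine(2)[OF p n eq r] by blast
      have "\<alpha> + a \<bullet> p (v t) = 0" for t
      proof -
        have "v t \<notin> J" using v(2) by blast
        then show ?thesis using a[of "v t"] unfolding u_def by simp
      qed
      from affine_function_zero[OF p v(1) this] have "u $ j = 0" using a by simp
      then show ?thesis using y(2) unfolding u_def by simp
    qed
    have inj: "inj_on (\<lambda>j. column j \<Omega>) J"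
    proof (rule inj_onI, rule ccontr)
      fix i j assume ij: "i \<in> J" "j \<in> J" "column i \<Omega> = column j \<Omega>" "i \<noteq> j"
      define y :: "'n \<Rightarrow> real" where "y k = (if k = i then 1 else 0) - (if k = j then 1 else 0)" for k
      have "y k *\<^sub>R column k \<Omega> = (if k = i then column i \<Omega> else 0) - (if k = j then column j \<Omega> else 0)" for k
        unfolding y_def by simp
      then have "(\<Sum>k\<in>J. y k *\<^sub>R column k \<Omega>) = 0" using ij by (simp add: sum_subtractf)
      from zero[OF this ij(1)] show False using ij(4) unfolding y_def by simp
    qed
    moreover have "independent ((\<lambda>j. column j \<Omega>) ` J)"
    proof (rule independent_if_scalars_zero)
      fix f x assume f: "(\<Sum>x\<in>(\<lambda>j. column j \<Omega>) ` J. f x *\<^sub>R x) = 0" and "x \<in> (\<lambda>j. column j \<Omega>) ` J"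
      then obtain j where j: "j \<in> J" "x = column j \<Omega>" by blast
      have "(\<Sum>j\<in>J. f (column j \<Omega>) *\<^sub>R column j \<Omega>) = 0" using f unfolding sum.reindex[OF inj] by simp
      from zero[OF this j(1)] show "f x = 0" using j(2) by simp
    qed simp
    ultimately show "inj_on (\<lambda>j. column j \<Omega>) J \<and> independent ((\<lambda>j. column j \<Omega>) ` J)" by blast
  qed
qed (use eq r in \<open>auto simp: equilibrium_stress_matrix_def\<close>)

theorem lemma7p6:
  fixes E :: "'n::finite set set" and p :: "'n \<Rightarrow> real ^ 'd::finite"
  assumes "simple_graph E"
    and "k_connected (CARD('d) + 1) E"
    and "generically_globally_rigid TYPE('d) E"
    and "generic p"
  shows "(\<exists>\<Omega> \<in> Gstr CARD('d) E. equilibrium_stress_matrix E p \<Omega>) \<and> Gstressable E p"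
proof -
  define P :: "real^'d^'n" where "P = (\<chi> i. p i)"
  have Pp: "(($) P) = p" unfolding P_def by (auto simp: fun_eq_iff)
  have gP: "generic (($) P)" unfolding Pp by (rule assms(4))
  have n: "CARD('d) + 1 \<le> CARD('n)" using assms(2) unfolding k_connected_def by simp
  have conn: "induced_connected E UNIV"
    using assms(2) unfolding k_connected_def by (metis Compl_empty_eq add_gr_0 card.empty zero_less_one)
  have bnd: "rank (stress_mat E w) < CARD('n) + 1" if "stress_act E w P = 0" for w
    using dim_kernel_stress_mat[of E w] by linarith
  have "stress_act E 0 P = 0" using linear_0[OF linear_stress_act_left] .
  from ex_has_greatest_nat[of "\<lambda>w. stress_act E w P = 0", OF this, of "\<lambda>w. rank (stress_mat E w)" "CARD('n) + 1"]
  obtain w0 where w0: "stress_act E w0 P = 0"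
      "\<And>w. stress_act E w P = 0 \<Longrightarrow> rank (stress_mat E w) \<le> rank (stress_mat E w0)"
    using bnd by (metis less_imp_le)
  have eq: "equilibrium_stress_matrix E p (stress_mat E w0)"
    using stress_mat_equilibrium w0(1) unfolding P_def by blast
  have "dim {u :: real^'n. stress_act E w0 u = 0} < CARD('d) + 2"
  proof (rule ccontr)
    assume "\<not> ?thesis"
    then have dimK: "CARD('d) + 2 \<le> dim {u :: real^'n. stress_act E w0 u = 0}" by simp
    obtain c :: "'d \<Rightarrow> real^'n" where c: "\<And>b. (\<Sum>i\<in>UNIV. c b $ i) = 0"
      "\<And>b b'. (\<Sum>i\<in>UNIV. c b $ i * P $ i $ b') = (if b = b' then 1 else 0)"
      using dual_affine_functions[OF gP n] by blast
    obtain \<rho> :: "'d \<Rightarrow> nat" where \<rho>: "inj \<rho>"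
      using finite_imp_inj_to_nat_seg[of "UNIV :: 'd set"] by auto
    \<comment> \<open>The rank of \<open>w0\<close> was maximal among stresses of \<open>P\<close>
      only. Genericity extends this to stresses of any \<open>Q\<close> whose stress space has the
      same dimension.\<close>
    have max2: "dim {u :: real^'n. stress_act E w0 u = 0} \<le> dim {u :: real^'n. stress_act E w u = 0}"
      if Q: "dim {w. stress_act E w P = 0} = dim {w. stress_act E w Q = 0}" "stress_act E w Q = 0" for Q :: "real^'d^'n" and w
    proof -
      obtain w' where "stress_act E w' P = 0" "rank (stress_mat E w) \<le> rank (stress_mat E w')"
        using generic_stress_rank_max[OF gP Q] by blast
      then have "rank (stress_mat E w) \<le> rank (stress_mat E w0)" using w0(2)[of w'] by linarith
      then show ?thesis using dim_kernel_stress_mat[of E w] dim_kernel_stress_mat[of E w0] by linarith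
    qed
    have flat: "edge_form E q q \<in> edge_form E P ` {a. stress_act E w0 a = 0}" if "stress_act E w0 q = 0" for q :: "real^'d^'n"
      by (rule stress_flatness[OF w0(1) generic_stress_space_min[OF gP] max2 that])
    have "pinned E P w0 c \<rho>"
      unfolding pinned_def
      using w0(1) \<rho> c gP assms(3) flat connected_edge_form_zero[OF conn] dimK by blast
    then show False by (rule pinned.inconsistent)
  qed
  then have r: "rank (stress_mat E w0) + CARD('d) + 1 = CARD('n)"
    using dim_kernel_stress_mat[of E w0] equilibrium_kernel_affine(1)[OF assms(4) n eq] by linarith
  have "stress_mat E w0 \<in> Gstr CARD('d) E" by (rule equilibrium_imp_Gstr[OF assms(4) n eq r])
  moreover have "Gstressable E p"
    unfolding Gstressable_def using generic_affine_general_position[OF assms(4) n] eq r by blast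
  ultimately show ?thesis using eq by blast
qed

end
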